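(* In the Bradley–Terry model, if $b_n^{11}/c_n^6=o\big(n^{1/2}/(\log n)^{5/2}\big)$, then under the homogeneous null $H_0:\beta_2=\cdots=\beta_r$ with a fixed integer $r>2$, the statistic $2\{\ell_{bt}(\widehat{\boldsymbol\beta})-\ell_{bt}(\widehat{\boldsymbol\beta}^0)\}$ converges in distribution, as $n\to\infty$, to the chi-square distribution with $r-2$ degrees of freedom, where $\widehat{\boldsymbol\beta}$ maximizes $\ell_{bt}$ over $\mathbb R^{n-1}$ and $\widehat{\boldsymbol\beta}^0$ maximizes $\ell_{bt}$ over $\Theta_0=\{\boldsymbol\beta\in\mathbb R^{n-1}:\beta_2=\cdots=\beta_r\}$.
   Context: Bradley–Terry model: subjects $1,\dots,n$; $K\ge1$ a fixed integer. For $1\le i<j\le n$, $a_{ij}\sim\mathrm{Binomial}(K,p_{ij})$ are mutually independent with $p_{ij}=e^{\beta_i-\beta_j}/(1+e^{\beta_i-\beta_j})$, and $a_{ji}=K-a_{ij}$. $\beta_1=0$, parameter $\boldsymbol\beta=(\beta_2,\dots,\beta_n)^\top$ (true value depending on $n$, satisfying the null). $d_i=\sum_{j\ne i}a_{ij}$. $\ell_{bt}(\boldsymbol\beta)=\sum_{i=1}^n\beta_id_i-K\sum_{1\le i<j\le n}\log(e^{\beta_i}+e^{\beta_j})$. $b_n=\max_{i\ne j}(1+e^{\beta_i-\beta_j})^2/e^{\beta_i-\beta_j}$, $c_n=\min_{i\ne j}(1+e^{\beta_i-\beta_j})^2/e^{\beta_i-\beta_j}$ at the true parameter. *)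

theory Defs
  imports "HOL-Probability.Probability" "HOL-Library.Landau_Symbols"
begin

text \<open>Subjects are 1..n; a parameter vector is a function nat => real of which only
  the values at 1..n matter, with b 1 = 0 (so the free parameters are b 2, ..., b n).\<close>

definition bt_prob :: "real \<Rightarrow> real \<Rightarrow> real" where
  "bt_prob bi bj = exp (bi - bj) / (1 + exp (bi - bj))"

definition bt_pairs :: "nat \<Rightarrow> (nat \<times> nat) set" where
  "bt_pairs n = {(i, j). 1 \<le> i \<and> i < j \<and> j \<le> n}"

definition bt_data :: "nat \<Rightarrow> nat \<Rightarrow> (nat \<Rightarrow> real) \<Rightarrow> (nat \<times> nat \<Rightarrow> nat) pmf" where
  "bt_data K n beta = Pi_pmf (bt_pairs n) 0
      (\<lambda>(i, j). binomial_pmf K (bt_prob (beta i) (beta j)))"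

definition bt_count :: "nat \<Rightarrow> (nat \<times> nat \<Rightarrow> nat) \<Rightarrow> nat \<Rightarrow> nat \<Rightarrow> real" where
  "bt_count K a i j = (if i < j then real (a (i, j)) else real K - real (a (j, i)))"

definition bt_degree :: "nat \<Rightarrow> nat \<Rightarrow> (nat \<times> nat \<Rightarrow> nat) \<Rightarrow> nat \<Rightarrow> real" where
  "bt_degree K n a i = (\<Sum>j\<in>{1..n} - {i}. bt_count K a i j)"

definition ell_bt :: "nat \<Rightarrow> nat \<Rightarrow> (nat \<times> nat \<Rightarrow> nat) \<Rightarrow> (nat \<Rightarrow> real) \<Rightarrow> real" where
  "ell_bt K n a b = (\<Sum>i=1..n. b i * bt_degree K n a i)
      - real K * (\<Sum>(i, j)\<in>bt_pairs n. ln (exp (b i) + exp (b j)))"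

definition bt_space :: "(nat \<Rightarrow> real) set" where
  "bt_space = {b. b 1 = 0}"

definition bt_null_space :: "nat \<Rightarrow> (nat \<Rightarrow> real) set" where
  "bt_null_space r = {b. b 1 = 0 \<and> (\<forall>i\<in>{2..r}. b i = b 2)}"

text \<open>Likelihood-ratio statistic 2 (l(beta_hat) - l(beta_hat^0)), with the maximized
  log-likelihoods written as suprema (they equal the values at the maximizers).\<close>
definition bt_lrt :: "nat \<Rightarrow> nat \<Rightarrow> nat \<Rightarrow> (nat \<times> nat \<Rightarrow> nat) \<Rightarrow> real" where
  "bt_lrt K n r a = 2 * ((SUP b\<in>bt_space. ell_bt K n a b) - (SUP b\<in>bt_null_space r. ell_bt K n a b))"

definition bt_ratio :: "(nat \<Rightarrow> real) \<Rightarrow> nat \<Rightarrow> nat \<Rightarrow> real" where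
  "bt_ratio beta i j = (1 + exp (beta i - beta j))^2 / exp (beta i - beta j)"

definition bt_b :: "nat \<Rightarrow> (nat \<Rightarrow> real) \<Rightarrow> real" where
  "bt_b n beta = Max {bt_ratio beta i j | i j. i \<in> {1..n} \<and> j \<in> {1..n} \<and> i \<noteq> j}"

definition bt_c :: "nat \<Rightarrow> (nat \<Rightarrow> real) \<Rightarrow> real" where
  "bt_c n beta = Min {bt_ratio beta i j | i j. i \<in> {1..n} \<and> j \<in> {1..n} \<and> i \<noteq> j}"

definition chi_square_density :: "nat \<Rightarrow> real \<Rightarrow> real" where
  "chi_square_density k x = (if x > 0 then
      x powr (real k / 2 - 1) * exp (- x / 2) / (2 powr (real k / 2) * Gamma (real k / 2))
    else 0)"

definition chi_square :: "nat \<Rightarrow> real measure" where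
  "chi_square k = density lborel (\<lambda>x. ennreal (chi_square_density k x))"

end

theory Submission
  imports Defs
begin

text \<open>Let B = {2..r} and m = r - 1. For parameters b^0 that are constant on B, the Hessian of the
  log-likelihood is exchangeable on B, so contrasts supported on B are eigenvectors of it and are
  orthogonal to the null space; no inversion of the growing information matrix is needed. If moreover
  the common value on B is optimal for the remaining coordinates, then the gradient on B is
  g_i = d_i - mean(d), whatever the other coordinates are. Hence optimizing over the block alone gains
  sum g_i^2 / (2 L) with L = K * sum over j outside B of p_j (1 - p_j), up to a factor tending to 1,
  and taking suprema over the other coordinates yields the likelihood-ratio statistic without any
  reference to the maximizers. Uniformity only requires L at b^0 to be close to its true value,
  which follows from an average (L^1) consistency bound for every parameter at least as likely as the
  truth; this uses Hoeffding's inequality for the degrees and the self-concordance of the logistic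
  function. Finally, g_i differs by a bounded amount from the centred comparisons of i with the
  subjects outside B. These are independent over i in B, so the central limit theorem, Skorohod's
  theorem on a product space and Helmert's decomposition give the chi-square limit. Since
  beta_2 = beta_3, the constant c_n equals 4, and the rate makes b_n^3 sqrt(log n / n) vanish.\<close>

section \<open>The chi-square distribution\<close>

text \<open>The cube of \<open>b\<close> is the product of three separate losses. The scores
  fluctuate by about \<open>n * sqrt (ln n / n)\<close>, up to the factor \<open>K\<close>; the
  curvature of a comparison may be as small as \<open>1 / b\<close>, so the average error of a
  parameter is \<open>\<tau>\<close>, of order \<open>b * sqrt (ln n / n)\<close>. Solving for the
  block coordinate divides by the curvature again and locates it within \<open>\<eta>\<close>, of
  order \<open>b * \<tau>\<close>. Comparing the perturbed information with a total that may be as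
  small as \<open>n / b\<close> costs the third factor. An average error is enough because a sum of
  \<open>logistic'\<close> over the outside subjects is Lipschitz in the L^1 norm; no single
  coordinate is controlled, not even the normalizing coordinate 1 relative to the others. As the
  likelihood sees differences only, errors are measured up to a common shift \<open>z\<close>. Every
  parameter is compared with one that has the same coordinates outside the block, so errors enter as
  factors close to 1. This is why the statistic and its limit object are linked by inequalities in
  both directions.\<close>

lemma std_normal_rotation:
  fixes h :: "real \<times> real \<Rightarrow> ennreal" and c d :: real
  assumes [measurable]: "h \<in> borel_measurable (borel \<Otimes>\<^sub>M borel)"
    and cd: "c\<^sup>2 + d\<^sup>2 = 1" "d > 0"
  shows "(\<integral>\<^sup>+s. \<integral>\<^sup>+y. h (c * s + d * y, d * s - c * y) \<partial>std_normal_distribution \<partial>std_normal_distribution)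
       = (\<integral>\<^sup>+u. \<integral>\<^sup>+v. h (u, v) \<partial>std_normal_distribution \<partial>std_normal_distribution)"
proof -
  let ?p = "\<lambda>x. ennreal (std_normal_density x)"
  have d: "d \<noteq> 0" using cd by auto
  \<comment> \<open>The map from \<open>(s, y)\<close> to
    \<open>(c * s + d * y, d * s - c * y)\<close> is an orthogonal reflection. Instead of a
    two-dimensional change of variables, \<open>y\<close> is replaced by \<open>u\<close> with
    \<open>s\<close> fixed, and after Fubini \<open>s\<close> is replaced by \<open>v\<close> with
    \<open>u\<close> fixed. This identity exchanges the density factors between the two
    substitutions.\<close>
  have dens: "?p s * ?p ((u - c * s) / d) = ?p u * ?p ((s - c * u) / d)" for s u
  proof -
    have "s\<^sup>2 + ((u - c * s) / d)\<^sup>2 = (s\<^sup>2 * (c\<^sup>2 + d\<^sup>2) + u\<^sup>2 - 2 * u * c * s) / d\<^sup>2"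
      using d by (simp add: field_simps power2_eq_square)
    moreover have "u\<^sup>2 + ((s - c * u) / d)\<^sup>2 = (u\<^sup>2 * (c\<^sup>2 + d\<^sup>2) + s\<^sup>2 - 2 * u * c * s) / d\<^sup>2"
      using d by (simp add: field_simps power2_eq_square)
    ultimately have "s\<^sup>2 + ((u - c * s) / d)\<^sup>2 = u\<^sup>2 + ((s - c * u) / d)\<^sup>2"
      using cd by simp
    then have "exp (- s\<^sup>2 / 2) * exp (- ((u - c * s) / d)\<^sup>2 / 2) = exp (- u\<^sup>2 / 2) * exp (- ((s - c * u) / d)\<^sup>2 / 2)"
      unfolding exp_add[symmetric] by (simp add: field_simps)
    then have "std_normal_density s * std_normal_density ((u - c * s) / d) = std_normal_density u * std_normal_density ((s - c * u) / d)"
      by (simp add: std_normal_density_def)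
    then show ?thesis by (simp add: ennreal_mult[symmetric])
  qed
  have "(\<integral>\<^sup>+s. \<integral>\<^sup>+y. h (c * s + d * y, d * s - c * y) \<partial>std_normal_distribution \<partial>std_normal_distribution)
      = (\<integral>\<^sup>+s. ?p s * (\<integral>\<^sup>+y. ?p y * h (c * s + d * y, d * s - c * y) \<partial>lborel) \<partial>lborel)"
    by (simp add: nn_integral_density)
  also have "\<dots> = (\<integral>\<^sup>+s. \<integral>\<^sup>+u. ennreal (1/d) * (?p s * ?p ((u - c * s) / d) * h (u, (s - c * u) / d)) \<partial>lborel \<partial>lborel)"
  proof (intro nn_integral_cong)
    fix s :: real
    have e: "d * s - c * (- (c * s / d) + 1 / d * u) = (s - c * u) / d" for u
    proof -
      have "d * s - c * (- (c * s / d) + 1 / d * u) = (s * (c\<^sup>2 + d\<^sup>2) - c * u) / d"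
        using d by (simp add: field_simps power2_eq_square)
      then show ?thesis using cd by simp
    qed
    have "(\<integral>\<^sup>+y. ?p y * h (c * s + d * y, d * s - c * y) \<partial>lborel)
       = \<bar>1/d\<bar> * (\<integral>\<^sup>+u. ?p (- (c * s / d) + 1/d * u) * h (c * s + d * (- (c * s / d) + 1/d * u), d * s - c * (- (c * s / d) + 1/d * u)) \<partial>lborel)"
      using d by (subst nn_integral_real_affine[where c = "1/d" and t = "- (c * s / d)"]) simp_all
    also have "\<dots> = ennreal (1/d) * (\<integral>\<^sup>+u. ?p ((u - c * s) / d) * h (u, (s - c * u) / d) \<partial>lborel)"
    proof -
      have "- (c * s / d) + 1/d * u = (u - c * s) / d" "c * s + d * ((u - c * s) / d) = u" for u
        using d by (simp_all add: field_simps)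
      then show ?thesis using e cd(2) by simp
    qed
    finally show "?p s * (\<integral>\<^sup>+y. ?p y * h (c * s + d * y, d * s - c * y) \<partial>lborel) =
      (\<integral>\<^sup>+u. ennreal (1/d) * (?p s * ?p ((u - c * s) / d) * h (u, (s - c * u) / d)) \<partial>lborel)"
      by (simp add: nn_integral_cmult[symmetric] mult_ac)
  qed
  also have "\<dots> = (\<integral>\<^sup>+u. \<integral>\<^sup>+s. ennreal (1/d) * (?p s * ?p ((u - c * s) / d) * h (u, (s - c * u) / d)) \<partial>lborel \<partial>lborel)"
    by (rule lborel_pair.Fubini') measurable
  also have "\<dots> = (\<integral>\<^sup>+u. \<integral>\<^sup>+s. ennreal (1/d) * (?p u * ?p ((s - c * u) / d) * h (u, (s - c * u) / d)) \<partial>lborel \<partial>lborel)"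
    by (subst dens) (rule refl)
  also have "\<dots> = (\<integral>\<^sup>+u. ?p u * (\<integral>\<^sup>+v. ?p v * h (u, v) \<partial>lborel) \<partial>lborel)"
  proof (intro nn_integral_cong)
    fix u :: real
    have "(\<integral>\<^sup>+s. ennreal (1/d) * (?p u * ?p ((s - c * u) / d) * h (u, (s - c * u) / d)) \<partial>lborel)
      = \<bar>d\<bar> * (\<integral>\<^sup>+v. ennreal (1/d) * (?p u * ?p ((c * u + d * v - c * u) / d) * h (u, (c * u + d * v - c * u) / d)) \<partial>lborel)"
      using d by (subst nn_integral_real_affine[where c = d and t = "c * u"]) simp_all
    also have "\<dots> = ennreal d * (ennreal (1/d) * (?p u * (\<integral>\<^sup>+v. ?p v * h (u, v) \<partial>lborel)))"
      using d cd(2) by (simp add: nn_integral_cmult[symmetric] mult_ac)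
    also have "\<dots> = ?p u * (\<integral>\<^sup>+v. ?p v * h (u, v) \<partial>lborel)"
      using d cd(2) by (simp add: mult.assoc[symmetric] ennreal_mult[symmetric])
    finally show "(\<integral>\<^sup>+s. ennreal (1/d) * (?p u * ?p ((s - c * u) / d) * h (u, (s - c * u) / d)) \<partial>lborel)
      = ?p u * (\<integral>\<^sup>+v. ?p v * h (u, v) \<partial>lborel)" .
  qed
  also have "\<dots> = (\<integral>\<^sup>+u. \<integral>\<^sup>+v. h (u, v) \<partial>std_normal_distribution \<partial>std_normal_distribution)"
    by (simp add: nn_integral_density)
  finally show ?thesis .
qed

section \<open>Chi-square densities, their total mass, and one degree of freedom\<close>

lemma borel_measurable_chi_square_density [measurable]:
  "chi_square_density k \<in> borel_measurable borel"
  unfolding chi_square_density_def[abs_def] by measurable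

lemma chi_square_density_nonneg: "0 \<le> chi_square_density k x"
  unfolding chi_square_density_def by (cases "k = 0") (auto intro!: divide_nonneg_nonneg Gamma_real_nonneg)

lemma sets_chi_square [measurable_cong, simp]: "sets (chi_square k) = sets borel"
  by (simp add: chi_square_def)

lemma space_chi_square [simp]: "space (chi_square k) = UNIV"
  by (simp add: chi_square_def)

lemma nn_integral_chi_square:
  "f \<in> borel_measurable borel \<Longrightarrow>
    (\<integral>\<^sup>+x. f x \<partial>chi_square k) = (\<integral>\<^sup>+x. ennreal (chi_square_density k x) * f x \<partial>lborel)"
  unfolding chi_square_def by (subst nn_integral_density) auto

lemma nn_integral_chi_square_density:
  assumes "k > 0"
  shows "(\<integral>\<^sup>+x. ennreal (chi_square_density k x) \<partial>lborel) = 1"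
proof -
  define a where "a = real k / 2"
  have a: "a > 0" using assms by (simp add: a_def)
  have G: "Gamma a > 0" using a by (rule Gamma_real_pos)
  \<comment> \<open>Doubling the variable turns the density into the normalized integrand of the
    Gamma integral; \<open>0 + 2 * t\<close> is the shape that the affine substitution
    produces.\<close>
  have eq: "chi_square_density k (0 + 2 * t) = indicator {0..} t * t powr (a - 1) / exp t / (2 * Gamma a)" if "t \<noteq> 0" for t
  proof (cases "t > 0")
    case True
    have "2 powr a = 2 * 2 powr (a - 1)"
      by (simp add: powr_diff)
    then show ?thesis using True G
      by (simp add: chi_square_density_def a_def[symmetric] powr_mult exp_minus field_simps)
  qed (use that in \<open>auto simp: chi_square_density_def\<close>)
  have "(\<integral>\<^sup>+x. ennreal (chi_square_density k x) \<partial>lborel)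
      = 2 * (\<integral>\<^sup>+t. ennreal (chi_square_density k (0 + 2 * t)) \<partial>lborel)"
    by (subst nn_integral_real_affine[where c = 2 and t = 0]) auto
  also have "(\<integral>\<^sup>+t. ennreal (chi_square_density k (0 + 2 * t)) \<partial>lborel)
      = (\<integral>\<^sup>+t. ennreal (indicator {0..} t * t powr (a - 1) / exp t) * ennreal (1 / (2 * Gamma a)) \<partial>lborel)"
    by (intro nn_integral_cong_AE eventually_mono[OF AE_lborel_singleton[of 0]])
       (use G in \<open>auto simp: eq ennreal_mult[symmetric] simp del: add_0\<close>)
  also have "\<dots> = ennreal (Gamma a) * ennreal (1 / (2 * Gamma a))"
    by (subst nn_integral_multc) (simp_all add: Gamma_conv_nn_integral_real[OF a])
  also have "2 * \<dots> = ennreal (2 * (Gamma a * (1 / (2 * Gamma a))))"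
    using G by (subst ennreal_mult, simp, simp, subst ennreal_mult) simp_all
  also have "\<dots> = 1" using G by simp
  finally show ?thesis .
qed

lemma prob_space_chi_square: "k > 0 \<Longrightarrow> prob_space (chi_square k)"
  by (intro prob_spaceI) (simp add: chi_square_def emeasure_density nn_integral_chi_square_density)

lemma real_distribution_chi_square: "k > 0 \<Longrightarrow> real_distribution (chi_square k)"
  by (intro real_distribution.intro prob_space_chi_square real_distribution_axioms.intro) auto

lemma prob_space_std_normal: "prob_space std_normal_distribution"
  using real_dist_normal_dist by (simp add: real_distribution_def)

lemma distr_std_normal_square:
  "distr std_normal_distribution borel (\<lambda>w. w\<^sup>2) = chi_square 1"
proof (intro cdf_unique ext)
  interpret N: prob_space std_normal_distribution by (rule prob_space_std_normal)
  show "real_distribution (distr std_normal_distribution borel (\<lambda>w. w\<^sup>2))"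
    by (rule N.real_distribution_distr) simp
  show "real_distribution (chi_square 1)" by (rule real_distribution_chi_square) simp
  fix x :: real
  have "emeasure (distr std_normal_distribution borel (\<lambda>w. w\<^sup>2)) {..x} = emeasure (chi_square 1) {..x}"
  proof (cases "x \<ge> 0")
    case False
    then have "(\<lambda>w::real. w\<^sup>2) -` {..x} = {}"
      by (auto simp: not_le) (metis not_less order_trans zero_le_power2)
    moreover have "emeasure (chi_square 1) {..x} = 0"
    proof -
      have "emeasure (chi_square 1) {..x} = (\<integral>\<^sup>+t. ennreal (chi_square_density 1 t) * indicator {..x} t \<partial>lborel)"
        unfolding chi_square_def by (rule emeasure_density) auto
      also have "\<dots> = (\<integral>\<^sup>+t. 0 \<partial>(lborel :: real measure))"
        by (intro nn_integral_cong) (use False in \<open>auto simp: chi_square_density_def split: split_indicator\<close>)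
      finally show ?thesis by simp
    qed
    ultimately show ?thesis
      by (subst emeasure_distr) auto
  next
    case True
    let ?r = "sqrt x"
    \<comment> \<open>\<open>2 * w\<close> is the Jacobian of squaring; the factor 2 on the right
      accounts for the two square roots of a positive number, whose contributions are merged by
      symmetry below.\<close>
    have dens: "chi_square_density 1 (w\<^sup>2) * (2 * w) = 2 * std_normal_density w" if "w > 0" for w
    proof -
      have "(w\<^sup>2) powr (-1/2) = inverse w"
        using that by (simp add: powr_minus powr_half_sqrt)
      then show ?thesis using that
        by (simp add: chi_square_density_def std_normal_density_def Gamma_one_half_real powr_half_sqrt real_sqrt_mult field_simps)
    qed
    have vim: "(\<lambda>w::real. w\<^sup>2) -` {..x} = {- ?r..?r}"
      using True by (auto simp: real_le_rsqrt real_sqrt_ge_abs1 dest: real_sqrt_le_mono)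
         (use True in \<open>auto simp: abs_le_iff real_sqrt_abs dest: real_sqrt_le_mono intro: sqrt_ge_absD\<close>)
    have "emeasure (distr std_normal_distribution borel (\<lambda>w. w\<^sup>2)) {..x}
        = (\<integral>\<^sup>+w. ennreal (std_normal_density w) * indicator {- ?r..?r} w \<partial>lborel)"
      by (subst emeasure_distr) (auto simp: vim emeasure_density)
    also have "\<dots> = (\<integral>\<^sup>+w. ennreal (std_normal_density w) * indicator {- ?r..0} w
         + ennreal (std_normal_density w) * indicator {0..?r} w \<partial>lborel)"
      by (intro nn_integral_cong_AE eventually_mono[OF AE_lborel_singleton[of 0]])
         (use True in \<open>auto split: split_indicator\<close>)
    also have "\<dots> = (\<integral>\<^sup>+w. ennreal (std_normal_density w) * indicator {- ?r..0} w \<partial>lborel)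
         + (\<integral>\<^sup>+w. ennreal (std_normal_density w) * indicator {0..?r} w \<partial>lborel)"
      by (rule nn_integral_add) auto
    also have "(\<integral>\<^sup>+w. ennreal (std_normal_density w) * indicator {- ?r..0} w \<partial>lborel)
        = (\<integral>\<^sup>+w. ennreal (std_normal_density w) * indicator {0..?r} w \<partial>lborel)"
      by (subst nn_integral_real_affine[where c = "-1" and t = 0])
         (auto intro!: nn_integral_cong simp: std_normal_density_def split: split_indicator)
    also have "(\<integral>\<^sup>+w. ennreal (std_normal_density w) * indicator {0..?r} w \<partial>lborel) +
         (\<integral>\<^sup>+w. ennreal (std_normal_density w) * indicator {0..?r} w \<partial>lborel)
       = (\<integral>\<^sup>+w. ennreal (std_normal_density w) * indicator {0..?r} w + ennreal (std_normal_density w) * indicator {0..?r} w \<partial>lborel)"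
      by (rule nn_integral_add[symmetric]) auto
    also have "\<dots> = (\<integral>\<^sup>+w. ennreal (chi_square_density 1 (w\<^sup>2) * (2 * w) * indicator {0..?r} w) \<partial>lborel)"
      using dens
      by (intro nn_integral_cong_AE eventually_mono[OF AE_lborel_singleton[of 0]])
         (auto split: split_indicator simp: ennreal_plus[symmetric] ennreal_mult[symmetric] chi_square_density_nonneg simp del: ennreal_plus)
    also have "\<dots> = (\<integral>\<^sup>+t. ennreal (chi_square_density 1 t * indicator {0\<^sup>2..?r\<^sup>2} t) \<partial>lborel)"
      by (rule nn_integral_substitution[where g = "\<lambda>w. w\<^sup>2" and g' = "\<lambda>w. 2 * w" and a = 0, symmetric])
         (use True in \<open>auto intro!: derivative_eq_intros continuous_intros simp: set_borel_measurable_def chi_square_density_nonneg\<close>)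
    also have "\<dots> = (\<integral>\<^sup>+t. ennreal (chi_square_density 1 t) * indicator {..x} t \<partial>lborel)"
      using True by (intro nn_integral_cong) (auto split: split_indicator simp: chi_square_density_def)
    also have "\<dots> = emeasure (chi_square 1) {..x}"
      unfolding chi_square_def by (subst emeasure_density) auto
    finally show ?thesis .
  qed
  then show "cdf (distr std_normal_distribution borel (\<lambda>w. w\<^sup>2)) x = cdf (chi_square 1) x"
    by (simp add: cdf_def measure_def)
qed

text \<open>In the convolution integral at \<open>t\<close>, put \<open>w = sqrt t * u\<close>, with
  Jacobian \<open>sqrt t\<close>. The exponentials combine to \<open>exp (- t / 2)\<close> and the
  powers of \<open>t\<close> collect, so the integrand splits into a function of \<open>u\<close>
  alone times the density with one more degree of freedom.\<close>

lemma chi_square_density_scale: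
  assumes "k > 0" "t > 0"
  defines "c \<equiv> 2 powr (real (k + 1) / 2) * Gamma (real (k + 1) / 2) / (sqrt (2 * pi) * 2 powr (real k / 2) * Gamma (real k / 2))"
  shows "sqrt t * (std_normal_density (sqrt t * u) * chi_square_density k (t - (sqrt t * u)\<^sup>2)) =
    (if u\<^sup>2 < 1 then c * (1 - u\<^sup>2) powr (real k / 2 - 1) else 0) * chi_square_density (k + 1) t"
proof (cases "u\<^sup>2 < 1")
  case False
  moreover have "t * u\<^sup>2 \<ge> t" using False assms by simp
  ultimately show ?thesis using assms
    by (simp add: chi_square_density_def power_mult_distrib)
next
  case True
  define a where "a = real k / 2"
  define A B where "A = Gamma a" and "B = Gamma (a + 1/2)"
  have A: "A > 0" "B > 0" using assms(1) unfolding A_def B_def by (auto simp: a_def intro!: Gamma_real_pos)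
  have a1: "real (k + 1) / 2 = a + 1/2" by (simp add: a_def field_simps)
  have tu: "t - (sqrt t * u)\<^sup>2 = t * (1 - u\<^sup>2)"
    using assms by (simp add: power_mult_distrib algebra_simps)
  have pos: "t * (1 - u\<^sup>2) > 0" using assms True by simp
  have e: "exp (- (sqrt t * u)\<^sup>2 / 2) * exp (- (t * (1 - u\<^sup>2)) / 2) = exp (- t / 2)"
    unfolding exp_add[symmetric] using assms by (simp add: field_simps power_mult_distrib)
  have p: "(t * (1 - u\<^sup>2)) powr (a - 1) * sqrt t = (1 - u\<^sup>2) powr (a - 1) * t powr (a + 1/2 - 1)"
  proof -
    have "t powr (a + 1/2 - 1) = t powr (a - 1) * sqrt t"
      using assms by (simp add: powr_half_sqrt[symmetric] powr_add[symmetric])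
    then show ?thesis using assms True by (simp add: powr_mult)
  qed
  have "sqrt t * (std_normal_density (sqrt t * u) * chi_square_density k (t - (sqrt t * u)\<^sup>2))
     = (exp (- (sqrt t * u)\<^sup>2 / 2) * exp (- (t * (1 - u\<^sup>2)) / 2)) * ((t * (1 - u\<^sup>2)) powr (a - 1) * sqrt t) / (sqrt (2 * pi) * 2 powr a * A)"
    using pos by (simp only: tu chi_square_density_def std_normal_density_def a_def[symmetric] A_def[symmetric]) (simp add: field_simps)
  also have "\<dots> = (1 - u\<^sup>2) powr (a - 1) * (t powr (a + 1/2 - 1) * exp (- t / 2)) / (sqrt (2 * pi) * 2 powr a * A)"
    unfolding e p by (simp add: field_simps)
  also have "t powr (a + 1/2 - 1) * exp (- t / 2) = chi_square_density (k + 1) t * (2 powr (a + 1/2) * B)"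
    unfolding chi_square_density_def a1 B_def[symmetric] using A assms by simp
  finally show ?thesis
    using True unfolding c_def a1 a_def[symmetric] A_def[symmetric] B_def[symmetric] by simp
qed

text \<open>The scaling lemma determines the convolution only up to a constant factor (a Beta integral); the
  factor is 1 because both sides have total mass 1.\<close>

lemma chi_square_add_square:
  assumes k: "k > 0" and f [measurable]: "f \<in> borel_measurable borel"
  shows "(\<integral>\<^sup>+q. \<integral>\<^sup>+w. f (q + w\<^sup>2) \<partial>std_normal_distribution \<partial>chi_square k) = (\<integral>\<^sup>+t. f t \<partial>chi_square (k + 1))"
proof -
  let ?p = "\<lambda>x. ennreal (std_normal_density x)" and ?x = "\<lambda>k x. ennreal (chi_square_density k x)"
  define h where "h u = (if u\<^sup>2 < 1 then 2 powr (real (k + 1) / 2) * Gamma (real (k + 1) / 2) / (sqrt (2 * pi) * 2 powr (real k / 2) * Gamma (real k / 2)) * (1 - u\<^sup>2) powr (real k / 2 - 1) else 0)" for u :: real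
  have h0: "h u \<ge> 0" for u
    using k unfolding h_def by (auto intro!: mult_nonneg_nonneg divide_nonneg_nonneg Gamma_real_nonneg)
  have [measurable]: "h \<in> borel_measurable borel" unfolding h_def[abs_def] by measurable
  define C where "C = (\<integral>\<^sup>+u. ennreal (h u) \<partial>lborel)"
  have inner: "(\<integral>\<^sup>+w. ?p w * ?x k (t - w\<^sup>2) \<partial>lborel) = C * ?x (k + 1) t" for t
  proof (cases "t > 0")
    case True
    have "(\<integral>\<^sup>+w. ?p w * ?x k (t - w\<^sup>2) \<partial>lborel) = \<bar>sqrt t\<bar> * (\<integral>\<^sup>+u. ?p (0 + sqrt t * u) * ?x k (t - (0 + sqrt t * u)\<^sup>2) \<partial>lborel)"
      using True by (subst nn_integral_real_affine[where c = "sqrt t" and t = 0]) auto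
    also have "\<dots> = (\<integral>\<^sup>+u. ennreal (sqrt t * (std_normal_density (sqrt t * u) * chi_square_density k (t - (sqrt t * u)\<^sup>2))) \<partial>lborel)"
      using True by (subst nn_integral_cmult[symmetric]) (auto simp: ennreal_mult chi_square_density_nonneg)
    also have "\<dots> = (\<integral>\<^sup>+u. ennreal (h u) * ?x (k + 1) t \<partial>lborel)"
      unfolding chi_square_density_scale[OF k True] h_def[symmetric]
      by (simp add: ennreal_mult h0 chi_square_density_nonneg)
    also have "\<dots> = C * ?x (k + 1) t"
      unfolding C_def by (rule nn_integral_multc) simp
    finally show ?thesis .
  next
    case False
    then have "\<not> 0 < t - w\<^sup>2" for w :: real
      using zero_le_power2[of w] by linarith
    then show ?thesis using False by (simp add: chi_square_density_def)
  qed
  have conv: "(\<integral>\<^sup>+q. \<integral>\<^sup>+w. f (q + w\<^sup>2) \<partial>std_normal_distribution \<partial>chi_square k) = C * (\<integral>\<^sup>+t. f t \<partial>chi_square (k + 1))"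
    if [measurable]: "f \<in> borel_measurable borel" for f
  proof -
    have "(\<integral>\<^sup>+q. \<integral>\<^sup>+w. f (q + w\<^sup>2) \<partial>std_normal_distribution \<partial>chi_square k)
       = (\<integral>\<^sup>+q. \<integral>\<^sup>+w. ?x k q * (?p w * f (q + w\<^sup>2)) \<partial>lborel \<partial>lborel)"
      by (simp add: nn_integral_chi_square nn_integral_density nn_integral_cmult)
    also have "\<dots> = (\<integral>\<^sup>+w. \<integral>\<^sup>+q. ?x k q * (?p w * f (q + w\<^sup>2)) \<partial>lborel \<partial>lborel)"
      by (rule lborel_pair.Fubini') measurable
    also have "\<dots> = (\<integral>\<^sup>+w. \<integral>\<^sup>+t. f t * (?p w * ?x k (t - w\<^sup>2)) \<partial>lborel \<partial>lborel)"
    proof (rule nn_integral_cong)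
      fix w :: real
      show "(\<integral>\<^sup>+q. ?x k q * (?p w * f (q + w\<^sup>2)) \<partial>lborel) = (\<integral>\<^sup>+t. f t * (?p w * ?x k (t - w\<^sup>2)) \<partial>lborel)"
        by (subst nn_integral_real_affine[where c = 1 and t = "- w\<^sup>2"]) (auto simp: mult_ac add_ac)
    qed
    also have "\<dots> = (\<integral>\<^sup>+t. \<integral>\<^sup>+w. f t * (?p w * ?x k (t - w\<^sup>2)) \<partial>lborel \<partial>lborel)"
      by (rule lborel_pair.Fubini') measurable
    also have "\<dots> = (\<integral>\<^sup>+t. C * (?x (k + 1) t * f t) \<partial>lborel)"
      by (simp add: nn_integral_cmult inner mult_ac)
    also have "\<dots> = C * (\<integral>\<^sup>+t. f t \<partial>chi_square (k + 1))"
      by (simp add: nn_integral_cmult nn_integral_chi_square)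
    finally show ?thesis .
  qed
  interpret N: prob_space std_normal_distribution by (rule prob_space_std_normal)
  interpret X: prob_space "chi_square k" by (rule prob_space_chi_square[OF k])
  interpret X': prob_space "chi_square (k + 1)" by (rule prob_space_chi_square) simp
  have "C = 1"
    using conv[of "\<lambda>_. 1"] X.emeasure_space_1 X'.emeasure_space_1 N.emeasure_space_1 by simp
  then show ?thesis using conv[OF f] by simp
qed

text \<open>Including the point mass at 0 lets the recursion start from a single coordinate.\<close>

definition chi_square0 :: "nat \<Rightarrow> real measure" where
  "chi_square0 k = (if k = 0 then return borel 0 else chi_square k)"

lemma sets_chi_square0 [measurable_cong, simp]: "sets (chi_square0 k) = sets borel"
  by (simp add: chi_square0_def)

lemma prob_space_chi_square0: "prob_space (chi_square0 k)"
  by (simp add: chi_square0_def prob_space_chi_square prob_space_return)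

lemma chi_square0_add_square:
  assumes [measurable]: "f \<in> borel_measurable borel"
  shows "(\<integral>\<^sup>+q. \<integral>\<^sup>+w. f (q + w\<^sup>2) \<partial>std_normal_distribution \<partial>chi_square0 k) = (\<integral>\<^sup>+t. f t \<partial>chi_square0 (k + 1))"
proof (cases "k = 0")
  case True
  interpret N: prob_space std_normal_distribution by (rule prob_space_std_normal)
  have "(\<integral>\<^sup>+q. \<integral>\<^sup>+w. f (q + w\<^sup>2) \<partial>std_normal_distribution \<partial>return borel 0) = (\<integral>\<^sup>+w. f (0 + w\<^sup>2) \<partial>std_normal_distribution)"
    by (subst nn_integral_return) (auto intro!: N.borel_measurable_nn_integral)
  also have "\<dots> = (\<integral>\<^sup>+t. f t \<partial>distr std_normal_distribution borel (\<lambda>w. w\<^sup>2))"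
    by (subst nn_integral_distr) auto
  finally show ?thesis using True by (simp add: chi_square0_def distr_std_normal_square del: nn_integral_return)
qed (use chi_square_add_square in \<open>simp add: chi_square0_def\<close>)

text \<open>Helmert's decomposition, one coordinate at a time: adding a coordinate y rotates the pair
  formed by the normalized sum and y.\<close>

lemma nn_integral_PiM_std_normal_sum_sq:
  fixes I :: "'i set" and F :: "real \<times> real \<Rightarrow> ennreal"
  assumes I: "finite I" "I \<noteq> {}" and F: "F \<in> borel_measurable (borel \<Otimes>\<^sub>M borel)"
  shows "(\<integral>\<^sup>+z. F ((\<Sum>i\<in>I. z i) / sqrt (card I), (\<Sum>i\<in>I. (z i)\<^sup>2) - (\<Sum>i\<in>I. z i)\<^sup>2 / card I) \<partial>(\<Pi>\<^sub>M i\<in>I. std_normal_distribution))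
    = (\<integral>\<^sup>+q. \<integral>\<^sup>+s. F (s, q) \<partial>std_normal_distribution \<partial>chi_square0 (card I - 1))"
  using I F
proof (induction I arbitrary: F rule: finite_ne_induct)
  case (singleton i)
  note [measurable] = singleton
  interpret N: prob_space std_normal_distribution by (rule prob_space_std_normal)
  interpret P: product_sigma_finite "\<lambda>_::'i. std_normal_distribution"
    by unfold_locales
  have "(\<integral>\<^sup>+z. F (z i, 0) \<partial>(\<Pi>\<^sub>M i\<in>{i}. std_normal_distribution)) = (\<integral>\<^sup>+s. F (s, 0) \<partial>std_normal_distribution)"
    by (rule P.product_nn_integral_singleton) simp
  also have "\<dots> = (\<integral>\<^sup>+q. \<integral>\<^sup>+s. F (s, q) \<partial>std_normal_distribution \<partial>return borel 0)"
    by (subst nn_integral_return) (auto intro!: N.borel_measurable_nn_integral)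
  finally show ?case by (simp add: chi_square0_def del: nn_integral_return)
next
  case (insert i I)
  note [measurable] = insert.prems
  interpret N: prob_space std_normal_distribution by (rule prob_space_std_normal)
  interpret P: product_sigma_finite "\<lambda>_::'i. std_normal_distribution"
    by unfold_locales
  interpret C: prob_space "chi_square0 k" for k by (rule prob_space_chi_square0)
  interpret NC: pair_sigma_finite std_normal_distribution "chi_square0 k" for k ..
  define k where "k = real (card I)"
  have k: "k > 0" using insert by (simp add: k_def card_gt_0_iff)
  \<comment> \<open>With \<open>s\<close> the normalized sum of the \<open>k\<close> old
    coordinates, \<open>c * s + d * y\<close> is the normalized sum of all \<open>k + 1\<close>, and
    the orthogonal coordinate \<open>d * s - c * y\<close> squares to exactly the increase of the
    sum of squared deviations.\<close>
  define c d where "c = sqrt (k / (k + 1))" and "d = 1 / sqrt (k + 1)"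
  have cd: "c\<^sup>2 + d\<^sup>2 = 1" "d > 0" using k by (simp_all add: c_def d_def power_divide field_simps)
  have card: "card (insert i I) = card I + 1" using insert by simp
  have alg: "(\<Sum>j\<in>insert i I. (z(i := y)) j) / sqrt (card (insert i I)) = c * ((\<Sum>j\<in>I. z j) / sqrt k) + d * y"
    "(\<Sum>j\<in>insert i I. ((z(i := y)) j)\<^sup>2) - (\<Sum>j\<in>insert i I. (z(i := y)) j)\<^sup>2 / card (insert i I)
     = ((\<Sum>j\<in>I. (z j)\<^sup>2) - (\<Sum>j\<in>I. z j)\<^sup>2 / k) + (d * ((\<Sum>j\<in>I. z j) / sqrt k) - c * y)\<^sup>2" for z :: "'i \<Rightarrow> real" and y
  proof -
    define S T where "S = (\<Sum>j\<in>I. z j)" and "T = (\<Sum>j\<in>I. (z j)\<^sup>2)"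
    have u: "(\<Sum>j\<in>insert i I. (z(i := y)) j) = y + S" "(\<Sum>j\<in>insert i I. ((z(i := y)) j)\<^sup>2) = y\<^sup>2 + T"
      using insert(3) by (simp_all add: insert(1) S_def T_def) (auto intro!: sum.cong)
    have ck: "real (card (insert i I)) = k + 1" using card by (simp add: k_def)
    show "(\<Sum>j\<in>insert i I. (z(i := y)) j) / sqrt (card (insert i I)) = c * ((\<Sum>j\<in>I. z j) / sqrt k) + d * y"
      unfolding u ck S_def[symmetric] c_def d_def using k by (simp add: real_sqrt_divide field_simps)
    define r where "r = sqrt (k * (k + 1))"
    have "d * (S / sqrt k) - c * y = (S - k * y) / r"
      using k unfolding c_def d_def r_def by (simp add: real_sqrt_divide real_sqrt_mult divide_simps)
    then have "(d * (S / sqrt k) - c * y)\<^sup>2 = (S - k * y)\<^sup>2 / (k * (k + 1))"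
      using k by (simp add: power_divide r_def)
    moreover have "y\<^sup>2 + T - (y + S)\<^sup>2 / (k + 1) = T - S\<^sup>2 / k + (S - k * y)\<^sup>2 / (k * (k + 1))"
      using k by (simp add: divide_simps power2_eq_square) (simp add: algebra_simps)
    ultimately show "(\<Sum>j\<in>insert i I. ((z(i := y)) j)\<^sup>2) - (\<Sum>j\<in>insert i I. (z(i := y)) j)\<^sup>2 / card (insert i I)
     = ((\<Sum>j\<in>I. (z j)\<^sup>2) - (\<Sum>j\<in>I. z j)\<^sup>2 / k) + (d * ((\<Sum>j\<in>I. z j) / sqrt k) - c * y)\<^sup>2"
      unfolding u ck S_def[symmetric] T_def[symmetric] by simp
  qed
  let ?N = std_normal_distribution
  have "(\<integral>\<^sup>+z. F ((\<Sum>j\<in>insert i I. z j) / sqrt (card (insert i I)), (\<Sum>j\<in>insert i I. (z j)\<^sup>2) - (\<Sum>j\<in>insert i I. z j)\<^sup>2 / card (insert i I)) \<partial>(\<Pi>\<^sub>M i\<in>insert i I. ?N))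
    = (\<integral>\<^sup>+z. \<integral>\<^sup>+y. F (c * ((\<Sum>j\<in>I. z j) / sqrt k) + d * y, ((\<Sum>j\<in>I. (z j)\<^sup>2) - (\<Sum>j\<in>I. z j)\<^sup>2 / k) + (d * ((\<Sum>j\<in>I. z j) / sqrt k) - c * y)\<^sup>2) \<partial>?N \<partial>(\<Pi>\<^sub>M i\<in>I. ?N))"
    using insert by (subst P.product_nn_integral_insert) (simp_all only: alg, measurable)
  also have "\<dots> = (\<integral>\<^sup>+q. \<integral>\<^sup>+s. \<integral>\<^sup>+y. F (c * s + d * y, q + (d * s - c * y)\<^sup>2) \<partial>?N \<partial>?N \<partial>chi_square0 (card I - 1))"
    using insert.IH[of "\<lambda>(s, q). \<integral>\<^sup>+y. F (c * s + d * y, q + (d * s - c * y)\<^sup>2) \<partial>?N"]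
    by (simp add: k_def)
  also have "\<dots> = (\<integral>\<^sup>+q. \<integral>\<^sup>+u. \<integral>\<^sup>+v. F (u, q + v\<^sup>2) \<partial>?N \<partial>?N \<partial>chi_square0 (card I - 1))"
  proof (rule nn_integral_cong)
    fix q :: real
    show "(\<integral>\<^sup>+s. \<integral>\<^sup>+y. F (c * s + d * y, q + (d * s - c * y)\<^sup>2) \<partial>?N \<partial>?N) = (\<integral>\<^sup>+u. \<integral>\<^sup>+v. F (u, q + v\<^sup>2) \<partial>?N \<partial>?N)"
      using std_normal_rotation[OF _ cd, of "\<lambda>(u, v). F (u, q + v\<^sup>2)"] by simp
  qed
  \<comment> \<open>Integrating over \<open>q\<close> and \<open>v\<close> next to each other is the
    form of \<open>chi_square0_add_square\<close>. Keeping \<open>F\<close> a function of both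
    arguments carries the independence of sum and deviation through the induction.\<close>
  also have "\<dots> = (\<integral>\<^sup>+u. \<integral>\<^sup>+q. \<integral>\<^sup>+v. F (u, q + v\<^sup>2) \<partial>?N \<partial>chi_square0 (card I - 1) \<partial>?N)"
    by (rule NC.Fubini') measurable
  also have "\<dots> = (\<integral>\<^sup>+u. \<integral>\<^sup>+q. F (u, q) \<partial>chi_square0 (card I - 1 + 1) \<partial>?N)"
    by (intro nn_integral_cong chi_square0_add_square) simp
  also have "\<dots> = (\<integral>\<^sup>+q. \<integral>\<^sup>+u. F (u, q) \<partial>?N \<partial>chi_square0 (card I - 1 + 1))"
    by (rule NC.Fubini'[symmetric]) measurable
  finally show ?case using k by (simp add: card k_def)
qed

text \<open>With \<open>F\<close> depending on its second argument only, the normalized sum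
  integrates out. Two indices are the least for which \<open>chi_square0\<close> is not the point
  mass.\<close>

lemma distr_std_normal_sum_sq_dev:
  assumes I: "finite I" "card I \<ge> 2"
  shows "distr (\<Pi>\<^sub>M i\<in>I. std_normal_distribution) borel (\<lambda>z. \<Sum>i\<in>I. (z i - (\<Sum>j\<in>I. z j) / card I)\<^sup>2) = chi_square (card I - 1)"
proof (rule measure_eqI)
  interpret N: prob_space std_normal_distribution by (rule prob_space_std_normal)
  fix A assume "A \<in> sets (distr (\<Pi>\<^sub>M i\<in>I. std_normal_distribution) borel (\<lambda>z. \<Sum>i\<in>I. (z i - (\<Sum>j\<in>I. z j) / card I)\<^sup>2))"
  then have [measurable]: "A \<in> sets borel" by simp
  have alg: "(\<Sum>i\<in>I. (z i - (\<Sum>j\<in>I. z j) / card I)\<^sup>2) = (\<Sum>i\<in>I. (z i)\<^sup>2) - (\<Sum>i\<in>I. z i)\<^sup>2 / card I" for z :: "'a \<Rightarrow> real"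
  proof -
    define m where "m = (\<Sum>j\<in>I. z j) / card I"
    have S: "(\<Sum>j\<in>I. z j) = card I * m" using I by (simp add: m_def)
    have "(\<Sum>i\<in>I. (z i - m)\<^sup>2) = (\<Sum>i\<in>I. (z i)\<^sup>2) - 2 * m * (\<Sum>j\<in>I. z j) + card I * m\<^sup>2"
      by (simp add: power2_diff sum.distrib sum_subtractf sum_distrib_left sum_distrib_right mult_ac)
    then show ?thesis unfolding m_def[symmetric] S using I by (simp add: power2_eq_square field_simps)
  qed
  have "emeasure (distr (\<Pi>\<^sub>M i\<in>I. std_normal_distribution) borel (\<lambda>z. \<Sum>i\<in>I. (z i - (\<Sum>j\<in>I. z j) / card I)\<^sup>2)) A
     = (\<integral>\<^sup>+t. indicator A t \<partial>distr (\<Pi>\<^sub>M i\<in>I. std_normal_distribution) borel (\<lambda>z. \<Sum>i\<in>I. (z i - (\<Sum>j\<in>I. z j) / card I)\<^sup>2))"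
    by simp
  also have "\<dots> = (\<integral>\<^sup>+z. indicator A ((\<Sum>i\<in>I. (z i)\<^sup>2) - (\<Sum>i\<in>I. z i)\<^sup>2 / card I) \<partial>(\<Pi>\<^sub>M i\<in>I. std_normal_distribution))"
    unfolding alg by (rule nn_integral_distr) measurable
  also have "\<dots> = (\<integral>\<^sup>+q. indicator A q \<partial>chi_square (card I - 1))"
    using nn_integral_PiM_std_normal_sum_sq[of I "\<lambda>(s, q). indicator A q"] I N.emeasure_space_1
    by (cases "I = {}") (auto simp: chi_square0_def)
  also have "\<dots> = emeasure (chi_square (card I - 1)) A"
    by simp
  finally show "emeasure (distr (\<Pi>\<^sub>M i\<in>I. std_normal_distribution) borel (\<lambda>z. \<Sum>i\<in>I. (z i - (\<Sum>j\<in>I. z j) / card I)\<^sup>2)) A = emeasure (chi_square (card I - 1)) A" .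
qed simp

section \<open>Limit theorems\<close>

text \<open>Lindeberg's replacement on characteristic functions, with explicit error: each factor is
  compared with \<open>1 - a j\<close>, and this with the normal factor \<open>exp (- a j)\<close>.
  The two terms of the bound are these two errors.\<close>

lemma (in prob_space) char_sum_std_normal_bound:
  fixes Y :: "'b \<Rightarrow> 'a \<Rightarrow> real" and v :: "'b \<Rightarrow> real"
  assumes fin: "finite J" and indep: "indep_vars (\<lambda>_. borel) Y J"
    and bound: "\<And>j. j \<in> J \<Longrightarrow> AE \<omega> in M. \<bar>Y j \<omega>\<bar> \<le> C"
    and mean: "\<And>j. j \<in> J \<Longrightarrow> expectation (Y j) = 0"
    and var: "\<And>j. j \<in> J \<Longrightarrow> expectation (\<lambda>\<omega>. (Y j \<omega>)\<^sup>2) = v j"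
    and V: "V = (\<Sum>j\<in>J. v j)" "V > 0" and C: "C \<ge> 0"
  shows "cmod (char (distr M borel (\<lambda>\<omega>. (\<Sum>j\<in>J. Y j \<omega>) / sqrt V)) t - exp (- t\<^sup>2 / 2))
    \<le> \<bar>t\<bar> ^ 3 * C / (6 * sqrt V) + t ^ 4 * C\<^sup>2 / (4 * V)"
proof -
  have rv [measurable]: "Y j \<in> borel_measurable M" if "j \<in> J" for j
    using indep that by (auto simp: indep_vars_def2)
  define X where "X j \<omega> = Y j \<omega> / sqrt V" for j \<omega>
  have rvX [measurable]: "X j \<in> borel_measurable M" if "j \<in> J" for j
    using rv[OF that] unfolding X_def by simp
  have indepX: "indep_vars (\<lambda>_. borel) X J"
    unfolding X_def by (rule indep_vars_compose2[OF indep]) simp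
  have bX: "AE \<omega> in M. \<bar>X j \<omega>\<bar> \<le> C / sqrt V" if "j \<in> J" for j
    using bound[OF that] by eventually_elim (use V in \<open>simp add: X_def divide_right_mono\<close>)
  have intp: "integrable M (\<lambda>\<omega>. \<bar>X j \<omega>\<bar> ^ k)" if "j \<in> J" for j k
  proof (rule integrable_const_bound[where B = "(C / sqrt V) ^ k"])
    show "AE \<omega> in M. norm (\<bar>X j \<omega>\<bar> ^ k) \<le> (C / sqrt V) ^ k"
      using bX[OF that] by eventually_elim (simp add: power_mono)
  qed (use rvX[OF that] in simp)
  have int1: "integrable M (X j)" if "j \<in> J" for j
    using intp[OF that, of 1] rvX[OF that] by (simp add: integrable_abs_iff)
  have int2: "integrable M (\<lambda>\<omega>. (X j \<omega>)\<^sup>2)" if "j \<in> J" for j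
    using intp[OF that, of 2] by simp
  have EX: "expectation (X j) = 0" if "j \<in> J" for j
    using mean[OF that] unfolding X_def by simp
  have EX2: "expectation (\<lambda>\<omega>. (X j \<omega>)\<^sup>2) = v j / V" if "j \<in> J" for j
    using var[OF that] V unfolding X_def by (simp add: power_divide)
  have v0: "0 \<le> v j" if "j \<in> J" for j
    unfolding var[OF that, symmetric] by simp
  have vC: "v j / V \<le> C\<^sup>2 / V" if "j \<in> J" for j
  proof -
    have "expectation (\<lambda>\<omega>. (X j \<omega>)\<^sup>2) \<le> expectation (\<lambda>\<omega>. C\<^sup>2 / V)"
    proof (rule integral_mono_AE)
      show "AE \<omega> in M. (X j \<omega>)\<^sup>2 \<le> C\<^sup>2 / V"
        using bX[OF that]
      proof eventually_elim
        case (elim \<omega>)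
        then have "\<bar>X j \<omega>\<bar>\<^sup>2 \<le> (C / sqrt V)\<^sup>2" by (intro power_mono) auto
        then show ?case using V by (simp add: power_divide)
      qed
    qed (use int2[OF that] in auto)
    then show ?thesis using EX2[OF that] by (simp add: prob_space)
  qed
  define a where "a j = t\<^sup>2 * (v j / V) / 2" for j
  have a0: "a j \<ge> 0" if "j \<in> J" for j using v0[OF that] V by (simp add: a_def)
  have sumv: "(\<Sum>j\<in>J. v j / V) = 1"
    using V by (simp add: sum_divide_distrib[symmetric])
  have suma: "(\<Sum>j\<in>J. a j) = t\<^sup>2 / 2"
    using sumv unfolding a_def by (simp add: sum_divide_distrib[symmetric] sum_distrib_left[symmetric])
  \<comment> \<open>The uniform bound on \<open>X j\<close> trades one of the three powers for
    \<open>C / sqrt V\<close>; what remains is the variance share \<open>v j / V\<close>, and these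
    shares add up to 1.\<close>
  have step1: "cmod (char (distr M borel (X j)) t - (1 - a j)) \<le> \<bar>t\<bar> ^ 3 * C / (6 * sqrt V) * (v j / V)" if j: "j \<in> J" for j
  proof -
    have "cmod (char (distr M borel (X j)) t - (1 - t\<^sup>2 * (v j / V) / 2))
       \<le> (t\<^sup>2 / 6) * expectation (\<lambda>\<omega>. min (6 * (X j \<omega>)\<^sup>2) (\<bar>t\<bar> * \<bar>X j \<omega>\<bar> ^ 3))"
      by (rule char_approx3') (use j EX EX2 int1 int2 in auto)
    also have "expectation (\<lambda>\<omega>. min (6 * (X j \<omega>)\<^sup>2) (\<bar>t\<bar> * \<bar>X j \<omega>\<bar> ^ 3)) \<le> expectation (\<lambda>\<omega>. \<bar>t\<bar> * (C / sqrt V) * (X j \<omega>)\<^sup>2)"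
    proof (rule integral_mono_AE)
      have "integrable M (\<lambda>\<omega>. 6 * (X j \<omega>)\<^sup>2)" "integrable M (\<lambda>\<omega>. \<bar>t\<bar> * \<bar>X j \<omega>\<bar> ^ 3)"
        using int2[OF j] intp[OF j, of 3] by simp_all
      then show "integrable M (\<lambda>\<omega>. min (6 * (X j \<omega>)\<^sup>2) (\<bar>t\<bar> * \<bar>X j \<omega>\<bar> ^ 3))" by (rule integrable_min)
      show "AE \<omega> in M. min (6 * (X j \<omega>)\<^sup>2) (\<bar>t\<bar> * \<bar>X j \<omega>\<bar> ^ 3) \<le> \<bar>t\<bar> * (C / sqrt V) * (X j \<omega>)\<^sup>2"
        using bX[OF j]
      proof eventually_elim
        case (elim \<omega>)
        have "\<bar>X j \<omega>\<bar> ^ 3 = \<bar>X j \<omega>\<bar> * (X j \<omega>)\<^sup>2" by (simp add: power3_eq_cube power2_eq_square abs_mult_self_eq mult.assoc)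
        also have "\<dots> \<le> (C / sqrt V) * (X j \<omega>)\<^sup>2" using elim by (intro mult_right_mono) auto
        finally have "\<bar>t\<bar> * \<bar>X j \<omega>\<bar> ^ 3 \<le> \<bar>t\<bar> * ((C / sqrt V) * (X j \<omega>)\<^sup>2)" by (intro mult_left_mono) auto
        then show ?case by (simp add: mult.assoc min.coboundedI2)
      qed
    qed (use int2[OF j] in simp)
    also have "\<dots> = \<bar>t\<bar> * (C / sqrt V) * (v j / V)" using EX2[OF j] by simp
    also have "t\<^sup>2 / 6 * \<dots> = \<bar>t\<bar> ^ 3 * C / (6 * sqrt V) * (v j / V)"
      by (simp add: power3_eq_cube power2_eq_square abs_mult_self_eq field_simps)
    finally show ?thesis by (simp add: a_def mult_left_mono)
  qed
  \<comment> \<open>For \<open>a \<ge> 0\<close>,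
    \<open>1 - a \<le> exp (- a) \<le> 1 / (1 + a) \<le> 1 - a + a^2\<close>. One factor of the
    square is then bounded uniformly and the other kept for summation.\<close>
  have step2: "cmod ((1 - a j) - exp (- a j)) \<le> t ^ 4 * C\<^sup>2 / (4 * V) * (v j / V)" if j: "j \<in> J" for j
  proof -
    have "exp (- a j) \<le> 1 / (1 + a j)"
      using exp_ge_add_one_self[of "a j"] a0[OF j] by (simp add: exp_minus field_simps)
    also have "\<dots> \<le> 1 - a j + (a j)\<^sup>2"
      using a0[OF j] by (simp add: field_simps power2_eq_square)
    finally have "\<bar>(1 - a j) - exp (- a j)\<bar> \<le> (a j)\<^sup>2"
      using exp_ge_add_one_self[of "- a j"] by simp
    also have "(a j)\<^sup>2 \<le> a j * (t\<^sup>2 * (C\<^sup>2 / V) / 2)"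
      unfolding power2_eq_square[of "a j"] using a0[OF j] vC[OF j]
      by (intro mult_left_mono) (auto simp: a_def simp del: divide_le_cancel times_divide_eq_right intro!: divide_right_mono mult_left_mono)
    also have "\<dots> = t ^ 4 * C\<^sup>2 / (4 * V) * (v j / V)"
      by (simp add: a_def power4_eq_xxxx power2_eq_square mult_ac)
    finally show ?thesis unfolding of_real_diff[symmetric] norm_of_real .
  qed
  have "char (distr M borel (\<lambda>\<omega>. (\<Sum>j\<in>J. Y j \<omega>) / sqrt V)) t = (\<Prod>j\<in>J. char (distr M borel (X j)) t)"
    using char_distr_sum[OF indepX] by (simp add: X_def sum_divide_distrib)
  moreover have "exp (- t\<^sup>2 / 2) = (\<Prod>j\<in>J. exp (- a j))"
    by (simp add: exp_sum[symmetric] fin sum_negf suma)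
  ultimately have "cmod (char (distr M borel (\<lambda>\<omega>. (\<Sum>j\<in>J. Y j \<omega>) / sqrt V)) t - exp (- t\<^sup>2 / 2))
    = cmod ((\<Prod>j\<in>J. char (distr M borel (X j)) t) - (\<Prod>j\<in>J. complex_of_real (exp (- a j))))"
    by (simp only: of_real_prod)
  \<comment> \<open>Telescoping: all factors have modulus at most 1, so the difference of the
    products is at most the sum of the differences.\<close>
  also have "\<dots> \<le> (\<Sum>j\<in>J. cmod (char (distr M borel (X j)) t - complex_of_real (exp (- a j))))"
  proof (rule norm_prod_diff)
    fix j assume j: "j \<in> J"
    interpret D: real_distribution "distr M borel (X j)" by (rule real_distribution_distr) (rule rvX[OF j])
    show "cmod (char (distr M borel (X j)) t) \<le> 1" by (rule D.cmod_char_le_1)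
    show "cmod (complex_of_real (exp (- a j))) \<le> 1" using a0[OF j] by (simp add: norm_of_real)
  qed
  also have "\<dots> \<le> (\<Sum>j\<in>J. (\<bar>t\<bar> ^ 3 * C / (6 * sqrt V) + t ^ 4 * C\<^sup>2 / (4 * V)) * (v j / V))"
  proof (rule sum_mono)
    fix j assume j: "j \<in> J"
    have "cmod (char (distr M borel (X j)) t - complex_of_real (exp (- a j)))
      \<le> cmod (char (distr M borel (X j)) t - (1 - a j)) + cmod ((1 - a j) - exp (- a j))"
      by (rule order_trans[OF eq_refl norm_triangle_ineq]) simp
    also have "\<dots> \<le> (\<bar>t\<bar> ^ 3 * C / (6 * sqrt V) + t ^ 4 * C\<^sup>2 / (4 * V)) * (v j / V)"
      unfolding distrib_right using step1[OF j] step2[OF j] by (rule add_mono)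
    finally show "cmod (char (distr M borel (X j)) t - complex_of_real (exp (- a j))) \<le> (\<bar>t\<bar> ^ 3 * C / (6 * sqrt V) + t ^ 4 * C\<^sup>2 / (4 * V)) * (v j / V)" .
  qed
  also have "\<dots> = \<bar>t\<bar> ^ 3 * C / (6 * sqrt V) + t ^ 4 * C\<^sup>2 / (4 * V)"
    unfolding sum_distrib_left[symmetric] sumv by simp
  finally show ?thesis .
qed

text \<open>The probability space changes with \<open>n\<close>, since the true parameter does. A
  uniform bound and a diverging total variance make the explicit estimate vanish for each fixed
  \<open>t\<close>, and Levy's continuity theorem concludes.\<close>

theorem central_limit_theorem_bounded_array:
  fixes M :: "nat \<Rightarrow> 'a measure" and Y :: "nat \<Rightarrow> 'b \<Rightarrow> 'a \<Rightarrow> real" and v :: "nat \<Rightarrow> 'b \<Rightarrow> real"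
  assumes M: "\<And>n. prob_space (M n)" and fin: "\<And>n. finite (J n)"
    and indep: "\<And>n. prob_space.indep_vars (M n) (\<lambda>_. borel) (Y n) (J n)"
    and bound: "\<And>n j. j \<in> J n \<Longrightarrow> AE \<omega> in M n. \<bar>Y n j \<omega>\<bar> \<le> C"
    and mean: "\<And>n j. j \<in> J n \<Longrightarrow> (\<integral>\<omega>. Y n j \<omega> \<partial>M n) = 0"
    and var: "\<And>n j. j \<in> J n \<Longrightarrow> (\<integral>\<omega>. (Y n j \<omega>)\<^sup>2 \<partial>M n) = v n j"
    and V: "filterlim (\<lambda>n. \<Sum>j\<in>J n. v n j) at_top sequentially"
  shows "weak_conv_m (\<lambda>n. distr (M n) borel (\<lambda>\<omega>. (\<Sum>j\<in>J n. Y n j \<omega>) / sqrt (\<Sum>j\<in>J n. v n j))) std_normal_distribution"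
proof (rule levy_continuity)
  define V' where "V' n = (\<Sum>j\<in>J n. v n j)" for n
  fix n
  interpret prob_space "M n" by (rule M)
  have "Y n j \<in> borel_measurable (M n)" if "j \<in> J n" for j
    using indep[of n] that by (auto simp: indep_vars_def2)
  then have "(\<lambda>\<omega>. (\<Sum>j\<in>J n. Y n j \<omega>) / sqrt (\<Sum>j\<in>J n. v n j)) \<in> borel_measurable (M n)" by simp
  then show "real_distribution (distr (M n) borel (\<lambda>\<omega>. (\<Sum>j\<in>J n. Y n j \<omega>) / sqrt (\<Sum>j\<in>J n. v n j)))"
    by (rule real_distribution_distr)
next
  fix t
  define V' where "V' n = (\<Sum>j\<in>J n. v n j)" for n
  have V': "filterlim V' at_top sequentially" using V unfolding V'_def .
  have "filterlim (\<lambda>n. sqrt (V' n)) at_top sequentially"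
    using filterlim_compose[OF sqrt_at_top V'] .
  then have "(\<lambda>n. \<bar>t\<bar> ^ 3 * \<bar>C\<bar> / 6 / sqrt (V' n) + t ^ 4 * \<bar>C\<bar>\<^sup>2 / 4 / V' n) \<longlonglongrightarrow> 0 + 0"
    by (intro tendsto_add real_tendsto_divide_at_top[OF tendsto_const] V')
  then have lim: "(\<lambda>n. \<bar>t\<bar> ^ 3 * \<bar>C\<bar> / (6 * sqrt (V' n)) + t ^ 4 * \<bar>C\<bar>\<^sup>2 / (4 * V' n)) \<longlonglongrightarrow> 0"
    by simp
  have "(\<lambda>n. char (distr (M n) borel (\<lambda>\<omega>. (\<Sum>j\<in>J n. Y n j \<omega>) / sqrt (V' n))) t - exp (- t\<^sup>2 / 2)) \<longlonglongrightarrow> 0"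
  proof (rule Lim_null_comparison[OF _ lim])
    have "eventually (\<lambda>n. V' n > 0) sequentially" using V' by (simp add: filterlim_at_top_dense)
    then show "eventually (\<lambda>n. norm (char (distr (M n) borel (\<lambda>\<omega>. (\<Sum>j\<in>J n. Y n j \<omega>) / sqrt (V' n))) t - exp (- t\<^sup>2 / 2))
      \<le> \<bar>t\<bar> ^ 3 * \<bar>C\<bar> / (6 * sqrt (V' n)) + t ^ 4 * \<bar>C\<bar>\<^sup>2 / (4 * V' n)) sequentially"
    proof eventually_elim
      case (elim n)
      interpret prob_space "M n" by (rule M)
      have "AE \<omega> in M n. \<bar>Y n j \<omega>\<bar> \<le> \<bar>C\<bar>" if "j \<in> J n" for j
        using bound[OF that] by eventually_elim auto
      then show ?case
        using char_sum_std_normal_bound[OF fin indep _ mean var V'_def elim, of "\<bar>C\<bar>" t] by simp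
    qed
  qed
  then show "(\<lambda>n. char (distr (M n) borel (\<lambda>\<omega>. (\<Sum>j\<in>J n. Y n j \<omega>) / sqrt (\<Sum>j\<in>J n. v n j))) t) \<longlonglongrightarrow> char std_normal_distribution t"
    unfolding V'_def char_std_normal_distribution by (subst (asm) LIM_zero_iff) (simp add: exp_of_real)
qed (rule real_dist_normal_dist)

section \<open>Coordinatewise weak limits of product measures\<close>

lemma distr_PiM_coordinatewise:
  assumes I: "finite I" and M: "\<And>i. i \<in> I \<Longrightarrow> prob_space (M i)"
    and h: "\<And>i. i \<in> I \<Longrightarrow> h i \<in> measurable (M i) (N i)"
  shows "distr (PiM I M) (PiM I N) (\<lambda>x. \<lambda>i\<in>I. h i (x i)) = PiM I (\<lambda>i. distr (M i) (N i) (h i))"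
proof -
  \<comment> \<open>Indices outside \<open>I\<close> receive a one-point probability space, because
    \<open>product_prob_space\<close> asks for a probability measure at every index.\<close>
  define D where "D i = (if i \<in> I then distr (M i) (N i) (h i) else count_space {undefined})" for i
  define M' where "M' i = (if i \<in> I then M i else count_space {undefined})" for i
  have D: "prob_space (D i)" for i
    unfolding D_def using prob_space.prob_space_distr[OF M h] by (auto intro!: prob_spaceI)
  have M': "prob_space (M' i)" for i
    unfolding M'_def using M by (auto intro!: prob_spaceI)
  interpret D: product_prob_space D by (rule product_prob_spaceI) (rule D)
  interpret M': product_prob_space M' by (rule product_prob_spaceI) (rule M')
  have meas: "(\<lambda>x. \<lambda>i\<in>I. h i (x i)) \<in> measurable (PiM I M') (PiM I N)"
  proof (rule measurable_restrict)
    fix i assume i: "i \<in> I"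
    have "h i \<in> measurable (M' i) (N i)" using h[OF i] i by (simp add: M'_def)
    then show "(\<lambda>x. h i (x i)) \<in> measurable (PiM I M') (N i)"
      using i by (rule measurable_compose[OF measurable_component_singleton, rotated])
  qed
  have "distr (PiM I M') (PiM I N) (\<lambda>x. \<lambda>i\<in>I. h i (x i)) = PiM I D"
  proof (rule D.PiM_eqI[OF I])
    have "sets (PiM I D) = sets (PiM I N)" by (rule sets_PiM_cong) (auto simp: D_def)
    then show "sets (distr (PiM I M') (PiM I N) (\<lambda>x. \<lambda>i\<in>I. h i (x i))) = sets (PiM I D)" by simp
    fix A assume A: "\<And>i. i \<in> I \<Longrightarrow> A i \<in> sets (D i)"
    then have A': "A i \<in> sets (N i)" if "i \<in> I" for i using that by (force simp: D_def)
    have "emeasure (distr (PiM I M') (PiM I N) (\<lambda>x. \<lambda>i\<in>I. h i (x i))) (PiE I A)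
      = emeasure (PiM I M') ((\<lambda>x. \<lambda>i\<in>I. h i (x i)) -` PiE I A \<inter> space (PiM I M'))"
      using A' I by (intro emeasure_distr meas sets_PiM_I_finite) auto
    also have "(\<lambda>x. \<lambda>i\<in>I. h i (x i)) -` PiE I A \<inter> space (PiM I M') = (\<Pi>\<^sub>E i\<in>I. h i -` A i \<inter> space (M' i))"
      by (auto simp: space_PiM PiE_iff extensional_def)
    also have "emeasure (PiM I M') \<dots> = (\<Prod>i\<in>I. emeasure (M' i) (h i -` A i \<inter> space (M' i)))"
      using A' h I by (intro M'.emeasure_PiM) (auto simp: M'_def intro!: measurable_sets)
    also have "\<dots> = (\<Prod>i\<in>I. emeasure (D i) (A i))"
      using A' h by (intro prod.cong refl) (auto simp: M'_def D_def emeasure_distr)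
    finally show "emeasure (distr (PiM I M') (PiM I N) (\<lambda>x. \<lambda>i\<in>I. h i (x i))) (PiE I A) = (\<Prod>i\<in>I. emeasure (D i) (A i))" .
  qed
  moreover have "PiM I M' = PiM I M" "PiM I D = PiM I (\<lambda>i. distr (M i) (N i) (h i))"
    by (auto intro!: PiM_cong simp: M'_def D_def)
  ultimately show ?thesis by simp
qed

text \<open>Each coordinate has a Skorohod representation on its own space, converging at every
  point. The product of these spaces carries all of them at once with the required independence, so
  \<open>q\<close> converges pointwise there, and dominated convergence gives weak
  convergence.\<close>

lemma weak_conv_PiM_continuous_map:
  fixes \<mu> :: "nat \<Rightarrow> 'i \<Rightarrow> real measure" and \<nu> :: "'i \<Rightarrow> real measure" and q :: "('i \<Rightarrow> real) \<Rightarrow> real"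
  assumes I: "finite I"
    and \<mu>: "\<And>n i. i \<in> I \<Longrightarrow> real_distribution (\<mu> n i)" and \<nu>: "\<And>i. i \<in> I \<Longrightarrow> real_distribution (\<nu> i)"
    and wc: "\<And>i. i \<in> I \<Longrightarrow> weak_conv_m (\<lambda>n. \<mu> n i) (\<nu> i)"
    and q [measurable]: "q \<in> borel_measurable (\<Pi>\<^sub>M i\<in>I. borel)"
    and cont: "\<And>z zs. (\<And>i. i \<in> I \<Longrightarrow> (\<lambda>n. zs n i) \<longlonglongrightarrow> z i) \<Longrightarrow> (\<lambda>n. q (zs n)) \<longlonglongrightarrow> q z"
  shows "weak_conv_m (\<lambda>n. distr (PiM I (\<mu> n)) borel q) (distr (PiM I \<nu>) borel q)"
proof -
  define S where "S i = (\<lambda>(\<Omega> :: real measure, Ys :: nat \<Rightarrow> real \<Rightarrow> real, Y :: real \<Rightarrow> real).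
      prob_space \<Omega> \<and> (\<forall>n. Ys n \<in> borel_measurable \<Omega>) \<and> (\<forall>n. distr \<Omega> borel (Ys n) = \<mu> n i)
      \<and> Y \<in> borel_measurable \<Omega> \<and> distr \<Omega> borel Y = \<nu> i \<and> (\<forall>x\<in>space \<Omega>. (\<lambda>n. Ys n x) \<longlonglongrightarrow> Y x))" for i
  have "\<forall>i\<in>I. \<exists>w. S i w"
  proof
    fix i assume "i \<in> I"
    then show "\<exists>w. S i w"
      using Skorohod[OF \<mu> \<nu> wc, of i] by (auto simp: S_def)
  qed
  then obtain w where w: "\<forall>i\<in>I. S i (w i)" using bchoice[of I S] by blast
  define \<Omega> Ys Y where "\<Omega> i = fst (w i)" and "Ys i = fst (snd (w i))" and "Y i = snd (snd (w i))" for i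
  have S: "prob_space (\<Omega> i)" "Ys i n \<in> borel_measurable (\<Omega> i)" "distr (\<Omega> i) borel (Ys i n) = \<mu> n i"
    "Y i \<in> borel_measurable (\<Omega> i)" "distr (\<Omega> i) borel (Y i) = \<nu> i"
    "x \<in> space (\<Omega> i) \<Longrightarrow> (\<lambda>n. Ys i n x) \<longlonglongrightarrow> Y i x" if "i \<in> I" for i n x
    using w[rule_format, OF that] by (auto simp: S_def \<Omega>_def Ys_def Y_def split: prod.splits)
  let ?P = "PiM I \<Omega>"
  define \<Omega>' where "\<Omega>' i = (if i \<in> I then \<Omega> i else count_space {undefined})" for i
  have "prob_space (\<Omega>' i)" for i
    unfolding \<Omega>'_def using S(1) by (auto intro!: prob_spaceI)
  then interpret O: product_prob_space \<Omega>' by (rule product_prob_spaceI)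
  have "?P = PiM I \<Omega>'" by (rule PiM_cong) (auto simp: \<Omega>'_def)
  then interpret P: prob_space ?P using O.P.prob_space_axioms by simp
  have meas: "(\<lambda>x. \<lambda>i\<in>I. h i (x i)) \<in> measurable ?P (\<Pi>\<^sub>M i\<in>I. borel)"
    if "\<And>i. i \<in> I \<Longrightarrow> h i \<in> borel_measurable (\<Omega> i)" for h :: "'i \<Rightarrow> real \<Rightarrow> real"
    using that by (intro measurable_restrict) (rule measurable_compose[OF measurable_component_singleton])
  have eqP: "distr (PiM I D) borel q = distr ?P borel (\<lambda>x. q (\<lambda>i\<in>I. h i (x i)))"
    if h: "\<And>i. i \<in> I \<Longrightarrow> h i \<in> borel_measurable (\<Omega> i)" "\<And>i. i \<in> I \<Longrightarrow> distr (\<Omega> i) borel (h i) = D i" for h D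
  proof -
    have "PiM I D = PiM I (\<lambda>i. distr (\<Omega> i) borel (h i))"
      by (rule PiM_cong) (simp_all add: h)
    also have "\<dots> = distr ?P (\<Pi>\<^sub>M i\<in>I. borel) (\<lambda>x. \<lambda>i\<in>I. h i (x i))"
      by (rule distr_PiM_coordinatewise[symmetric]) (use I S(1) h in auto)
    finally show ?thesis
      by (simp add: distr_distr[OF q meas[OF h(1)]] comp_def)
  qed
  have e1: "distr (PiM I (\<mu> n)) borel q = distr ?P borel (\<lambda>x. q (\<lambda>i\<in>I. Ys i n (x i)))" for n
    by (rule eqP) (use S in auto)
  have e2: "distr (PiM I \<nu>) borel q = distr ?P borel (\<lambda>x. q (\<lambda>i\<in>I. Y i (x i)))"
    by (rule eqP) (use S in auto)
  have m1 [measurable]: "(\<lambda>x. q (\<lambda>i\<in>I. Ys i n (x i))) \<in> borel_measurable ?P" for n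
    by (rule measurable_compose[OF meas q]) (use S in auto)
  have m2 [measurable]: "(\<lambda>x. q (\<lambda>i\<in>I. Y i (x i))) \<in> borel_measurable ?P"
    by (rule measurable_compose[OF meas q]) (use S in auto)
  show ?thesis
    unfolding e1 e2
  proof (rule integral_bdd_continuous_conv_imp_weak_conv)
    fix f :: "real \<Rightarrow> real" assume f: "\<And>x. isCont f x" "\<And>x. \<bar>f x\<bar> \<le> 1"
    have [measurable]: "f \<in> borel_measurable borel"
      using f(1) by (intro borel_measurable_continuous_onI) (simp add: continuous_at_imp_continuous_on)
    have "(\<lambda>n. \<integral>x. f (q (\<lambda>i\<in>I. Ys i n (x i))) \<partial>?P) \<longlonglongrightarrow> (\<integral>x. f (q (\<lambda>i\<in>I. Y i (x i))) \<partial>?P)"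
    proof (rule integral_dominated_convergence[where w = "\<lambda>_. 1"])
      show "AE x in ?P. (\<lambda>n. f (q (\<lambda>i\<in>I. Ys i n (x i)))) \<longlonglongrightarrow> f (q (\<lambda>i\<in>I. Y i (x i)))"
      proof (rule AE_I2)
        fix x assume "x \<in> space ?P"
        then show "(\<lambda>n. f (q (\<lambda>i\<in>I. Ys i n (x i)))) \<longlonglongrightarrow> f (q (\<lambda>i\<in>I. Y i (x i)))"
          by (intro isCont_tendsto_compose[OF f(1)] cont) (auto simp: space_PiM PiE_iff intro!: S(6))
      qed
    qed (use f(2) in auto)
    then show "(\<lambda>n. integral\<^sup>L (distr ?P borel (\<lambda>x. q (\<lambda>i\<in>I. Ys i n (x i)))) f) \<longlonglongrightarrow> integral\<^sup>L (distr ?P borel (\<lambda>x. q (\<lambda>i\<in>I. Y i (x i)))) f"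
      by (simp add: integral_distr)
  qed (use m1 m2 in \<open>simp_all add: P.real_distribution_distr\<close>)
qed

section \<open>The log-likelihood\<close>

definition logistic :: "real \<Rightarrow> real" where
  "logistic t = exp t / (1 + exp t)"

text \<open>At once the derivative of \<open>logistic\<close>, the variance of a single comparison,
  and the reciprocal of \<open>bt_ratio\<close>.\<close>

definition logistic' :: "real \<Rightarrow> real" where
  "logistic' t = exp t / (1 + exp t)\<^sup>2"

definition softplus :: "real \<Rightarrow> real" where
  "softplus t = ln (1 + exp t)"

text \<open>The Bregman divergence of \<open>softplus\<close>: what one comparison loses, beyond the
  linear term, when its strength difference moves from \<open>\<theta>\<close> to
  \<open>\<theta> + h\<close>.\<close>

definition bregman :: "real \<Rightarrow> real \<Rightarrow> real" where
  "bregman \<theta> h = softplus (\<theta> + h) - softplus \<theta> - logistic \<theta> * h"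

lemma one_plus_exp_pos: "0 < 1 + exp (t::real)" "1 + exp (t::real) \<noteq> 0"
  using exp_gt_zero[of t] by (auto intro: add_pos_pos simp del: exp_gt_zero)

lemma logistic_bounds: "0 < logistic t" "logistic t < 1"
  using one_plus_exp_pos[of t] by (simp_all add: logistic_def)

lemma logistic_minus: "logistic (- t) = 1 - logistic t"
  using one_plus_exp_pos[of t] one_plus_exp_pos[of "- t"]
  by (simp add: logistic_def exp_minus divide_simps)

lemma logistic'_eq: "logistic' t = logistic t * (1 - logistic t)"
  using one_plus_exp_pos[of t] by (simp add: logistic_def logistic'_def power2_eq_square divide_simps)

lemma logistic'_pos: "0 < logistic' t"
  using logistic_bounds[of t] by (simp add: logistic'_eq)

lemma logistic'_minus: "logistic' (- t) = logistic' t"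
  by (simp add: logistic'_eq logistic_minus)

lemma logistic'_le: "logistic' t \<le> 1 / 4"
  using mult_const_minus_self_real_le[of "logistic t" 1] by (simp add: logistic'_eq)

lemma softplus_deriv: "(softplus has_real_derivative logistic t) (at t)"
  unfolding softplus_def[abs_def] logistic_def
  using one_plus_exp_pos[of t] by (auto intro!: derivative_eq_intros simp: divide_inverse mult.commute)

lemma logistic_deriv: "(logistic has_real_derivative logistic' t) (at t)"
  unfolding logistic_def[abs_def] logistic'_def
  using one_plus_exp_pos[of t]
  by (auto intro!: derivative_eq_intros simp: power2_eq_square divide_simps algebra_simps)

lemma logistic_lipschitz: "\<bar>logistic u - logistic v\<bar> \<le> \<bar>u - v\<bar>"
proof -
  have "norm (logistic u - logistic v) \<le> 1 * norm (u - v)"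
  proof (rule field_differentiable_bound[of UNIV])
    fix z show "(logistic has_field_derivative logistic' z) (at z within UNIV)" by (simp add: logistic_deriv)
    show "norm (logistic' z) \<le> 1" using logistic'_pos[of z] logistic'_le[of z] by simp
  qed auto
  then show ?thesis by simp
qed

lemma logistic'_lipschitz: "\<bar>logistic' u - logistic' v\<bar> \<le> \<bar>u - v\<bar>"
proof -
  have "logistic' u - logistic' v = (logistic u - logistic v) * (1 - logistic u - logistic v)"
    by (simp add: logistic'_eq algebra_simps)
  then have "\<bar>logistic' u - logistic' v\<bar> = \<bar>logistic u - logistic v\<bar> * \<bar>1 - logistic u - logistic v\<bar>"
    by (simp add: abs_mult)
  also have "\<dots> \<le> \<bar>logistic u - logistic v\<bar> * 1"
    using logistic_bounds[of u] logistic_bounds[of v] by (intro mult_left_mono) auto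
  finally show ?thesis using logistic_lipschitz[of u v] by simp
qed

text \<open>Self-concordance: the logarithmic derivative of \<open>logistic'\<close> is
  \<open>1 - 2 * logistic t\<close>, of modulus below 1. The proof compares denominators directly,
  according to the sign of \<open>h\<close>.\<close>

lemma logistic'_exp_le: "logistic' (\<theta> + h) \<le> exp \<bar>h\<bar> * logistic' \<theta>"
proof (cases "h \<ge> 0")
  case True
  have "(1 + exp \<theta>)\<^sup>2 \<le> (1 + exp (\<theta> + h))\<^sup>2" using True by (intro power_mono) auto
  then have "exp (\<theta> + h) / (1 + exp (\<theta> + h))\<^sup>2 \<le> exp (\<theta> + h) / (1 + exp \<theta>)\<^sup>2"
    by (intro divide_left_mono mult_pos_pos) (auto simp: one_plus_exp_pos)
  then show ?thesis using True by (simp add: logistic'_def exp_add mult.commute)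
next
  case False
  have "exp h * (1 + exp \<theta>) \<le> 1 + exp (\<theta> + h)"
    using False by (simp add: exp_add algebra_simps)
  then have "(exp h * (1 + exp \<theta>))\<^sup>2 \<le> (1 + exp (\<theta> + h))\<^sup>2" by (intro power_mono) auto
  then have "exp (\<theta> + h) / (1 + exp (\<theta> + h))\<^sup>2 \<le> exp (\<theta> + h) / (exp h * (1 + exp \<theta>))\<^sup>2"
    by (intro divide_left_mono mult_pos_pos) (auto simp: one_plus_exp_pos)
  also have "\<dots> = exp (- h) * (exp \<theta> / (1 + exp \<theta>)\<^sup>2)"
    by (simp add: exp_add exp_minus power_mult_distrib power2_eq_square[of "exp h"] divide_inverse)
  finally show ?thesis using False by (simp add: logistic'_def)
qed

lemma logistic'_exp_ge: "exp (- \<bar>h\<bar>) * logistic' \<theta> \<le> logistic' (\<theta> + h)"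
  using logistic'_exp_le[of "\<theta> + h" "- h"] by (simp add: exp_minus field_simps)

lemma bregman_taylor:
  obtains h' where "\<bar>h'\<bar> \<le> \<bar>h\<bar>" "bregman \<theta> h = logistic' (\<theta> + h') * h\<^sup>2 / 2"
proof (cases "h = 0")
  case True
  then show ?thesis using that[of 0] by (simp add: bregman_def)
next
  case False
  define diff where "diff m = (if m = 0 then softplus else if m = 1 then logistic else logistic')" for m :: nat
  have "\<exists>t. (if \<theta> + h < \<theta> then \<theta> + h < t \<and> t < \<theta> else \<theta> < t \<and> t < \<theta> + h) \<and>
      softplus (\<theta> + h) = (\<Sum>m<2. diff m \<theta> / fact m * (\<theta> + h - \<theta>) ^ m) + diff 2 t / fact 2 * (\<theta> + h - \<theta>) ^ 2"
  proof (rule Taylor[where a = "\<theta> - \<bar>h\<bar>" and b = "\<theta> + \<bar>h\<bar>"])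
    show "\<forall>m t. m < 2 \<and> \<theta> - \<bar>h\<bar> \<le> t \<and> t \<le> \<theta> + \<bar>h\<bar> \<longrightarrow> (diff m has_real_derivative diff (Suc m) t) (at t)"
      by (auto simp: diff_def less_2_cases_iff softplus_deriv logistic_deriv)
  qed (use False in \<open>auto simp: diff_def\<close>)
  then obtain t where t: "if \<theta> + h < \<theta> then \<theta> + h < t \<and> t < \<theta> else \<theta> < t \<and> t < \<theta> + h"
    "softplus (\<theta> + h) = softplus \<theta> + logistic \<theta> * h + logistic' t / 2 * h\<^sup>2"
    by (auto simp: diff_def eval_nat_numeral)
  have "\<bar>t - \<theta>\<bar> \<le> \<bar>h\<bar>" using t(1) by (auto split: if_splits)
  then show ?thesis using that[of "t - \<theta>"] t(2) by (simp add: bregman_def)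
qed

lemma bregman_nonneg: "0 \<le> bregman \<theta> h"
proof -
  obtain h' where "bregman \<theta> h = logistic' (\<theta> + h') * h\<^sup>2 / 2" by (rule bregman_taylor)
  then show ?thesis using logistic'_pos[of "\<theta> + h'"] by (simp only: zero_le_power2 mult_nonneg_nonneg less_imp_le divide_nonneg_pos zero_less_numeral)
qed

lemma bregman_zero [simp]: "bregman \<theta> 0 = 0"
  by (simp add: bregman_def)

lemma bregman_le: "bregman \<theta> h \<le> exp \<bar>h\<bar> * logistic' \<theta> * h\<^sup>2 / 2"
proof -
  obtain h' where h': "\<bar>h'\<bar> \<le> \<bar>h\<bar>" "bregman \<theta> h = logistic' (\<theta> + h') * h\<^sup>2 / 2" by (rule bregman_taylor)
  have "logistic' (\<theta> + h') \<le> exp \<bar>h'\<bar> * logistic' \<theta>" by (rule logistic'_exp_le)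
  also have "\<dots> \<le> exp \<bar>h\<bar> * logistic' \<theta>" using h' logistic'_pos[of \<theta>] by simp
  finally show ?thesis unfolding h'(2) by (intro divide_right_mono mult_right_mono) auto
qed

lemma bregman_le_sq: "bregman \<theta> h \<le> h\<^sup>2 / 8"
proof -
  obtain h' where h': "bregman \<theta> h = logistic' (\<theta> + h') * h\<^sup>2 / 2" by (rule bregman_taylor)
  have "logistic' (\<theta> + h') * h\<^sup>2 \<le> 1 / 4 * h\<^sup>2" using logistic'_le by (rule mult_right_mono) simp
  then show ?thesis unfolding h' by simp
qed

lemma softplus_minus: "softplus (- t) = softplus t - t"
proof -
  have "1 + exp t = exp t * (1 + exp (- t))" by (simp add: exp_minus algebra_simps)
  then have "softplus t = t + softplus (- t)"
    unfolding softplus_def using one_plus_exp_pos[of "- t"] by (simp only: ln_mult_pos exp_gt_zero ln_exp)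
  then show ?thesis by simp
qed

text \<open>The remainder of a pair does not depend on its orientation, so a sum over
  \<open>bt_pairs\<close> can be doubled into one over ordered pairs.\<close>

lemma bregman_minus: "bregman (- \<theta>) (- h) = bregman \<theta> h"
  using softplus_minus[of "\<theta> + h"] by (simp add: bregman_def softplus_minus logistic_minus algebra_simps)

lemma softplus_convex: "convex_on UNIV softplus"
  by (rule f''_ge0_imp_convex[where f' = logistic and f'' = logistic'])
     (auto intro: softplus_deriv logistic_deriv less_imp_le[OF logistic'_pos])

lemma bregman_scale:
  assumes "0 \<le> c" "c \<le> 1"
  shows "bregman \<theta> (c * h) \<le> c * bregman \<theta> h"
proof -
  have "softplus ((1 - c) *\<^sub>R \<theta> + c *\<^sub>R (\<theta> + h)) \<le> (1 - c) * softplus \<theta> + c * softplus (\<theta> + h)"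
    using assms by (intro convex_onD[OF softplus_convex]) auto
  moreover have "(1 - c) *\<^sub>R \<theta> + c *\<^sub>R (\<theta> + h) = \<theta> + c * h" by (simp add: algebra_simps)
  ultimately show ?thesis by (simp add: bregman_def algebra_simps)
qed

text \<open>Convexity extends the quadratic bound for small increments to a linear one for large increments, so
  no a priori bound on the parameters is needed.\<close>

lemma bregman_ge:
  assumes \<delta>: "\<delta> > 0"
  shows "exp (- \<delta>) * logistic' \<theta> / 2 * min (h\<^sup>2) (\<delta> * \<bar>h\<bar>) \<le> bregman \<theta> h"
proof -
  have small: "exp (- \<delta>) * logistic' \<theta> / 2 * u\<^sup>2 \<le> bregman \<theta> u" if u: "\<bar>u\<bar> \<le> \<delta>" for u
  proof -
    obtain h' where h': "\<bar>h'\<bar> \<le> \<bar>u\<bar>" "bregman \<theta> u = logistic' (\<theta> + h') * u\<^sup>2 / 2" by (rule bregman_taylor)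
    have "exp (- \<delta>) * logistic' \<theta> \<le> exp (- \<bar>h'\<bar>) * logistic' \<theta>" using h' u logistic'_pos[of \<theta>] by simp
    also have "\<dots> \<le> logistic' (\<theta> + h')" by (rule logistic'_exp_ge)
    finally have "exp (- \<delta>) * logistic' \<theta> * u\<^sup>2 \<le> logistic' (\<theta> + h') * u\<^sup>2" by (rule mult_right_mono) simp
    then show ?thesis unfolding h'(2) by simp
  qed
  show ?thesis
  proof (cases "\<bar>h\<bar> \<le> \<delta>")
    case True
    have "exp (- \<delta>) * logistic' \<theta> / 2 * min (h\<^sup>2) (\<delta> * \<bar>h\<bar>) \<le> exp (- \<delta>) * logistic' \<theta> / 2 * h\<^sup>2"
      using logistic'_pos[of \<theta>] by (intro mult_left_mono) auto
    also have "\<dots> \<le> bregman \<theta> h" by (rule small[OF True])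
    finally show ?thesis .
  next
    case False
    \<comment> \<open>\<open>c * h\<close> has length exactly \<open>\<delta>\<close>, where the
      quadratic bound still applies; \<open>bregman_scale\<close> carries it out to \<open>h\<close>
      and makes it linear.\<close>
    define c where "c = \<delta> / \<bar>h\<bar>"
    have c: "0 < c" "c \<le> 1" using False \<delta> by (auto simp: c_def)
    have ch: "\<bar>c * h\<bar> = \<delta>" using False \<delta> by (simp add: c_def abs_mult)
    then have "(c * h)\<^sup>2 = \<delta>\<^sup>2" by (metis power2_abs)
    then have "exp (- \<delta>) * logistic' \<theta> / 2 * \<delta>\<^sup>2 \<le> c * bregman \<theta> h"
      using order_trans[OF small[of "c * h"] bregman_scale[of c \<theta> h]] ch c by simp
    then have "exp (- \<delta>) * logistic' \<theta> / 2 * \<delta>\<^sup>2 / c \<le> bregman \<theta> h"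
      unfolding pos_divide_le_eq[OF c(1)] by (simp only: mult.commute)
    moreover have "\<delta>\<^sup>2 / c = \<delta> * \<bar>h\<bar>" using \<delta> False by (simp add: c_def power2_eq_square)
    ultimately have "exp (- \<delta>) * logistic' \<theta> / 2 * (\<delta> * \<bar>h\<bar>) \<le> bregman \<theta> h" by (metis times_divide_eq_right)
    moreover have "exp (- \<delta>) * logistic' \<theta> / 2 * min (h\<^sup>2) (\<delta> * \<bar>h\<bar>) \<le> exp (- \<delta>) * logistic' \<theta> / 2 * (\<delta> * \<bar>h\<bar>)"
      using logistic'_pos[of \<theta>] by (intro mult_left_mono) auto
    ultimately show ?thesis by (rule order_trans[rotated])
  qed
qed

text \<open>Mean value theorem; the intermediate point is within 1 of \<open>\<theta>\<close>, so
  self-concordance loses at most the factor \<open>exp (-1)\<close>.\<close>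

lemma logistic_diff_ge:
  assumes "0 \<le> \<eta>" "\<eta> \<le> 1"
  shows "\<eta> * (exp (-1) * logistic' \<theta>) \<le> logistic (\<theta> + \<eta>) - logistic \<theta>"
    and "\<eta> * (exp (-1) * logistic' \<theta>) \<le> logistic \<theta> - logistic (\<theta> - \<eta>)"
proof -
  have *: "\<eta> * (exp (-1) * logistic' \<theta>) \<le> logistic v - logistic u"
    if uv: "v = u + \<eta>" "\<theta> = u \<or> \<theta> = v" for u v
  proof (cases "\<eta> = 0")
    case False
    then have "u < v" using uv assms by simp
    from MVT2[OF this, of logistic logistic'] obtain z where z: "u < z" "z < v" "logistic v - logistic u = (v - u) * logistic' z"
      using logistic_deriv by blast
    have "exp (-1) * logistic' \<theta> \<le> exp (- \<bar>z - \<theta>\<bar>) * logistic' \<theta>"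
      using z uv assms logistic'_pos[of \<theta>] by auto
    also have "\<dots> \<le> logistic' z" using logistic'_exp_ge[of "z - \<theta>" \<theta>] by simp
    finally show ?thesis using z(3) uv assms by (simp add: mult_left_mono)
  qed (use uv in simp)
  show "\<eta> * (exp (-1) * logistic' \<theta>) \<le> logistic (\<theta> + \<eta>) - logistic \<theta>" by (rule *) auto
  show "\<eta> * (exp (-1) * logistic' \<theta>) \<le> logistic \<theta> - logistic (\<theta> - \<eta>)" by (rule *) auto
qed

lemma ln_exp_add_exp: "ln (exp u + exp v) = v + softplus (u - v)"
proof -
  have "exp u + exp v = exp v * (1 + exp (u - v))" by (simp add: exp_diff field_simps)
  then show ?thesis unfolding softplus_def using one_plus_exp_pos[of "u - v"] by (simp only: ln_mult_pos exp_gt_zero ln_exp)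
qed

section \<open>Sums over pairs and the exact expansion of the log-likelihood\<close>

lemma finite_bt_pairs [simp]: "finite (bt_pairs n)"
  by (rule finite_subset[of _ "{1..n} \<times> {1..n}"]) (auto simp: bt_pairs_def)

lemma sum_bt_pairs:
  fixes G :: "nat \<Rightarrow> nat \<Rightarrow> real"
  shows "(\<Sum>i\<in>{1..n}. \<Sum>j\<in>{1..n} - {i}. G i j) = (\<Sum>(i, j)\<in>bt_pairs n. G i j + G j i)"
proof -
  have "(\<Sum>i\<in>{1..n}. \<Sum>j\<in>{1..n} - {i}. G i j) = (\<Sum>p\<in>(SIGMA i:{1..n}. {1..n} - {i}). G (fst p) (snd p))"
    by (subst sum.Sigma) (auto simp: split_def)
  also have "(SIGMA i:{1..n}. {1..n} - {i}) = bt_pairs n \<union> prod.swap ` bt_pairs n"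
    by (auto simp: bt_pairs_def image_iff)
  also have "(\<Sum>p\<in>bt_pairs n \<union> prod.swap ` bt_pairs n. G (fst p) (snd p))
     = (\<Sum>p\<in>bt_pairs n. G (fst p) (snd p)) + (\<Sum>p\<in>prod.swap ` bt_pairs n. G (fst p) (snd p))"
    by (rule sum.union_disjoint) (simp_all, auto simp: bt_pairs_def)
  also have "(\<Sum>p\<in>prod.swap ` bt_pairs n. G (fst p) (snd p)) = (\<Sum>p\<in>bt_pairs n. G (snd p) (fst p))"
    by (subst sum.reindex) (auto intro: inj_onI)
  finally show ?thesis by (simp add: sum.distrib split_def)
qed

lemma sum_bt_pairs_sym:
  fixes G :: "nat \<Rightarrow> nat \<Rightarrow> real"
  assumes "\<And>i j. G i j = G j i" "\<And>i. G i i = 0"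
  shows "2 * (\<Sum>(i, j)\<in>bt_pairs n. G i j) = (\<Sum>i\<in>{1..n}. \<Sum>j\<in>{1..n}. G i j)"
proof -
  have "(\<Sum>i\<in>{1..n}. \<Sum>j\<in>{1..n}. G i j) = (\<Sum>i\<in>{1..n}. \<Sum>j\<in>{1..n} - {i}. G i j)"
    by (intro sum.cong[OF refl] sum.mono_neutral_right) (auto simp: assms(2))
  also have "\<dots> = (\<Sum>(i, j)\<in>bt_pairs n. G i j + G i j)"
    unfolding sum_bt_pairs by (intro sum.cong refl) (use assms(1) in force)
  finally show ?thesis by (simp add: sum_distrib_left split_def)
qed

lemma card_bt_pairs: "2 * real (card (bt_pairs n)) = real n * (real n - 1)"
proof -
  have "2 * (\<Sum>(i, j)\<in>bt_pairs n. if i = j then 0 else 1::real) = (\<Sum>i\<in>{1..n}. \<Sum>j\<in>{1..n}. if i = j then 0 else 1)"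
    by (rule sum_bt_pairs_sym) auto
  also have "\<dots> = (\<Sum>i\<in>{1..n}. \<Sum>j\<in>{1..n} - {i}. 1)"
    by (intro sum.cong refl sum.mono_neutral_cong_right) auto
  also have "\<dots> = (\<Sum>i\<in>{1..n}. real n - 1)"
    by (intro sum.cong refl) (auto simp: of_nat_diff)
  also have "(\<Sum>(i, j)\<in>bt_pairs n. if i = j then 0 else 1::real) = (\<Sum>(i, j)\<in>bt_pairs n. 1)"
    by (intro sum.cong) (auto simp: bt_pairs_def)
  finally show ?thesis by (simp add: split_def)
qed

lemma bt_count_swap: "i \<noteq> j \<Longrightarrow> bt_count K a i j + bt_count K a j i = real K"
  by (auto simp: bt_count_def)

definition bt_score :: "nat \<Rightarrow> nat \<Rightarrow> (nat \<times> nat \<Rightarrow> nat) \<Rightarrow> (nat \<Rightarrow> real) \<Rightarrow> nat \<Rightarrow> real" where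
  "bt_score K n a b i = bt_degree K n a i - K * (\<Sum>j\<in>{1..n} - {i}. logistic (b i - b j))"

text \<open>The two sides of a comparison have counts adding to \<open>K\<close> and probabilities
  adding to 1. This is the infinitesimal form of shift invariance, and it allows increments to be
  centred for free.\<close>

lemma sum_bt_score: "(\<Sum>i\<in>{1..n}. bt_score K n a b i) = 0"
proof -
  have "(\<Sum>i\<in>{1..n}. bt_score K n a b i) = (\<Sum>i\<in>{1..n}. \<Sum>j\<in>{1..n} - {i}. bt_count K a i j - K * logistic (b i - b j))"
    unfolding bt_score_def bt_degree_def by (simp add: sum_subtractf sum_distrib_left)
  also have "\<dots> = (\<Sum>(i, j)\<in>bt_pairs n. (bt_count K a i j - K * logistic (b i - b j)) + (bt_count K a j i - K * logistic (b j - b i)))"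
    by (rule sum_bt_pairs)
  also have "\<dots> = (\<Sum>(i, j)\<in>bt_pairs n. 0)"
  proof (intro sum.cong refl, clarify)
    fix i j assume "(i, j) \<in> bt_pairs n"
    then have "i \<noteq> j" by (auto simp: bt_pairs_def)
    have l: "logistic (b j - b i) = 1 - logistic (b i - b j)"
      using logistic_minus[of "b i - b j"] by simp
    show "(bt_count K a i j - K * logistic (b i - b j)) + (bt_count K a j i - K * logistic (b j - b i)) = 0"
      using bt_count_swap[OF \<open>i \<noteq> j\<close>, of K a] unfolding l by (simp add: algebra_simps)
  qed
  finally show ?thesis by simp
qed

text \<open>Exact for all increments, since \<open>bregman\<close> is by definition the remainder of
  each pair; every later comparison of likelihoods starts here.\<close>

lemma ell_bt_expand:
  "ell_bt K n a (\<lambda>i. b i + x i) = ell_bt K n a b + (\<Sum>i\<in>{1..n}. x i * bt_score K n a b i)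
     - K * (\<Sum>(i, j)\<in>bt_pairs n. bregman (b i - b j) (x i - x j))"
proof -
  have l: "logistic (b j - b i) = 1 - logistic (b i - b j)" for i j
    using logistic_minus[of "b i - b j"] by simp
  have 1: "ln (exp (b i + x i) + exp (b j + x j)) = ln (exp (b i) + exp (b j))
      + (x i * logistic (b i - b j) + x j * logistic (b j - b i)) + bregman (b i - b j) (x i - x j)" for i j
  proof -
    have "b i + x i - (b j + x j) = (b i - b j) + (x i - x j)" by simp
    then show ?thesis
      unfolding ln_exp_add_exp bregman_def l[of j i] by (simp add: algebra_simps)
  qed
  have "(\<Sum>(i, j)\<in>bt_pairs n. ln (exp (b i + x i) + exp (b j + x j)))
     = (\<Sum>(i, j)\<in>bt_pairs n. ln (exp (b i) + exp (b j))) + (\<Sum>(i, j)\<in>bt_pairs n. x i * logistic (b i - b j) + x j * logistic (b j - b i))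
       + (\<Sum>(i, j)\<in>bt_pairs n. bregman (b i - b j) (x i - x j))"
    unfolding 1 by (simp add: sum.distrib split_def)
  also have "(\<Sum>(i, j)\<in>bt_pairs n. x i * logistic (b i - b j) + x j * logistic (b j - b i)) = (\<Sum>i\<in>{1..n}. \<Sum>j\<in>{1..n} - {i}. x i * logistic (b i - b j))"
    by (rule sum_bt_pairs[symmetric])
  finally show ?thesis
    unfolding ell_bt_def bt_score_def
    by (simp add: algebra_simps sum.distrib sum_subtractf sum_distrib_left)
qed

text \<open>Both \<open>b i\<close> and \<open>b j\<close> lie below
  \<open>ln (exp (b i) + exp (b j))\<close>, and the counts of a pair are nonnegative with sum
  \<open>K\<close>. This makes the suprema in \<open>bt_lrt\<close> bounded.\<close>

lemma ell_bt_nonpos: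
  assumes a: "\<And>p. p \<in> bt_pairs n \<Longrightarrow> a p \<le> K"
  shows "ell_bt K n a b \<le> 0"
proof -
  have "(\<Sum>i=1..n. b i * bt_degree K n a i) = (\<Sum>i\<in>{1..n}. \<Sum>j\<in>{1..n} - {i}. b i * bt_count K a i j)"
    by (simp add: bt_degree_def sum_distrib_left)
  also have "\<dots> = (\<Sum>(i, j)\<in>bt_pairs n. b i * bt_count K a i j + b j * bt_count K a j i)"
    by (rule sum_bt_pairs)
  also have "\<dots> \<le> (\<Sum>(i, j)\<in>bt_pairs n. K * ln (exp (b i) + exp (b j)))"
  proof (intro sum_mono, clarify)
    fix i j assume p: "(i, j) \<in> bt_pairs n"
    define M where "M = ln (exp (b i) + exp (b j))"
    have M: "b i \<le> M" "b j \<le> M"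
      unfolding M_def by (simp_all add: ln_ge_iff add_pos_pos)
    have c: "bt_count K a i j \<ge> 0" "bt_count K a j i \<ge> 0" "bt_count K a i j + bt_count K a j i = K"
      using p a[OF p] by (auto simp: bt_pairs_def bt_count_def)
    have "b i * bt_count K a i j + b j * bt_count K a j i \<le> M * bt_count K a i j + M * bt_count K a j i"
      using M c by (intro add_mono mult_right_mono)
    also have "\<dots> = K * M" unfolding distrib_left[symmetric] c(3) by simp
    finally show "b i * bt_count K a i j + b j * bt_count K a j i \<le> K * M" .
  qed
  finally show ?thesis by (simp add: ell_bt_def sum_distrib_left split_def)
qed

text \<open>Here b stands for the paper's b_n, and \<tau> is the scale of the average estimation error of a
  parameter.\<close>

locale bt_params =
  fixes K n r :: nat and beta :: "nat \<Rightarrow> real" and b \<tau> :: real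
  assumes K: "1 \<le> K" and r: "2 < r" and n: "2 * r \<le> n"
    and beta1: "beta 1 = 0" and null: "\<And>i. i \<in> {2..r} \<Longrightarrow> beta i = beta 2"
    and b: "1 \<le> b"
    and info: "\<And>i j. i \<in> {1..n} \<Longrightarrow> j \<in> {1..n} \<Longrightarrow> i \<noteq> j \<Longrightarrow> 1 / b \<le> logistic' (beta i - beta j)"
    and \<tau>: "0 < \<tau>" "48 * exp 1 * b\<^sup>2 * \<tau> \<le> 1"
begin

section \<open>The block, its information, and the scales of the errors\<close>

definition B where "B = {2..r}"
definition J where "J = {1..n} - {2..r}"
definition m where "m = real r - 1"
text \<open>The true curvature along block contrasts is this plus \<open>K * m / 4\<close> from
  comparisons inside the block. That part stays bounded, is left out, and reappears as the
  correction \<open>K * m / \<Lambda>\<close> in \<open>null_le_ell\<close>.\<close>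

definition \<Lambda> where "\<Lambda> = K * (\<Sum>j\<in>J. logistic' (beta 2 - beta j))"
text \<open>Chosen so that a step of \<open>\<eta>\<close> in the block coordinate moves the outside
  sum of \<open>logistic\<close> by at least
  \<open>(n / 2) * \<eta> * exp (-1) / b = 3 * n * \<tau>\<close>: enough for the average error
  \<open>2 * n * \<tau>\<close> and for \<open>n * \<tau>\<close> from the scores.\<close>

definition \<eta> where "\<eta> = 6 * exp 1 * b * \<tau>"
definition block where "block c t = (\<lambda>i. if i \<in> B then t else c i :: real)"

lemma finite_B_J [simp]: "finite B" "finite J" by (simp_all add: B_def J_def)

lemma index_split: "{1..n} = B \<union> J" "B \<inter> J = {}" "B \<subseteq> {1..n}" "J \<subseteq> {1..n}" "1 \<in> J" "2 \<in> B"
  using r n by (auto simp: B_def J_def)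

lemma card_B_J: "real (card B) = m" "real (card J) = n - m" "m \<ge> 2" "n / 2 \<le> n - m" "n > 0"
proof -
  show 1: "real (card B) = m" using r by (simp add: B_def m_def of_nat_diff)
  have "card B + card J = card {1..n}"
    unfolding index_split(1) by (rule card_Un_disjoint[symmetric]) (simp_all add: index_split(2))
  then have "card B + card J = n" by simp
  then show "real (card J) = n - m" using 1 by linarith
  show "m \<ge> 2" "n / 2 \<le> n - m" "n > 0" using r n by (auto simp: m_def)
qed

lemma e2: "2 \<le> exp (1::real)" using exp_ge_add_one_self[of 1] by simp

text \<open>All from \<open>48 * exp 1 * b^2 * \<tau> \<le> 1\<close>. The quantity
  \<open>4 * b * \<eta>\<close> is the relative error of the information in
  \<open>info_block\<close>; below 1/2 it leaves at least half of \<open>\<Lambda>\<close>.\<close>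

lemma small: "\<tau> \<le> 1/96" "0 < \<eta>" "\<eta> \<le> 1" "2 * \<tau> \<le> \<eta>" "4 * b * \<eta> \<le> 1/2"
proof -
  have bb: "1 \<le> b\<^sup>2" using b by (rule one_le_power)
  have "96 * \<tau> \<le> 48 * exp 1 * b\<^sup>2 * \<tau>"
    using e2 bb \<tau>(1) mult_mono[of 2 "exp 1" 1 "b\<^sup>2"] by (intro mult_right_mono) auto
  then show "\<tau> \<le> 1/96" using \<tau> by linarith
  have "\<eta> * 4 * b = (48 * exp 1 * b\<^sup>2 * \<tau>) / 2" by (simp add: \<eta>_def power2_eq_square)
  then show 1: "4 * b * \<eta> \<le> 1/2" using \<tau> by (simp add: mult_ac)
  show 2: "0 < \<eta>" using \<tau> b by (simp add: \<eta>_def)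
  have "\<eta> * 1 \<le> \<eta> * (4 * b)" using b 2 by (intro mult_left_mono) auto
  then show "\<eta> \<le> 1" using 1 by (simp add: mult_ac)
  have "2 * 1 * \<tau> \<le> (6 * exp 1) * b * \<tau>" using e2 b \<tau> by (intro mult_right_mono mult_mono) auto
  then show "2 * \<tau> \<le> \<eta>" by (simp add: \<eta>_def)
qed

lemma \<Lambda>_ge: "K * n / (2 * b) \<le> \<Lambda>"
proof -
  have "K * n / (2 * b) = K * (n / 2 * (1 / b))" by simp
  also have "\<dots> \<le> K * ((n - m) * (1 / b))" using card_B_J(4) b by (intro mult_left_mono mult_right_mono) auto
  also have "\<dots> = K * (\<Sum>j\<in>J. 1 / b)" by (simp add: card_B_J(2))
  also have "\<dots> \<le> \<Lambda>" unfolding \<Lambda>_def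
  proof (intro mult_left_mono sum_mono info)
    fix j assume "j \<in> J"
    then show "2 \<in> {1..n}" "j \<in> {1..n}" "2 \<noteq> j" using index_split r n by auto
  qed simp
  finally show ?thesis .
qed

lemma \<Lambda>_pos: "\<Lambda> > 0"
proof -
  have "0 < K * n / (2 * b)" using K b card_B_J(5) by simp
  then show ?thesis using \<Lambda>_ge by linarith
qed

lemma block_beta: "block beta (beta 2) = beta"
proof
  fix i show "block beta (beta 2) i = beta i" using null[of i] by (simp add: block_def B_def)
qed

end

text \<open>The deterministic part of the argument. The slope
  \<open>K * \<tau> / (8 * exp 1 * b)\<close> of the score bound is a quarter of the slope
  \<open>K * \<tau> / (2 * exp 1 * b)\<close> that curvature provides in \<open>consistency\<close>,
  so the linear term can be absorbed.\<close>

locale bt_good_data = bt_params +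
  fixes a :: "nat \<times> nat \<Rightarrow> nat"
  assumes a: "\<And>p. p \<in> bt_pairs n \<Longrightarrow> a p \<le> K"
    and score: "\<And>i. i \<in> {1..n} \<Longrightarrow> \<bar>bt_score K n a beta i\<bar> \<le> K * n * \<tau> / (8 * exp 1 * b)"
begin

definition g where "g i = bt_degree K n a i - (\<Sum>k\<in>B. bt_degree K n a k) / m"

text \<open>Any parameter at least as likely as the true one is close to it on average, up to the shift z
  that leaves the likelihood invariant.\<close>

lemma consistency:
  assumes "ell_bt K n a beta \<le> ell_bt K n a c"
  obtains z where "(\<Sum>j\<in>{1..n}. \<bar>c j - beta j - z\<bar>) \<le> 2 * n * \<tau>"
proof -
  define x where "x j = c j - beta j" for j
  \<comment> \<open>Subtracting the mean leaves the linear term unchanged, as the scores sum to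
    zero, and lets the pairwise differences control the deviations through
    \<open>n * S \<le> 2 * H\<close>.\<close>
  define z where "z = (\<Sum>j\<in>{1..n}. x j) / n"
  define H where "H = (\<Sum>(i, j)\<in>bt_pairs n. \<bar>x i - x j\<bar>)"
  define S where "S = (\<Sum>j\<in>{1..n}. \<bar>x j - z\<bar>)"
  have npos: "real n > 0" using card_B_J(5) by simp
  have H2: "2 * H = (\<Sum>i\<in>{1..n}. \<Sum>j\<in>{1..n}. \<bar>x i - x j\<bar>)"
    unfolding H_def by (rule sum_bt_pairs_sym) auto
  have "n * \<bar>x i - z\<bar> \<le> (\<Sum>j\<in>{1..n}. \<bar>x i - x j\<bar>)" for i
  proof -
    have "n * (x i - z) = (\<Sum>j\<in>{1..n}. x i - x j)"
      using npos by (simp add: z_def sum_subtractf right_diff_distrib)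
    then have "n * \<bar>x i - z\<bar> = \<bar>\<Sum>j\<in>{1..n}. x i - x j\<bar>" by (metis abs_mult abs_of_nat)
    then show ?thesis by (simp add: sum_abs)
  qed
  then have "(\<Sum>i\<in>{1..n}. n * \<bar>x i - z\<bar>) \<le> 2 * H" unfolding H2 by (rule sum_mono)
  then have S: "n * S \<le> 2 * H" by (simp add: S_def sum_distrib_left)
  have lin: "(\<Sum>i\<in>{1..n}. x i * bt_score K n a beta i) \<le> K * n * \<tau> / (8 * exp 1 * b) * S"
  proof -
    have "(\<Sum>i\<in>{1..n}. x i * bt_score K n a beta i) = (\<Sum>i\<in>{1..n}. (x i - z) * bt_score K n a beta i) + z * (\<Sum>i\<in>{1..n}. bt_score K n a beta i)"
      by (simp add: sum.distrib[symmetric] sum_distrib_left algebra_simps)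
    also have "\<dots> = (\<Sum>i\<in>{1..n}. (x i - z) * bt_score K n a beta i)" by (simp only: sum_bt_score mult_zero_right add_0_right)
    also have "\<dots> \<le> (\<Sum>i\<in>{1..n}. \<bar>x i - z\<bar> * (K * n * \<tau> / (8 * exp 1 * b)))"
    proof (rule sum_mono)
      fix i assume i: "i \<in> {1..n}"
      have "(x i - z) * bt_score K n a beta i \<le> \<bar>x i - z\<bar> * \<bar>bt_score K n a beta i\<bar>" by (simp add: abs_mult[symmetric])
      also have "\<dots> \<le> \<bar>x i - z\<bar> * (K * n * \<tau> / (8 * exp 1 * b))" using score[OF i] by (rule mult_left_mono) simp
      finally show "(x i - z) * bt_score K n a beta i \<le> \<bar>x i - z\<bar> * (K * n * \<tau> / (8 * exp 1 * b))" .
    qed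
    also have "\<dots> = K * n * \<tau> / (8 * exp 1 * b) * S"
      unfolding S_def sum_distrib_right[symmetric] by (rule mult.commute)
    finally show ?thesis .
  qed
  define P where "P = real (card (bt_pairs n))"
  have P: "2 * P \<le> n * n"
    using card_bt_pairs[of n] npos by (simp add: P_def algebra_simps)
  \<comment> \<open>\<open>\<tau> * (h - \<tau>)\<close> is a linear minorant of
    \<open>min (h^2) h\<close>. It converts curvature into control of the L^1 quantity
    \<open>H\<close>, at the price of \<open>\<tau>\<close> per pair.\<close>
  have quad: "\<tau> / (2 * exp 1 * b) * (H - P * \<tau>) \<le> (\<Sum>(i, j)\<in>bt_pairs n. bregman (beta i - beta j) (x i - x j))"
  proof -
    have "\<tau> / (2 * exp 1 * b) * (H - P * \<tau>) = (\<Sum>(i, j)\<in>bt_pairs n. \<tau> / (2 * exp 1 * b) * (\<bar>x i - x j\<bar> - \<tau>))"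
      by (simp add: H_def P_def sum_subtractf sum_distrib_left split_def right_diff_distrib)
    also have "\<dots> \<le> (\<Sum>(i, j)\<in>bt_pairs n. bregman (beta i - beta j) (x i - x j))"
    proof (intro sum_mono, clarify)
      fix i j assume "(i, j) \<in> bt_pairs n"
      then have i: "1 / b \<le> logistic' (beta i - beta j)" by (intro info) (auto simp: bt_pairs_def)
      define h where "h = \<bar>x i - x j\<bar>"
      have h0: "h \<ge> 0" by (simp add: h_def)
      have "\<tau> * (h - \<tau>) \<le> min (h\<^sup>2) (1 * h)"
      proof (rule min.boundedI)
        have "0 \<le> (h - \<tau> / 2)\<^sup>2 + 3 * \<tau>\<^sup>2 / 4" by simp
        then show "\<tau> * (h - \<tau>) \<le> h\<^sup>2" by (simp add: power2_eq_square algebra_simps)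
        have "\<tau> * (h - \<tau>) \<le> \<tau> * h" using \<tau> by (intro mult_left_mono) auto
        also have "\<dots> \<le> 1 * h" using small h0 by (intro mult_right_mono) auto
        finally show "\<tau> * (h - \<tau>) \<le> 1 * h" .
      qed
      then have "1 / (2 * exp 1 * b) * (\<tau> * (h - \<tau>)) \<le> 1 / (2 * exp 1 * b) * min (h\<^sup>2) (1 * h)"
        using b by (intro mult_left_mono) auto
      also have "\<dots> = exp (- 1) * (1 / b) / 2 * min (h\<^sup>2) (1 * h)" by (simp add: exp_minus field_simps)
      also have "\<dots> \<le> exp (- 1) * logistic' (beta i - beta j) / 2 * min (h\<^sup>2) (1 * h)"
        using i h0 by (intro mult_right_mono divide_right_mono mult_left_mono) auto
      also have "\<dots> \<le> bregman (beta i - beta j) (x i - x j)"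
        using bregman_ge[of 1 "beta i - beta j" "x i - x j"] by (simp add: h_def)
      finally show "\<tau> / (2 * exp 1 * b) * (\<bar>x i - x j\<bar> - \<tau>) \<le> bregman (beta i - beta j) (x i - x j)"
        by (simp add: h_def)
    qed
    finally show ?thesis .
  qed
  have "c = (\<lambda>i. beta i + x i)" by (simp add: x_def)
  then have "K * (\<Sum>(i, j)\<in>bt_pairs n. bregman (beta i - beta j) (x i - x j)) \<le> (\<Sum>i\<in>{1..n}. x i * bt_score K n a beta i)"
    using assms ell_bt_expand[of K n a beta x] by simp
  then have "K * (\<tau> / (2 * exp 1 * b) * (H - P * \<tau>)) \<le> K * n * \<tau> / (8 * exp 1 * b) * S"
    using quad lin mult_left_mono[OF quad, of "real K"] by linarith
  moreover have "K * (\<tau> / (2 * exp 1 * b) * (H - P * \<tau>)) = (K * \<tau> / (8 * exp 1 * b)) * (4 * (H - P * \<tau>))"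
  proof -
    have "k * (\<tau> / (2 * e * b) * W) = (k * \<tau> / (8 * e * b)) * (4 * W)" for k e W :: real by (simp add: mult_ac)
    then show ?thesis .
  qed
  moreover have "K * n * \<tau> / (8 * exp 1 * b) * S = (K * \<tau> / (8 * exp 1 * b)) * (n * S)" by simp
  ultimately have "(K * \<tau> / (8 * exp 1 * b)) * (4 * (H - P * \<tau>)) \<le> (K * \<tau> / (8 * exp 1 * b)) * (n * S)" by metis
  moreover have "K * \<tau> / (8 * exp 1 * b) > 0" using K \<tau> b by simp
  ultimately have "4 * (H - P * \<tau>) \<le> n * S" by (simp only: mult_le_cancel_left_pos)
  \<comment> \<open>Absorption: \<open>4 * (H - P * \<tau>) \<le> n * S \<le> 2 * H\<close>.\<close>
  then have "H \<le> 2 * P * \<tau>" using S by simp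
  also have "\<dots> \<le> (n * n) * \<tau>" using P \<tau> by (intro mult_right_mono) auto
  finally have "n * S \<le> n * (2 * n * \<tau>)" using S by simp
  then have "S \<le> 2 * n * \<tau>" using npos by (simp only: mult_le_cancel_left_pos)
  then show ?thesis using that[of z] by (simp add: S_def x_def)
qed

text \<open>Comparisons inside the block have equal strengths and contribute 1/2 each. The
  subtracted term is therefore the same for all \<open>i\<close> in \<open>B\<close>, so score
  differences within the block are degree differences.\<close>

lemma score_block:
  assumes "i \<in> B"
  shows "bt_score K n a (block c t) i = bt_degree K n a i - K * ((\<Sum>j\<in>J. logistic (t - c j)) + (m - 1) / 2)"
proof -
  have eq: "{1..n} - {i} = J \<union> (B - {i})" "J \<inter> (B - {i}) = {}"
    using index_split assms by auto
  have "(\<Sum>j\<in>{1..n} - {i}. logistic (block c t i - block c t j))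
     = (\<Sum>j\<in>J. logistic (block c t i - block c t j)) + (\<Sum>j\<in>B - {i}. logistic (block c t i - block c t j))"
    unfolding eq(1) by (rule sum.union_disjoint) (use eq(2) in auto)
  also have "(\<Sum>j\<in>J. logistic (block c t i - block c t j)) = (\<Sum>j\<in>J. logistic (t - c j))"
    using assms index_split by (intro sum.cong) (auto simp: block_def)
  also have "(\<Sum>j\<in>B - {i}. logistic (block c t i - block c t j)) = (\<Sum>j\<in>B - {i}. 1 / 2)"
    using assms by (intro sum.cong) (auto simp: block_def logistic_def)
  also have "\<dots> = (m - 1) / 2"
  proof -
    have "Suc (card (B - {i})) = card B" using assms by (intro card_Suc_Diff1) auto
    then have "real (card (B - {i})) = m - 1" using card_B_J(1) by linarith
    then show ?thesis by simp
  qed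
  finally show ?thesis by (simp add: bt_score_def)
qed

text \<open>The value of the block coordinate that maximizes the likelihood under the null hypothesis
  when the other coordinates are fixed.\<close>

lemma block_maximizer:
  assumes z: "(\<Sum>j\<in>{1..n}. \<bar>c j - beta j - z\<bar>) \<le> 2 * n * \<tau>"
  obtains t where "\<bar>t - beta 2 - z\<bar> \<le> \<eta>" "\<And>i. i \<in> B \<Longrightarrow> bt_score K n a (block c t) i = g i"
proof -
  \<comment> \<open>\<open>S\<close> is the derivative of the log-likelihood in the common block
    value; \<open>T\<close> is the only part of it that moves with \<open>t\<close>.\<close>
  define T where "T t = (\<Sum>j\<in>J. logistic (t - c j) - logistic (beta 2 - beta j))" for t
  define S where "S t = (\<Sum>i\<in>B. bt_score K n a (block c t) i)" for t
  have ST: "S t = (\<Sum>i\<in>B. bt_score K n a beta i) - m * K * T t" for t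
  proof -
    have "S t = (\<Sum>i\<in>B. bt_score K n a beta i - K * T t)"
      unfolding S_def
    proof (rule sum.cong)
      fix i assume i: "i \<in> B"
      show "bt_score K n a (block c t) i = bt_score K n a beta i - K * T t"
        using score_block[OF i, of c t] score_block[OF i, of beta "beta 2"]
        unfolding block_beta T_def by (simp add: sum_subtractf algebra_simps)
    qed simp
    then show ?thesis by (simp add: sum_subtractf card_B_J(1)[symmetric])
  qed
  have zJ: "(\<Sum>j\<in>J. \<bar>c j - beta j - z\<bar>) \<le> 2 * n * \<tau>"
    using z index_split by (intro order_trans[OF sum_mono2 z]) auto
  have npos: "real n > 0" using card_B_J(5) by simp
  have sc: "\<bar>\<Sum>i\<in>B. bt_score K n a beta i\<bar> \<le> m * K * (n * \<tau>)"
  proof -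
    have div: "u / v \<le> u" if "0 \<le> u" "1 \<le> v" for u v :: real
      using that mult_left_mono[of 1 v u] by (simp add: divide_le_eq)
    have "1 * 1 \<le> 8 * exp 1 * b" using e2 b by (intro mult_mono) auto
    then have "K * n * \<tau> / (8 * exp 1 * b) \<le> K * n * \<tau>" using \<tau> by (intro div) auto
    then have "K * n * \<tau> / (8 * exp 1 * b) \<le> K * (n * \<tau>)" by (simp only: mult.assoc of_nat_mult)
    then have "\<bar>bt_score K n a beta i\<bar> \<le> K * (n * \<tau>)" if "i \<in> B" for i
      using score[of i] index_split that by fastforce
    then have "(\<Sum>i\<in>B. \<bar>bt_score K n a beta i\<bar>) \<le> (\<Sum>i\<in>B. K * (n * \<tau>))" by (rule sum_mono)
    then show ?thesis
      using order_trans[OF sum_abs[of "bt_score K n a beta" B]] by (simp add: card_B_J(1)[symmetric] mult.assoc)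
  qed
  \<comment> \<open>The budget behind \<open>\<eta>\<close>: a gain of \<open>3 * n * \<tau>\<close>
    less the average error \<open>2 * n * \<tau>\<close>. The remainder \<open>n * \<tau>\<close>
    outweighs the block scores in \<open>sc\<close> and forces the sign change of
    \<open>S\<close>.\<close>
  have step: "n * \<tau> \<le> (\<Sum>j\<in>J. \<eta> * (exp (-1) * logistic' (beta 2 - beta j))) - (\<Sum>j\<in>J. \<bar>c j - beta j - z\<bar>)"
  proof -
    have "\<eta> * (exp (-1) * (1 / b)) = 6 * \<tau>" using b by (simp add: \<eta>_def exp_minus)
    then have "3 * n * \<tau> = (n / 2) * (\<eta> * (exp (-1) * (1 / b)))" by simp
    also have "\<dots> \<le> (n - m) * (\<eta> * (exp (-1) * (1 / b)))"
      using card_B_J(4) small b by (intro mult_right_mono) auto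
    also have "\<dots> = (\<Sum>j\<in>J. \<eta> * (exp (-1) * (1 / b)))" by (simp add: card_B_J(2))
    also have "\<dots> \<le> (\<Sum>j\<in>J. \<eta> * (exp (-1) * logistic' (beta 2 - beta j)))"
    proof (intro sum_mono mult_left_mono info)
      fix j assume "j \<in> J"
      then show "2 \<in> {1..n}" "j \<in> {1..n}" "2 \<noteq> j" using index_split r n by auto
    qed (use small in auto)
    finally show ?thesis using zJ by linarith
  qed
  have up: "n * \<tau> \<le> T (beta 2 + z + \<eta>)"
  proof -
    have "(\<Sum>j\<in>J. \<eta> * (exp (-1) * logistic' (beta 2 - beta j)) - \<bar>c j - beta j - z\<bar>) \<le> T (beta 2 + z + \<eta>)"
      unfolding T_def
    proof (rule sum_mono)
      fix j
      have "\<bar>logistic (beta 2 - beta j + \<eta>) - logistic (beta 2 + z + \<eta> - c j)\<bar> \<le> \<bar>c j - beta j - z\<bar>"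
        using logistic_lipschitz[of "beta 2 - beta j + \<eta>" "beta 2 + z + \<eta> - c j"] by (simp add: algebra_simps)
      then show "\<eta> * (exp (-1) * logistic' (beta 2 - beta j)) - \<bar>c j - beta j - z\<bar> \<le> logistic (beta 2 + z + \<eta> - c j) - logistic (beta 2 - beta j)"
        using logistic_diff_ge(1)[of \<eta> "beta 2 - beta j"] small by linarith
    qed
    then show ?thesis using step by (simp add: sum_subtractf)
  qed
  have down: "T (beta 2 + z - \<eta>) \<le> - (n * \<tau>)"
  proof -
    have "T (beta 2 + z - \<eta>) \<le> (\<Sum>j\<in>J. - (\<eta> * (exp (-1) * logistic' (beta 2 - beta j)) - \<bar>c j - beta j - z\<bar>))"
      unfolding T_def
    proof (rule sum_mono)
      fix j
      have "\<bar>logistic (beta 2 + z - \<eta> - c j) - logistic (beta 2 - beta j - \<eta>)\<bar> \<le> \<bar>c j - beta j - z\<bar>"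
        using logistic_lipschitz[of "beta 2 + z - \<eta> - c j" "beta 2 - beta j - \<eta>"] by (simp add: algebra_simps abs_minus_commute)
      then show "logistic (beta 2 + z - \<eta> - c j) - logistic (beta 2 - beta j) \<le> - (\<eta> * (exp (-1) * logistic' (beta 2 - beta j)) - \<bar>c j - beta j - z\<bar>)"
        using logistic_diff_ge(2)[of \<eta> "beta 2 - beta j"] small by linarith
    qed
    then show ?thesis using step by (simp add: sum_subtractf)
  qed
  have mK: "m * K \<ge> 0" using card_B_J(3) by simp
  have "\<exists>t. beta 2 + z - \<eta> \<le> t \<and> t \<le> beta 2 + z + \<eta> \<and> S t = 0"
  proof (rule IVT2)
    show "S (beta 2 + z + \<eta>) \<le> 0"
      using sc mult_left_mono[OF up mK] unfolding ST by linarith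
    show "0 \<le> S (beta 2 + z - \<eta>)"
      using sc mult_left_mono[OF down mK] unfolding ST by linarith
    show "beta 2 + z - \<eta> \<le> beta 2 + z + \<eta>" using small by simp
    have "isCont (\<lambda>t. logistic (t - u)) t" for t u
      by (rule continuous_within_compose3[OF DERIV_isCont[OF logistic_deriv]]) auto
    then show "\<forall>t. beta 2 + z - \<eta> \<le> t \<and> t \<le> beta 2 + z + \<eta> \<longrightarrow> isCont S t"
      unfolding ST T_def by (auto intro!: continuous_intros)
  qed
  then obtain t where "beta 2 + z - \<eta> \<le> t" "t \<le> beta 2 + z + \<eta>" and t0: "S t = 0" by blast
  then have t: "\<bar>t - beta 2 - z\<bar> \<le> \<eta>" "S t = 0" by linarith+
  have "bt_score K n a (block c t) i = g i" if i: "i \<in> B" for i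
  proof -
    \<comment> \<open>At the root the common term \<open>D\<close> must be the mean block degree,
      whatever \<open>c\<close> is.\<close>
    define D where "D = K * ((\<Sum>j\<in>J. logistic (t - c j)) + (m - 1) / 2)"
    have "(\<Sum>k\<in>B. bt_degree K n a k) - m * D = 0"
      using t(2) unfolding S_def by (simp add: score_block D_def[symmetric] sum_subtractf card_B_J(1))
    then have "D = (\<Sum>k\<in>B. bt_degree K n a k) / m" using card_B_J(3) by (simp add: field_simps)
    then show ?thesis using score_block[OF i, of c t] by (simp add: g_def D_def)
  qed
  then show ?thesis using that t(1) by blast
qed

lemma sum_g: "(\<Sum>i\<in>B. g i) = 0"
  using card_B_J(1,3) by (simp add: g_def sum_subtractf)

text \<open>The common term of \<open>score_block\<close> cancels under centring, so
  \<open>g\<close> is also the centred score at the truth; centring costs a factor 2.\<close>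

lemma abs_g_le: "i \<in> B \<Longrightarrow> \<bar>g i\<bar> \<le> K * n * \<tau> / (4 * exp 1 * b)"
proof -
  assume i: "i \<in> B"
  define D where "D = K * ((\<Sum>j\<in>J. logistic (beta 2 - beta j)) + (m - 1) / 2)"
  define e where "e = K * n * \<tau> / (8 * exp 1 * b)"
  have s: "bt_score K n a beta k = bt_degree K n a k - D" if "k \<in> B" for k
    using score_block[OF that, of beta "beta 2"] by (simp add: D_def block_beta)
  have se: "\<bar>bt_score K n a beta k\<bar> \<le> e" if "k \<in> B" for k
    unfolding e_def using that index_split by (intro score) auto
  have "g i = bt_score K n a beta i - (\<Sum>k\<in>B. bt_score K n a beta k) / m"
    using card_B_J(1,3) i by (simp add: g_def s sum_subtractf diff_divide_distrib)
  moreover have "\<bar>(\<Sum>k\<in>B. bt_score K n a beta k) / m\<bar> \<le> e"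
  proof -
    have "\<bar>\<Sum>k\<in>B. bt_score K n a beta k\<bar> \<le> (\<Sum>k\<in>B. e)"
      by (rule order_trans[OF sum_abs sum_mono]) (rule se)
    then show ?thesis using card_B_J(1,3) by (simp add: abs_divide pos_divide_le_eq mult.commute)
  qed
  ultimately have "\<bar>g i\<bar> \<le> 2 * e" using se[OF i] by linarith
  then show ?thesis by (simp add: e_def mult_ac)
qed

text \<open>\<open>logistic'\<close> is 1-Lipschitz, so the terms change by
  \<open>\<eta> + \<bar>c j - beta j - z\<bar>\<close> at most, in total
  \<open>2 * n * \<eta>\<close> up to \<open>K\<close>. Measured against
  \<open>\<Lambda> \<ge> K * n / (2 * b)\<close> this is the relative error
  \<open>4 * b * \<eta>\<close>.\<close>

lemma info_block:
  assumes z: "(\<Sum>j\<in>{1..n}. \<bar>c j - beta j - z\<bar>) \<le> 2 * n * \<tau>" and t: "\<bar>t - beta 2 - z\<bar> \<le> \<eta>"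
  shows "\<bar>K * (\<Sum>j\<in>J. logistic' (t - c j)) - \<Lambda>\<bar> \<le> 4 * b * \<eta> * \<Lambda>"
proof -
  have "\<bar>(\<Sum>j\<in>J. logistic' (t - c j)) - (\<Sum>j\<in>J. logistic' (beta 2 - beta j))\<bar>
      \<le> (\<Sum>j\<in>J. \<bar>logistic' (t - c j) - logistic' (beta 2 - beta j)\<bar>)"
    unfolding sum_subtractf[symmetric] by (rule sum_abs)
  also have "\<dots> \<le> (\<Sum>j\<in>J. \<eta> + \<bar>c j - beta j - z\<bar>)"
  proof (rule sum_mono)
    fix j
    have "\<bar>logistic' (t - c j) - logistic' (beta 2 - beta j)\<bar> \<le> \<bar>(t - c j) - (beta 2 - beta j)\<bar>" by (rule logistic'_lipschitz)
    then show "\<bar>logistic' (t - c j) - logistic' (beta 2 - beta j)\<bar> \<le> \<eta> + \<bar>c j - beta j - z\<bar>" using t by linarith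
  qed
  also have "\<dots> = real (card J) * \<eta> + (\<Sum>j\<in>J. \<bar>c j - beta j - z\<bar>)" by (simp add: sum.distrib)
  also have "\<dots> \<le> n * \<eta> + 2 * n * \<tau>"
  proof (rule add_mono)
    show "real (card J) * \<eta> \<le> n * \<eta>" using card_B_J small by (intro mult_right_mono) auto
    show "(\<Sum>j\<in>J. \<bar>c j - beta j - z\<bar>) \<le> 2 * n * \<tau>"
      using z index_split by (intro order_trans[OF sum_mono2 z]) auto
  qed
  also have "2 * n * \<tau> \<le> n * \<eta>" using small(4) mult_left_mono[of "2 * \<tau>" \<eta> "real n"] by simp
  finally have "\<bar>(\<Sum>j\<in>J. logistic' (t - c j)) - (\<Sum>j\<in>J. logistic' (beta 2 - beta j))\<bar> \<le> 2 * n * \<eta>" by simp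
  then have "K * \<bar>(\<Sum>j\<in>J. logistic' (t - c j)) - (\<Sum>j\<in>J. logistic' (beta 2 - beta j))\<bar> \<le> K * (2 * n * \<eta>)"
    by (rule mult_left_mono) simp
  moreover have "K * (2 * n * \<eta>) = 4 * b * \<eta> * (K * n / (2 * b))" using b by simp
  moreover have "\<dots> \<le> 4 * b * \<eta> * \<Lambda>" using \<Lambda>_ge small b by (intro mult_left_mono) auto
  ultimately show ?thesis by (simp add: \<Lambda>_def right_diff_distrib[symmetric] abs_mult)
qed

text \<open>Only pairs that meet \<open>B\<close> see the increment. Pairs inside \<open>B\<close>
  occur in both orders in the double sum, hence the half.\<close>

lemma ell_block_expand:
  assumes sc: "\<And>i. i \<in> B \<Longrightarrow> bt_score K n a (block c t) i = g i"
    and x: "\<And>i. i \<notin> B \<Longrightarrow> x i = 0"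
  shows "ell_bt K n a (\<lambda>i. block c t i + x i) = ell_bt K n a (block c t) + (\<Sum>i\<in>B. x i * g i)
    - K * ((\<Sum>i\<in>B. \<Sum>j\<in>J. bregman (t - c j) (x i)) + (\<Sum>i\<in>B. \<Sum>k\<in>B. bregman 0 (x i - x k)) / 2)"
proof -
  have lin: "(\<Sum>i\<in>{1..n}. x i * bt_score K n a (block c t) i) = (\<Sum>i\<in>B. x i * g i)"
    by (rule sum.mono_neutral_cong_right) (use index_split x sc in auto)
  define G where "G i j = bregman (block c t i - block c t j) (x i - x j)" for i j
  have JB: "j \<notin> B" if "j \<in> J" for j using index_split(2) that by auto
  have Gsym: "G i j = G j i" for i j
    unfolding G_def using bregman_minus[of "block c t i - block c t j" "x i - x j"] by simp
  have "2 * (\<Sum>(i, j)\<in>bt_pairs n. G i j) = (\<Sum>i\<in>{1..n}. \<Sum>j\<in>{1..n}. G i j)"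
    by (rule sum_bt_pairs_sym) (simp_all add: Gsym[symmetric], simp add: G_def)
  also have "\<dots> = (\<Sum>i\<in>B. \<Sum>j\<in>B. G i j) + (\<Sum>i\<in>B. \<Sum>j\<in>J. G i j) + (\<Sum>i\<in>J. \<Sum>j\<in>B. G i j) + (\<Sum>i\<in>J. \<Sum>j\<in>J. G i j)"
    unfolding index_split(1) using index_split(2) by (simp add: sum.union_disjoint sum.distrib)
  also have "(\<Sum>i\<in>J. \<Sum>j\<in>B. G i j) = (\<Sum>i\<in>B. \<Sum>j\<in>J. G i j)"
    by (subst sum.swap) (simp only: Gsym)
  also have "(\<Sum>i\<in>J. \<Sum>j\<in>J. G i j) = 0"
    by (intro sum.neutral ballI) (simp add: G_def x JB)
  also have "(\<Sum>i\<in>B. \<Sum>j\<in>J. G i j) = (\<Sum>i\<in>B. \<Sum>j\<in>J. bregman (t - c j) (x i))"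
    by (intro sum.cong refl) (simp add: G_def block_def x JB)
  also have "(\<Sum>i\<in>B. \<Sum>j\<in>B. G i j) = (\<Sum>i\<in>B. \<Sum>k\<in>B. bregman 0 (x i - x k))"
    by (intro sum.cong refl) (auto simp: G_def block_def)
  finally have "(\<Sum>(i, j)\<in>bt_pairs n. G i j) = (\<Sum>i\<in>B. \<Sum>j\<in>J. bregman (t - c j) (x i)) + (\<Sum>i\<in>B. \<Sum>k\<in>B. bregman 0 (x i - x k)) / 2"
    by simp
  then show ?thesis using ell_bt_expand[of K n a "block c t" x] lin by (simp add: G_def)
qed

end

section \<open>The likelihood ratio on typical data\<close>

text \<open>The maximum of \<open>x * u - L * x^2\<close> is \<open>u^2 / (4 * L)\<close>. The bound
  on \<open>u\<close> says that the slope cannot beat the linear tail, so capping the square does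
  not raise this maximum.\<close>

lemma linear_minus_min_le:
  fixes u x \<delta> L :: real
  assumes "\<bar>u\<bar> \<le> L * \<delta>" "L > 0"
  shows "x * u - L * min (x\<^sup>2) (\<delta> * \<bar>x\<bar>) \<le> u\<^sup>2 / (4 * L)"
proof -
  have "0 \<le> L * (x - u / (2 * L))\<^sup>2" using assms by simp
  also have "\<dots> = L * x\<^sup>2 - x * u + u\<^sup>2 / (4 * L)"
    using assms by (simp add: power2_eq_square field_simps)
  finally have 1: "x * u - L * x\<^sup>2 \<le> u\<^sup>2 / (4 * L)" by simp
  have "x * u \<le> \<bar>x\<bar> * \<bar>u\<bar>" by (simp add: abs_mult[symmetric])
  also have "\<dots> \<le> \<bar>x\<bar> * (L * \<delta>)" using assms by (intro mult_left_mono) auto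
  finally have "x * u - L * (\<delta> * \<bar>x\<bar>) \<le> 0" by (simp add: mult_ac)
  also have "0 \<le> u\<^sup>2 / (4 * L)" using assms by simp
  finally show ?thesis using 1 by (auto simp: min_def)
qed

context bt_good_data
begin

definition Q where "Q = (\<Sum>i\<in>B. (g i)\<^sup>2) / \<Lambda>"

lemma Q_nonneg: "0 \<le> Q"
  using \<Lambda>_pos by (simp add: Q_def sum_nonneg)

lemma bdd_ell: "bdd_above (ell_bt K n a ` S)"
  by (rule bdd_aboveI[of _ 0]) (auto intro: ell_bt_nonpos a)

lemma beta_null: "beta \<in> bt_null_space r"
  unfolding bt_null_space_def using beta1 null by blast

lemma null_subset: "bt_null_space r \<subseteq> bt_space"
  by (auto simp: bt_space_def bt_null_space_def)

lemma block_null: "c \<in> bt_space \<Longrightarrow> block c t \<in> bt_null_space r"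
  using r by (auto simp: block_def bt_space_def bt_null_space_def B_def)

lemma info_block_bounds:
  assumes "\<bar>L - \<Lambda>\<bar> \<le> 4 * b * \<eta> * \<Lambda>"
  shows "(1 - 4 * b * \<eta>) * \<Lambda> \<le> L" "L \<le> (1 + 4 * b * \<eta>) * \<Lambda>" "\<Lambda> / 2 \<le> L" "0 < L" "K * n / (4 * b) \<le> L"
proof -
  show "(1 - 4 * b * \<eta>) * \<Lambda> \<le> L" "L \<le> (1 + 4 * b * \<eta>) * \<Lambda>"
    using assms by (simp_all add: left_diff_distrib distrib_right abs_le_iff)
  have "4 * b * \<eta> * \<Lambda> \<le> 1/2 * \<Lambda>" using small(5) \<Lambda>_pos by (intro mult_right_mono) auto
  then show 1: "\<Lambda> / 2 \<le> L" using assms by (simp add: abs_le_iff)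
  then show "0 < L" using \<Lambda>_pos by simp
  have "K * n / (4 * b) = K * n / (2 * b) / 2" by simp
  then show "K * n / (4 * b) \<le> L" using 1 \<Lambda>_ge by simp
qed

text \<open>The witness is \<open>block c t\<close>. Replacing the block coordinates of
  \<open>c\<close> by \<open>t\<close> loses at most the sum of one-dimensional maxima, one for each
  \<open>i\<close> in \<open>B\<close>; remainders inside the block are nonnegative and are
  dropped.\<close>

lemma ell_le_null:
  assumes c: "c \<in> bt_space" "ell_bt K n a beta \<le> ell_bt K n a c"
  obtains c0 where "c0 \<in> bt_null_space r" "ell_bt K n a c \<le> ell_bt K n a c0 + exp (4 * \<tau>) / (1 - 4 * b * \<eta>) * Q / 2"
proof -
  obtain z where z: "(\<Sum>j\<in>{1..n}. \<bar>c j - beta j - z\<bar>) \<le> 2 * n * \<tau>" by (rule consistency[OF c(2)])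
  obtain t where t: "\<bar>t - beta 2 - z\<bar> \<le> \<eta>" and sc: "\<And>i. i \<in> B \<Longrightarrow> bt_score K n a (block c t) i = g i"
    by (rule block_maximizer[OF z]) blast
  define L where "L = K * (\<Sum>j\<in>J. logistic' (t - c j))"
  note L = info_block_bounds[OF info_block[OF z t], folded L_def]
  define x where "x i = (if i \<in> B then c i - t else 0)" for i
  \<comment> \<open>The loss in \<open>bregman_ge\<close> for \<open>\<delta> = 4 * \<tau>\<close>.
    This radius is the one for which \<open>abs_g_le\<close>, \<open>\<kappa> \<ge> 1/2\<close> and
    \<open>L \<ge> K * n / (4 * b)\<close> verify the slope condition of
    \<open>linear_minus_min_le\<close>.\<close>
  define \<kappa> where "\<kappa> = exp (- (4 * \<tau>))"
  have \<kappa>: "1/2 \<le> \<kappa>" "0 < \<kappa>" using exp_ge_add_one_self[of "- (4 * \<tau>)"] small by (auto simp: \<kappa>_def)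
  have cx: "c = (\<lambda>i. block c t i + x i)" by (auto simp: x_def block_def)
  have per: "x i * g i - K * (\<Sum>j\<in>J. bregman (t - c j) (x i)) \<le> (g i)\<^sup>2 / (2 * \<kappa> * L)" if i: "i \<in> B" for i
  proof -
    have "\<kappa> * L / 2 * min ((x i)\<^sup>2) (4 * \<tau> * \<bar>x i\<bar>) = K * (\<Sum>j\<in>J. \<kappa> * logistic' (t - c j) / 2 * min ((x i)\<^sup>2) (4 * \<tau> * \<bar>x i\<bar>))"
      unfolding L_def by (simp add: sum_distrib_left sum_distrib_right sum_divide_distrib mult_ac)
    also have "\<dots> \<le> K * (\<Sum>j\<in>J. bregman (t - c j) (x i))"
      unfolding \<kappa>_def using \<tau> by (intro mult_left_mono sum_mono bregman_ge) auto
    finally have 1: "x i * g i - K * (\<Sum>j\<in>J. bregman (t - c j) (x i)) \<le> x i * g i - \<kappa> * L / 2 * min ((x i)\<^sup>2) (4 * \<tau> * \<bar>x i\<bar>)"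
      by simp
    have "\<bar>g i\<bar> \<le> K * n * \<tau> / (4 * exp 1 * b)" by (rule abs_g_le[OF i])
    also have "\<dots> \<le> K * n * \<tau> / (4 * 1 * b)"
      using e2 b \<tau> by (intro divide_left_mono mult_right_mono mult_left_mono) auto
    also have "\<dots> = (1/2) * (K * n / (4 * b)) / 2 * (4 * \<tau>)" by simp
    also have "\<dots> \<le> \<kappa> * L / 2 * (4 * \<tau>)"
      using \<kappa> L(4,5) \<tau> b by (intro mult_right_mono divide_right_mono mult_mono) auto
    finally have F: "x i * g i - \<kappa> * L / 2 * min ((x i)\<^sup>2) (4 * \<tau> * \<bar>x i\<bar>) \<le> (g i)\<^sup>2 / (4 * (\<kappa> * L / 2))"
      by (rule linear_minus_min_le) (use \<kappa> L in simp)
    have eq: "4 * (\<kappa> * L / 2) = 2 * \<kappa> * L" by simp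
    show ?thesis using order_trans[OF 1 F] unfolding eq .
  qed
  have "ell_bt K n a c = ell_bt K n a (\<lambda>i. block c t i + x i)" using cx by simp
  also have "\<dots> = ell_bt K n a (block c t) + (\<Sum>i\<in>B. x i * g i)
    - K * ((\<Sum>i\<in>B. \<Sum>j\<in>J. bregman (t - c j) (x i)) + (\<Sum>i\<in>B. \<Sum>k\<in>B. bregman 0 (x i - x k)) / 2)"
    by (rule ell_block_expand[OF sc]) (auto simp: x_def)
  also have "\<dots> \<le> ell_bt K n a (block c t) + (\<Sum>i\<in>B. x i * g i) - K * (\<Sum>i\<in>B. \<Sum>j\<in>J. bregman (t - c j) (x i))"
  proof -
    have "0 \<le> K * ((\<Sum>i\<in>B. \<Sum>k\<in>B. bregman 0 (x i - x k)) / 2)"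
      by (intro mult_nonneg_nonneg divide_nonneg_nonneg sum_nonneg bregman_nonneg) auto
    then show ?thesis by (simp add: distrib_left)
  qed
  also have "\<dots> = ell_bt K n a (block c t) + (\<Sum>i\<in>B. x i * g i - K * (\<Sum>j\<in>J. bregman (t - c j) (x i)))"
    by (simp add: sum_subtractf sum_distrib_left)
  also have "\<dots> \<le> ell_bt K n a (block c t) + (\<Sum>i\<in>B. (g i)\<^sup>2 / (2 * \<kappa> * L))"
    using per by (intro add_left_mono sum_mono)
  also have "(\<Sum>i\<in>B. (g i)\<^sup>2 / (2 * \<kappa> * L)) = (\<Sum>i\<in>B. (g i)\<^sup>2) / (2 * \<kappa> * L)" by (simp add: sum_divide_distrib)
  also have "\<dots> \<le> (\<Sum>i\<in>B. (g i)\<^sup>2) / (2 * \<kappa> * ((1 - 4 * b * \<eta>) * \<Lambda>))"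
    using L \<kappa> \<Lambda>_pos small(5) by (intro divide_left_mono mult_left_mono sum_nonneg mult_pos_pos) auto
  also have "\<dots> = exp (4 * \<tau>) / (1 - 4 * b * \<eta>) * Q / 2"
  proof -
    have 1: "A / (2 * \<kappa> * (d * l)) = inverse \<kappa> / d * (A / l) / 2" for A d l :: real
      by (simp only: divide_inverse inverse_mult_distrib mult_ac)
    have 2: "inverse \<kappa> = exp (4 * \<tau>)" by (simp add: \<kappa>_def exp_minus)
    show ?thesis unfolding Q_def 2[symmetric] by (rule 1)
  qed
  finally show ?thesis using that[OF block_null[OF c(1)]] by simp
qed

text \<open>First \<open>c\<close> is dominated by \<open>block c t\<close>: it differs by a
  constant on \<open>B\<close>, whose linear term vanishes since \<open>g\<close> sums to zero. A
  Newton step from \<open>block c t\<close> then realizes the gain; it stays in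
  \<open>bt_space\<close> because 1 lies outside \<open>B\<close>.\<close>

lemma null_le_ell:
  assumes c: "c \<in> bt_null_space r" "ell_bt K n a beta \<le> ell_bt K n a c" and Km: "2 * K * m \<le> \<Lambda>"
  obtains c1 where "c1 \<in> bt_space" "ell_bt K n a c + (2 - exp \<tau> - K * m / \<Lambda>) / (1 + 4 * b * \<eta>) * Q / 2 \<le> ell_bt K n a c1"
proof -
  obtain z where z: "(\<Sum>j\<in>{1..n}. \<bar>c j - beta j - z\<bar>) \<le> 2 * n * \<tau>" by (rule consistency[OF c(2)])
  obtain t where t: "\<bar>t - beta 2 - z\<bar> \<le> \<eta>" and sc: "\<And>i. i \<in> B \<Longrightarrow> bt_score K n a (block c t) i = g i"
    by (rule block_maximizer[OF z]) blast
  define L where "L = K * (\<Sum>j\<in>J. logistic' (t - c j))"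
  note L = info_block_bounds[OF info_block[OF z t], folded L_def]
  define x where "x i = (if i \<in> B then c 2 - t else 0)" for i
  \<comment> \<open>The Newton step that ignores the curvature inside the block.\<close>
  define y where "y i = (if i \<in> B then g i / L else 0)" for i
  define G where "G = (\<Sum>i\<in>B. (g i)\<^sup>2)"
  have G0: "G \<ge> 0" by (simp add: G_def sum_nonneg)
  have "c i = c 2" if "i \<in> B" for i using c(1) that unfolding bt_null_space_def B_def by blast
  then have cx: "c = (\<lambda>i. block c t i + x i)" by (auto simp: x_def block_def)
  have "ell_bt K n a c = ell_bt K n a (\<lambda>i. block c t i + x i)" using cx by simp
  also have "\<dots> = ell_bt K n a (block c t) + (\<Sum>i\<in>B. x i * g i)
    - K * ((\<Sum>i\<in>B. \<Sum>j\<in>J. bregman (t - c j) (x i)) + (\<Sum>i\<in>B. \<Sum>k\<in>B. bregman 0 (x i - x k)) / 2)"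
    by (rule ell_block_expand[OF sc]) (auto simp: x_def)
  also have "(\<Sum>i\<in>B. x i * g i) = (c 2 - t) * (\<Sum>i\<in>B. g i)" by (simp add: x_def sum_distrib_left)
  also have "\<dots> = 0" by (simp add: sum_g)
  also have "ell_bt K n a (block c t) + 0 - K * ((\<Sum>i\<in>B. \<Sum>j\<in>J. bregman (t - c j) (x i)) + (\<Sum>i\<in>B. \<Sum>k\<in>B. bregman 0 (x i - x k)) / 2) \<le> ell_bt K n a (block c t)"
  proof -
    have "0 \<le> K * ((\<Sum>i\<in>B. \<Sum>j\<in>J. bregman (t - c j) (x i)) + (\<Sum>i\<in>B. \<Sum>k\<in>B. bregman 0 (x i - x k)) / 2)"
      by (intro mult_nonneg_nonneg add_nonneg_nonneg divide_nonneg_nonneg sum_nonneg bregman_nonneg) auto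
    then show ?thesis by simp
  qed
  finally have le: "ell_bt K n a c \<le> ell_bt K n a (block c t)" .
  have y: "\<bar>y i\<bar> \<le> \<tau>" if i: "i \<in> B" for i
  proof -
    have "\<bar>g i\<bar> \<le> K * n * \<tau> / (4 * exp 1 * b)" by (rule abs_g_le[OF i])
    also have "\<dots> \<le> K * n * \<tau> / (4 * 1 * b)"
      using e2 b \<tau> by (intro divide_left_mono mult_right_mono mult_left_mono) auto
    also have "\<dots> = (K * n / (4 * b)) * \<tau>" by simp
    also have "\<dots> \<le> L * \<tau>" using L \<tau> by (intro mult_right_mono) auto
    finally show ?thesis using i L by (simp add: y_def pos_divide_le_eq mult.commute)
  qed
  have ysum: "(\<Sum>i\<in>B. (y i)\<^sup>2) = G / L\<^sup>2"
    by (simp add: y_def G_def power_divide sum_divide_distrib)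
  have lin: "(\<Sum>i\<in>B. y i * g i) = G / L"
    by (simp add: y_def G_def power2_eq_square sum_divide_distrib)
  have out: "K * (\<Sum>i\<in>B. \<Sum>j\<in>J. bregman (t - c j) (y i)) \<le> exp \<tau> / 2 * (G / L)"
  proof -
    have "K * (\<Sum>i\<in>B. \<Sum>j\<in>J. bregman (t - c j) (y i)) \<le> K * (\<Sum>i\<in>B. \<Sum>j\<in>J. exp \<tau> / 2 * (logistic' (t - c j) * (y i)\<^sup>2))"
    proof (intro mult_left_mono sum_mono)
      fix i j assume i: "i \<in> B"
      have "bregman (t - c j) (y i) \<le> exp \<bar>y i\<bar> * logistic' (t - c j) * (y i)\<^sup>2 / 2" by (rule bregman_le)
      also have "\<dots> \<le> exp \<tau> * logistic' (t - c j) * (y i)\<^sup>2 / 2"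
        using y[OF i] logistic'_pos[of "t - c j"] by (intro divide_right_mono mult_right_mono) auto
      finally show "bregman (t - c j) (y i) \<le> exp \<tau> / 2 * (logistic' (t - c j) * (y i)\<^sup>2)" by simp
    qed simp
    also have "\<dots> = exp \<tau> / 2 * (L * (\<Sum>i\<in>B. (y i)\<^sup>2))"
      unfolding L_def by (simp add: sum_distrib_left sum_distrib_right mult_ac) (rule sum.swap)
    also have "L * (\<Sum>i\<in>B. (y i)\<^sup>2) = G / L" using L unfolding ysum by (simp add: power2_eq_square)
    finally show ?thesis .
  qed
  have inn: "K * ((\<Sum>i\<in>B. \<Sum>k\<in>B. bregman 0 (y i - y k)) / 2) \<le> K * m / (4 * L) * (G / L)"
  proof -
    have "(\<Sum>i\<in>B. \<Sum>k\<in>B. bregman 0 (y i - y k)) \<le> (\<Sum>i\<in>B. \<Sum>k\<in>B. ((y i)\<^sup>2 + (y k)\<^sup>2) / 4)"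
    proof (intro sum_mono)
      fix i k
      have "bregman 0 (y i - y k) \<le> (y i - y k)\<^sup>2 / 8" by (rule bregman_le_sq)
      moreover have "0 \<le> (y i + y k)\<^sup>2" by simp
      then have "(y i - y k)\<^sup>2 \<le> 2 * ((y i)\<^sup>2 + (y k)\<^sup>2)" by (simp add: power2_eq_square algebra_simps)
      ultimately show "bregman 0 (y i - y k) \<le> ((y i)\<^sup>2 + (y k)\<^sup>2) / 4" by simp
    qed
    also have "\<dots> = m * (G / L\<^sup>2) / 2"
      by (simp add: add_divide_distrib sum.distrib card_B_J(1) sum_divide_distrib[symmetric] sum_distrib_left[symmetric] ysum) (simp add: mult.commute)
    finally have "K * ((\<Sum>i\<in>B. \<Sum>k\<in>B. bregman 0 (y i - y k)) / 2) \<le> K * (m * (G / L\<^sup>2) / 2 / 2)"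
      by (intro mult_left_mono divide_right_mono) auto
    then show ?thesis by (simp add: power2_eq_square)
  qed
  define c1 where "c1 = (\<lambda>i. block c t i + y i)"
  have "c1 \<in> bt_space"
    using block_null[of c t] null_subset c(1) index_split by (auto simp: bt_space_def c1_def y_def bt_null_space_def block_def B_def)
  moreover
  have "ell_bt K n a c1 = ell_bt K n a (block c t) + (\<Sum>i\<in>B. y i * g i)
    - K * ((\<Sum>i\<in>B. \<Sum>j\<in>J. bregman (t - c j) (y i)) + (\<Sum>i\<in>B. \<Sum>k\<in>B. bregman 0 (y i - y k)) / 2)"
    unfolding c1_def by (rule ell_block_expand[OF sc]) (auto simp: y_def)
  then have "ell_bt K n a (block c t) + G / L - exp \<tau> / 2 * (G / L) - K * m / (4 * L) * (G / L) \<le> ell_bt K n a c1"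
    using out inn unfolding lin distrib_left by linarith
  moreover have "K * m / (4 * L) \<le> K * m / (2 * \<Lambda>)"
    using L \<Lambda>_pos card_B_J(3) by (intro divide_left_mono mult_pos_pos) auto
  then have "K * m / (4 * L) * (G / L) \<le> K * m / (2 * \<Lambda>) * (G / L)" using G0 L by (intro mult_right_mono) auto
  \<comment> \<open>Passing from \<open>L\<close> to its upper bound requires a nonnegative
    coefficient; \<open>2 * K * m \<le> \<Lambda>\<close> keeps it so.\<close>
  moreover have "(2 - exp \<tau> - K * m / \<Lambda>) / 2 * (G / ((1 + 4 * b * \<eta>) * \<Lambda>)) \<le> (2 - exp \<tau> - K * m / \<Lambda>) / 2 * (G / L)"
  proof (rule mult_left_mono)
    have "exp \<tau> \<le> 1 + 2 * \<tau>" using exp_bound_lemma[of \<tau>] small(1) \<tau>(1) by simp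
    moreover have "K * m / \<Lambda> \<le> 1/2" using Km \<Lambda>_pos by (simp add: pos_divide_le_eq)
    ultimately show "0 \<le> (2 - exp \<tau> - K * m / \<Lambda>) / 2" using small by simp
    show "G / ((1 + 4 * b * \<eta>) * \<Lambda>) \<le> G / L" using L G0 \<Lambda>_pos b small by (intro divide_left_mono mult_pos_pos) (auto intro!: add_pos_nonneg)
  qed
  moreover have "(2 - exp \<tau> - K * m / \<Lambda>) / 2 * (G / L) = G / L - exp \<tau> / 2 * (G / L) - K * m / (2 * \<Lambda>) * (G / L)"
    by (simp add: diff_divide_distrib left_diff_distrib)
  moreover have "(2 - exp \<tau> - K * m / \<Lambda>) / 2 * (G / ((1 + 4 * b * \<eta>) * \<Lambda>)) = (2 - exp \<tau> - K * m / \<Lambda>) / (1 + 4 * b * \<eta>) * Q / 2"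
    by (simp add: Q_def G_def)
  ultimately have "ell_bt K n a c + (2 - exp \<tau> - K * m / \<Lambda>) / (1 + 4 * b * \<eta>) * Q / 2 \<le> ell_bt K n a c1"
    using le by linarith
  then show ?thesis using that \<open>c1 \<in> bt_space\<close> by blast
qed

lemma bt_lrt_le: "bt_lrt K n r a \<le> exp (4 * \<tau>) / (1 - 4 * b * \<eta>) * Q"
proof -
  define U where "U = exp (4 * \<tau>) / (1 - 4 * b * \<eta>) * Q / 2"
  have U: "U \<ge> 0" unfolding U_def using Q_nonneg small(5) by (intro divide_nonneg_nonneg mult_nonneg_nonneg) auto
  have up: "ell_bt K n a c \<le> (SUP b\<in>bt_null_space r. ell_bt K n a b)" if "c \<in> bt_null_space r" for c
    using that by (rule cSUP_upper[OF _ bdd_ell])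
  have "(SUP b\<in>bt_space. ell_bt K n a b) \<le> (SUP b\<in>bt_null_space r. ell_bt K n a b) + U"
  proof (rule cSUP_least)
    show "bt_space \<noteq> {}" using beta_null null_subset by blast
    fix c assume c: "c \<in> bt_space"
    show "ell_bt K n a c \<le> (SUP b\<in>bt_null_space r. ell_bt K n a b) + U"
    \<comment> \<open>\<open>consistency\<close> speaks only of parameters at least as likely as
      \<open>beta\<close>; all others are beaten by \<open>beta\<close> itself, which belongs to the
      null space.\<close>
    proof (cases "ell_bt K n a beta \<le> ell_bt K n a c")
      case True
      obtain c0 where "c0 \<in> bt_null_space r" "ell_bt K n a c \<le> ell_bt K n a c0 + U"
        unfolding U_def by (rule ell_le_null[OF c True])
      then show ?thesis using up[of c0] by linarith
    next
      case False
      then show ?thesis using up[OF beta_null] U by linarith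
    qed
  qed
  moreover have eq: "exp (4 * \<tau>) / (1 - 4 * b * \<eta>) * Q = 2 * U" by (simp only: U_def mult_2 field_sum_of_halves)
  ultimately show ?thesis unfolding bt_lrt_def eq by simp
qed

lemma bt_lrt_ge:
  assumes Km: "2 * K * m \<le> \<Lambda>"
  shows "(2 - exp \<tau> - K * m / \<Lambda>) / (1 + 4 * b * \<eta>) * Q \<le> bt_lrt K n r a"
proof -
  define W where "W = (2 - exp \<tau> - K * m / \<Lambda>) / (1 + 4 * b * \<eta>) * Q / 2"
  have up: "ell_bt K n a c \<le> (SUP b\<in>bt_space. ell_bt K n a b)" if "c \<in> bt_space" for c
    using that by (rule cSUP_upper[OF _ bdd_ell])
  have "(SUP b\<in>bt_null_space r. ell_bt K n a b) \<le> (SUP b\<in>bt_space. ell_bt K n a b) - W"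
  proof (rule cSUP_least)
    show "bt_null_space r \<noteq> {}" using beta_null by blast
    fix c assume c: "c \<in> bt_null_space r"
    \<comment> \<open>A null parameter less likely than \<open>beta\<close> may be replaced by
      \<open>beta\<close>, which brings it within reach of \<open>consistency\<close>.\<close>
    define c' where "c' = (if ell_bt K n a beta \<le> ell_bt K n a c then c else beta)"
    have c': "c' \<in> bt_null_space r" "ell_bt K n a beta \<le> ell_bt K n a c'" "ell_bt K n a c \<le> ell_bt K n a c'"
      using c beta_null by (auto simp: c'_def)
    obtain c1 where "c1 \<in> bt_space" "ell_bt K n a c' + W \<le> ell_bt K n a c1"
      unfolding W_def by (rule null_le_ell[OF c'(1,2) Km])
    then show "ell_bt K n a c \<le> (SUP b\<in>bt_space. ell_bt K n a b) - W" using up[of c1] c'(3) by linarith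
  qed
  moreover have eq: "(2 - exp \<tau> - K * m / \<Lambda>) / (1 + 4 * b * \<eta>) * Q = 2 * W" by (simp only: W_def mult_2 field_sum_of_halves)
  ultimately show ?thesis unfolding bt_lrt_def eq by simp
qed

end

section \<open>Distribution of the comparisons\<close>

lemma
  assumes p: "p \<in> {0..1}"
  shows expectation_binomial: "measure_pmf.expectation (binomial_pmf N p) real = N * p"
    and variance_binomial: "measure_pmf.expectation (binomial_pmf N p) (\<lambda>k. (real k - N * p)\<^sup>2) = N * p * (1 - p)"
proof -
  have E: "measure_pmf.expectation (binomial_pmf N p) f = (\<Sum>k\<le>N. f k * Bernstein N k p)" for f :: "nat \<Rightarrow> real"
    by (simp add: expectation_binomial_pmf'[OF p] Bernstein_def mult_ac)
  show "measure_pmf.expectation (binomial_pmf N p) real = N * p" by (simp add: E)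
  \<comment> \<open>The centred square in terms of \<open>k * (k - 1)\<close>, \<open>k\<close> and
    1, whose sums against Bernstein polynomials are known.\<close>
  have "(real k - N * p)\<^sup>2 * Bernstein N k p = real k * (real k - 1) * Bernstein N k p
      + (1 - 2 * (N * p)) * (real k * Bernstein N k p) + (N * p)\<^sup>2 * Bernstein N k p" for k
    by (simp add: power2_eq_square algebra_simps)
  then show "measure_pmf.expectation (binomial_pmf N p) (\<lambda>k. (real k - N * p)\<^sup>2) = N * p * (1 - p)"
    unfolding E by (simp add: sum.distrib sum_distrib_left[symmetric]) (simp add: power2_eq_square algebra_simps)
qed

text \<open>Disjoint groups of coordinates are independent; \<open>dep\<close> says that
  \<open>Y l\<close> reads its own group only, so that restricting its argument is harmless.\<close>

lemma indep_vars_Pi_pmf_blocks: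
  fixes Y :: "'l \<Rightarrow> ('i \<Rightarrow> 'c) \<Rightarrow> real"
  assumes I: "finite I" and C: "\<And>l. l \<in> L \<Longrightarrow> C l \<subseteq> I" "disjoint_family_on C L"
    and Y: "\<And>l. l \<in> L \<Longrightarrow> Y l \<in> borel_measurable (\<Pi>\<^sub>M i\<in>C l. count_space UNIV)"
    and dep: "\<And>l f. l \<in> L \<Longrightarrow> Y l (restrict f (C l)) = Y l f"
  shows "prob_space.indep_vars (measure_pmf (Pi_pmf I dflt p)) (\<lambda>_. borel) Y L"
proof -
  have "prob_space.indep_vars (measure_pmf (Pi_pmf I dflt p)) (\<lambda>l. PiM (C l) (\<lambda>_. count_space UNIV)) (\<lambda>l f. restrict (\<lambda>i. f i) (C l)) L"
    by (rule prob_space.indep_vars_restrict[OF measure_pmf.prob_space_axioms indep_vars_Pi_pmf[OF I] C])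
  then have "prob_space.indep_vars (measure_pmf (Pi_pmf I dflt p)) (\<lambda>_. borel) (\<lambda>l f. Y l (restrict (\<lambda>i. f i) (C l))) L"
    by (rule prob_space.indep_vars_compose2[OF measure_pmf.prob_space_axioms]) (rule Y)
  then show ?thesis
    by (rule prob_space.indep_vars_cong[OF measure_pmf.prob_space_axioms, THEN iffD1, rotated -1]) (auto simp: dep)
qed

text \<open>The key under which the comparison of \<open>i\<close> and \<open>j\<close> is stored,
  in either order. Outside subjects lie on both sides of the block, so both orders occur.\<close>

definition bt_coord :: "nat \<Rightarrow> nat \<Rightarrow> nat \<times> nat" where
  "bt_coord i j = (min i j, max i j)"

lemma bt_count_eq: "i \<noteq> j \<Longrightarrow> bt_count K a i j = (if i < j then real (a (bt_coord i j)) else K - real (a (bt_coord i j)))"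
  by (auto simp: bt_count_def bt_coord_def min_def max_def)

lemma bt_coord_pairs: "i \<in> {1..n} \<Longrightarrow> j \<in> {1..n} \<Longrightarrow> i \<noteq> j \<Longrightarrow> bt_coord i j \<in> bt_pairs n"
  by (auto simp: bt_coord_def bt_pairs_def)

lemma bt_prob_eq: "bt_prob u v = logistic (u - v)"
  by (simp add: bt_prob_def logistic_def)

lemma set_pmf_bt_data:
  assumes "a \<in> set_pmf (bt_data K n beta)" "p \<in> bt_pairs n"
  shows "a p \<le> K"
proof -
  obtain i j where p: "p = (i, j)" by (cases p)
  have "a p \<in> set_pmf (binomial_pmf K (bt_prob (beta i) (beta j)))"
    using assms by (auto simp: bt_data_def set_Pi_pmf PiE_dflt_def p)
  then show ?thesis using logistic_bounds[of "beta i - beta j"] by (simp add: bt_prob_eq)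
qed

lemma expectation_bt_data_coord:
  fixes h :: "nat \<Rightarrow> real"
  assumes "(i, j) \<in> bt_pairs n"
  shows "measure_pmf.expectation (bt_data K n beta) (\<lambda>a. h (a (i, j))) = measure_pmf.expectation (binomial_pmf K (logistic (beta i - beta j))) h"
proof -
  have "map_pmf (\<lambda>a. a (i, j)) (bt_data K n beta) = binomial_pmf K (logistic (beta i - beta j))"
    unfolding bt_data_def using assms by (subst Pi_pmf_component) (auto simp: bt_prob_eq)
  then show ?thesis using integral_map_pmf[of "\<lambda>a. a (i, j)" "bt_data K n beta" h] by simp
qed

lemma
  assumes ij: "i \<in> {1..n}" "j \<in> {1..n}" "i \<noteq> j"
  shows expectation_bt_count: "measure_pmf.expectation (bt_data K n beta) (\<lambda>a. bt_count K a i j) = K * logistic (beta i - beta j)"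
    and variance_bt_count: "measure_pmf.expectation (bt_data K n beta) (\<lambda>a. (bt_count K a i j - K * logistic (beta i - beta j))\<^sup>2) = K * logistic' (beta i - beta j)"
    and integrable_bt_count: "integrable (measure_pmf (bt_data K n beta)) (\<lambda>a. bt_count K a i j)"
proof -
  let ?P = "bt_data K n beta"
  have fin: "finite (set_pmf ?P)"
    unfolding bt_data_def using logistic_bounds
    by (subst set_Pi_pmf) (auto intro!: finite_PiE_dflt simp: bt_prob_eq less_imp_le)
  then show int: "integrable (measure_pmf ?P) (\<lambda>a. bt_count K a i j)" by (rule integrable_measure_pmf_finite)
  have p: "logistic t \<in> {0..1}" for t using logistic_bounds[of t] by simp
  show "measure_pmf.expectation ?P (\<lambda>a. bt_count K a i j) = K * logistic (beta i - beta j)"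
  proof (cases "i < j")
    case True
    then have "(i, j) \<in> bt_pairs n" using ij by (auto simp: bt_pairs_def)
    from expectation_bt_data_coord[OF this, of K beta real] True show ?thesis
      by (simp add: bt_count_def expectation_binomial[OF p])
  next
    case False
    then have "(j, i) \<in> bt_pairs n" using ij by (auto simp: bt_pairs_def)
    have "measure_pmf.expectation (binomial_pmf K (logistic (beta j - beta i))) (\<lambda>k. real K - real k) = K - K * logistic (beta j - beta i)"
      by (subst Bochner_Integration.integral_diff) (use integrable_binomial_pmf[OF p] expectation_binomial[OF p] in simp_all)
    with expectation_bt_data_coord[OF \<open>(j, i) \<in> bt_pairs n\<close>, of K beta "\<lambda>k. real K - real k"] False show ?thesis
      using logistic_minus[of "beta j - beta i"]
      by (simp add: bt_count_def right_diff_distrib)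
  qed
  show "measure_pmf.expectation ?P (\<lambda>a. (bt_count K a i j - K * logistic (beta i - beta j))\<^sup>2) = K * logistic' (beta i - beta j)"
  proof (cases "i < j")
    case True
    then have "(i, j) \<in> bt_pairs n" using ij by (auto simp: bt_pairs_def)
    from expectation_bt_data_coord[OF this, of K beta "\<lambda>k. (real k - K * logistic (beta i - beta j))\<^sup>2"] True show ?thesis
      by (simp add: bt_count_def variance_binomial[OF p] logistic'_eq)
  next
    case False
    then have "(j, i) \<in> bt_pairs n" using ij by (auto simp: bt_pairs_def)
    have l: "logistic (beta i - beta j) = 1 - logistic (beta j - beta i)"
      using logistic_minus[of "beta i - beta j"] by simp
    have "(real K - real k - K * logistic (beta i - beta j))\<^sup>2 = (real k - K * logistic (beta j - beta i))\<^sup>2" for k :: nat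
      unfolding l by (simp add: power2_eq_square algebra_simps)
    with expectation_bt_data_coord[OF \<open>(j, i) \<in> bt_pairs n\<close>, of K beta "\<lambda>k. (real k - K * logistic (beta j - beta i))\<^sup>2"] False show ?thesis
      using logistic'_minus[of "beta i - beta j"] by (simp add: bt_count_def variance_binomial[OF p] logistic'_eq[symmetric] mult.assoc)
  qed
qed

lemma AE_bt_count:
  assumes ij: "i \<in> {1..n}" "j \<in> {1..n}" "i \<noteq> j"
  shows "AE a in measure_pmf (bt_data K n beta). bt_count K a i j \<in> {0..K}"
proof (rule AE_pmfI)
  fix a assume "a \<in> set_pmf (bt_data K n beta)"
  from set_pmf_bt_data[OF this bt_coord_pairs[OF ij]] show "bt_count K a i j \<in> {0..K}"
    using ij by (simp add: bt_count_eq)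
qed

lemma indep_vars_bt_count:
  assumes i: "i \<in> {1..n}" and J: "J \<subseteq> {1..n} - {i}"
  shows "prob_space.indep_vars (measure_pmf (bt_data K n beta)) (\<lambda>_. borel) (\<lambda>j a. bt_count K a i j) J"
  unfolding bt_data_def
proof (rule indep_vars_Pi_pmf_blocks[where C = "\<lambda>j. {bt_coord i j}"])
  show "finite (bt_pairs n)" by simp
  show "{bt_coord i j} \<subseteq> bt_pairs n" if "j \<in> J" for j
  proof -
    have "j \<in> {1..n}" "i \<noteq> j" using J that by auto
    then show ?thesis using bt_coord_pairs[OF i] by simp
  qed
  show "disjoint_family_on (\<lambda>j. {bt_coord i j}) J"
    using J by (auto simp: disjoint_family_on_def bt_coord_def min_def max_def split: if_splits)
  show "(\<lambda>a. bt_count K a i j) \<in> borel_measurable (\<Pi>\<^sub>M i\<in>{bt_coord i j}. count_space UNIV)" if "j \<in> J" for j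
  proof -
    have "i \<noteq> j" using J that by auto
    then show ?thesis
      unfolding bt_count_eq[OF \<open>i \<noteq> j\<close>] by (cases "i < j") (simp_all, measurable)
  qed
  show "bt_count K (restrict a {bt_coord i j}) i j = bt_count K a i j" if "j \<in> J" for j a
  proof -
    have "i \<noteq> j" using J that by auto
    then show ?thesis by (simp add: bt_count_eq)
  qed
qed

text \<open>The key sets \<open>bt_coord i\<close> applied to \<open>J\<close> are disjoint for
  distinct \<open>i\<close> in \<open>B\<close>: a shared key would compare two members of
  \<open>B\<close>, while each key has an end in \<open>J\<close>.\<close>

lemma indep_vars_bt_block:
  assumes J: "J \<subseteq> {1..n}" "B \<subseteq> {1..n}" "B \<inter> J = {}"
  shows "prob_space.indep_vars (measure_pmf (bt_data K n beta)) (\<lambda>_. borel)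
    (\<lambda>i a. (\<Sum>j\<in>J. bt_count K a i j - e i j) / s) B"
  unfolding bt_data_def
proof (rule indep_vars_Pi_pmf_blocks[where C = "\<lambda>i. bt_coord i ` J"])
  have ne: "i \<noteq> j" if "i \<in> B" "j \<in> J" for i j using that J by auto
  show "finite (bt_pairs n)" by simp
  show "bt_coord i ` J \<subseteq> bt_pairs n" if "i \<in> B" for i
    using bt_coord_pairs[of i n] J that ne by blast
  show "disjoint_family_on (\<lambda>i. bt_coord i ` J) B"
    using J by (auto simp: disjoint_family_on_def bt_coord_def min_def max_def split: if_splits)
  show "(\<lambda>a. (\<Sum>j\<in>J. bt_count K a i j - e i j) / s) \<in> borel_measurable (\<Pi>\<^sub>M i\<in>bt_coord i ` J. count_space UNIV)" if "i \<in> B" for i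
  proof (intro borel_measurable_divide borel_measurable_sum borel_measurable_diff borel_measurable_const)
    fix j assume j: "j \<in> J"
    have c: "(\<lambda>a. a (bt_coord i j)) \<in> measurable (\<Pi>\<^sub>M i\<in>bt_coord i ` J. count_space UNIV) (count_space UNIV)"
      by (rule measurable_component_singleton) (use j in auto)
    have "(\<lambda>a. real (a (bt_coord i j))) \<in> borel_measurable (\<Pi>\<^sub>M i\<in>bt_coord i ` J. count_space UNIV)"
      by (rule measurable_compose[OF c]) simp
    then show "(\<lambda>a. bt_count K a i j) \<in> borel_measurable (\<Pi>\<^sub>M i\<in>bt_coord i ` J. count_space UNIV)"
      unfolding bt_count_eq[OF ne[OF that j]] by (cases "i < j") simp_all
  qed
  show "(\<Sum>j\<in>J. bt_count K (restrict a (bt_coord i ` J)) i j - e i j) / s = (\<Sum>j\<in>J. bt_count K a i j - e i j) / s" if "i \<in> B" for i a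
    using ne[OF that] by (intro arg_cong2[where f = "(/)"] sum.cong refl) (simp add: bt_count_eq)
qed

lemma prob_bt_score_ge:
  assumes i: "i \<in> {1..n}" and n: "n > 1" and K: "K \<ge> 1" and \<epsilon>: "\<epsilon> \<ge> 0"
  shows "measure_pmf.prob (bt_data K n beta) {a. \<epsilon> \<le> \<bar>bt_score K n a beta i\<bar>} \<le> 2 * exp (- 2 * \<epsilon>\<^sup>2 / (n * (real K)\<^sup>2))"
proof -
  let ?P = "measure_pmf (bt_data K n beta)" and ?J = "{1..n} - {i}"
  interpret Hoeffding_ineq ?P ?J "\<lambda>j a. bt_count K a i j" "\<lambda>_. 0" "\<lambda>_. real K" "\<Sum>j\<in>?J. measure_pmf.expectation (bt_data K n beta) (\<lambda>a. bt_count K a i j)"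
  proof unfold_locales
    show "prob_space.indep_vars ?P (\<lambda>_. borel) (\<lambda>j a. bt_count K a i j) ?J"
      by (rule indep_vars_bt_count[OF i]) simp
    show "AE a in ?P. bt_count K a i j \<in> {0..real K}" if "j \<in> ?J" for j
      by (rule AE_bt_count) (use i that in auto)
  qed simp_all
  have card: "real (card ?J) = real n - 1" using i by (simp add: of_nat_diff)
  have \<mu>: "(\<Sum>j\<in>?J. measure_pmf.expectation (bt_data K n beta) (\<lambda>a. bt_count K a i j)) = (\<Sum>j\<in>?J. K * logistic (beta i - beta j))"
    by (intro sum.cong refl expectation_bt_count) (use i in auto)
  have sc: "(\<Sum>j\<in>?J. bt_count K a i j) - (\<Sum>j\<in>?J. K * logistic (beta i - beta j)) = bt_score K n a beta i" for a
    by (simp add: bt_score_def bt_degree_def sum_distrib_left)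
  have "measure_pmf.prob (bt_data K n beta) {a. \<epsilon> \<le> \<bar>bt_score K n a beta i\<bar>} \<le> 2 * exp (- 2 * \<epsilon>\<^sup>2 / (\<Sum>j\<in>?J. (real K - 0)\<^sup>2))"
    using Hoeffding_ineq_abs_ge[OF \<epsilon>] n K i unfolding \<mu> sc by (simp add: card)
  also have "(\<Sum>j\<in>?J. (real K - 0)\<^sup>2) = (real n - 1) * (real K)\<^sup>2" by (simp only: sum_constant card diff_zero)
  also have "2 * exp (- 2 * \<epsilon>\<^sup>2 / ((real n - 1) * (real K)\<^sup>2)) \<le> 2 * exp (- 2 * \<epsilon>\<^sup>2 / (n * (real K)\<^sup>2))"
  proof -
    have "2 * \<epsilon>\<^sup>2 / (n * (real K)\<^sup>2) \<le> 2 * \<epsilon>\<^sup>2 / ((real n - 1) * (real K)\<^sup>2)"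
      using n K by (intro divide_left_mono mult_right_mono mult_pos_pos) auto
    then show ?thesis by simp
  qed
  finally show ?thesis .
qed

section \<open>Convergence of the statistic\<close>

text \<open>A copy of \<open>\<Lambda>\<close> outside the locale, whose assumptions hold only
  eventually along the sequence.\<close>

definition bt_info :: "nat \<Rightarrow> nat \<Rightarrow> nat \<Rightarrow> (nat \<Rightarrow> real) \<Rightarrow> real" where
  "bt_info K n r beta = K * (\<Sum>j\<in>{1..n} - {2..r}. logistic' (beta 2 - beta j))"

text \<open>The normalized centred score of a block member against the subjects outside the block: these
  are independent over the block, unlike the full degrees.\<close>

definition bt_outer :: "nat \<Rightarrow> nat \<Rightarrow> nat \<Rightarrow> (nat \<Rightarrow> real) \<Rightarrow> (nat \<times> nat \<Rightarrow> nat) \<Rightarrow> nat \<Rightarrow> real" where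
  "bt_outer K n r beta a i =
     (\<Sum>j\<in>{1..n} - {2..r}. bt_count K a i j - K * logistic (beta i - beta j)) / sqrt (bt_info K n r beta)"

definition sum_sq_dev :: "'i set \<Rightarrow> ('i \<Rightarrow> real) \<Rightarrow> real" where
  "sum_sq_dev I z = (\<Sum>i\<in>I. (z i - (\<Sum>j\<in>I. z j) / card I)\<^sup>2)"

text \<open>Young's inequality with a free weight, so that the main term can be kept with a factor
  tending to 1.\<close>

lemma power2_sum_le:
  fixes x y w :: real
  assumes "w > 0"
  shows "(x + y)\<^sup>2 \<le> (1 + w) * x\<^sup>2 + (1 + 1 / w) * y\<^sup>2"
proof -
  have "0 \<le> (w * x - y)\<^sup>2 / w" using assms by simp
  also have "\<dots> = w * x\<^sup>2 - 2 * x * y + y\<^sup>2 / w" using assms by (simp add: power2_eq_square field_simps)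
  finally show ?thesis by (simp add: power2_eq_square algebra_simps)
qed

lemma (in bt_params) bt_info_eq: "bt_info K n r beta = \<Lambda>"
  by (simp add: bt_info_def \<Lambda>_def J_def)

context bt_good_data
begin

text \<open>\<open>g\<close> is the centred outside score plus the centred number of wins inside the
  block. The latter is at most \<open>m * K\<close> in modulus, hence negligible after division by
  \<open>\<Lambda>\<close>.\<close>

lemma Q_sum_sq_dev:
  assumes w: "w > 0"
  shows "Q \<le> (1 + w) * sum_sq_dev {2..r} (bt_outer K n r beta a) + (1 + 1 / w) * (m * (m * K)\<^sup>2) / \<Lambda>"
    and "sum_sq_dev {2..r} (bt_outer K n r beta a) \<le> (1 + w) * Q + (1 + 1 / w) * (m * (m * K)\<^sup>2) / \<Lambda>"
proof -
  define u where "u i = (\<Sum>j\<in>J. bt_count K a i j - K * logistic (beta i - beta j))" for i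
  define v where "v i = u i - (\<Sum>k\<in>B. u k) / m" for i
  define N where "N i = (\<Sum>k\<in>B - {i}. bt_count K a i k)" for i
  define w' where "w' i = N i - (\<Sum>k\<in>B. N k) / m" for i
  define c0 where "c0 = K * (\<Sum>j\<in>J. logistic (beta 2 - beta j))"
  have deg: "bt_degree K n a i = u i + c0 + N i" if i: "i \<in> B" for i
  proof -
    have eq: "{1..n} - {i} = J \<union> (B - {i})" "J \<inter> (B - {i}) = {}" using index_split i by auto
    have "bt_degree K n a i = (\<Sum>j\<in>J. bt_count K a i j) + N i"
      unfolding bt_degree_def eq(1) N_def by (rule sum.union_disjoint) (use eq(2) in auto)
    moreover have "beta i = beta 2" using null[of i] i by (simp add: B_def)
    ultimately show ?thesis by (simp add: u_def c0_def sum_subtractf sum_distrib_left)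
  qed
  have gvw: "g i = v i + w' i" if i: "i \<in> B" for i
  proof -
    have "(\<Sum>k\<in>B. bt_degree K n a k) = (\<Sum>k\<in>B. u k) + m * c0 + (\<Sum>k\<in>B. N k)"
      by (simp add: deg sum.distrib card_B_J(1))
    then show ?thesis using card_B_J(3) by (simp add: g_def deg[OF i] v_def w'_def add_divide_distrib)
  qed
  have Nb: "0 \<le> N i \<and> N i \<le> m * K" if i: "i \<in> B" for i
  proof -
    have c: "0 \<le> bt_count K a i k \<and> bt_count K a i k \<le> K" if "k \<in> B - {i}" for k
    proof -
      have "i \<noteq> k" "bt_coord i k \<in> bt_pairs n" using that i index_split(3) by (auto intro!: bt_coord_pairs)
      then show ?thesis using a[of "bt_coord i k"] by (simp add: bt_count_eq)
    qed
    have "N i \<le> (\<Sum>k\<in>B - {i}. K)" unfolding N_def of_nat_sum using c by (intro sum_mono) auto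
    also have "\<dots> \<le> (\<Sum>k\<in>B. K)" unfolding of_nat_sum by (intro sum_mono2) auto
    finally have "N i \<le> m * K" by (simp add: card_B_J(1)[symmetric])
    moreover have "0 \<le> N i" unfolding N_def using c by (intro sum_nonneg) auto
    ultimately show ?thesis by simp
  qed
  have mean: "0 \<le> (\<Sum>k\<in>B. N k) / m \<and> (\<Sum>k\<in>B. N k) / m \<le> m * K"
  proof -
    have "(\<Sum>k\<in>B. N k) \<le> (\<Sum>k\<in>B. m * K)" using Nb by (intro sum_mono) auto
    moreover have "0 \<le> (\<Sum>k\<in>B. N k)" using Nb by (intro sum_nonneg) auto
    ultimately show ?thesis using card_B_J(1,3) by (simp add: pos_divide_le_eq mult_ac)
  qed
  have w'2: "(w' i)\<^sup>2 \<le> (m * K)\<^sup>2" if "i \<in> B" for i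
  proof -
    have "\<bar>w' i\<bar> \<le> m * K" using Nb[OF that] mean by (simp add: w'_def abs_le_iff)
    then have "\<bar>w' i\<bar>\<^sup>2 \<le> (m * K)\<^sup>2" by (intro power_mono) auto
    then show ?thesis by simp
  qed
  have Bw: "(\<Sum>i\<in>B. (1 + 1 / w) * (w' i)\<^sup>2) \<le> (1 + 1 / w) * (m * (m * K)\<^sup>2)"
  proof -
    have "(\<Sum>i\<in>B. (1 + 1 / w) * (w' i)\<^sup>2) \<le> (\<Sum>i\<in>B. (1 + 1 / w) * (m * K)\<^sup>2)"
      using w w'2 by (intro sum_mono mult_left_mono) auto
    then show ?thesis by (simp add: card_B_J(1) mult.left_commute[of m])
  qed
  have dev: "sum_sq_dev {2..r} (bt_outer K n r beta a) = (\<Sum>i\<in>B. (v i)\<^sup>2) / \<Lambda>"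
  proof -
    have o: "bt_outer K n r beta a = (\<lambda>i. u i / sqrt \<Lambda>)"
      by (simp add: bt_outer_def u_def bt_info_eq J_def fun_eq_iff)
    have "u i / sqrt \<Lambda> - (\<Sum>j\<in>B. u j / sqrt \<Lambda>) / card B = v i / sqrt \<Lambda>" for i
      by (simp add: v_def card_B_J(1) sum_divide_distrib[symmetric] diff_divide_distrib mult.commute)
    then have "sum_sq_dev B (\<lambda>i. u i / sqrt \<Lambda>) = (\<Sum>i\<in>B. (v i)\<^sup>2 / \<Lambda>)"
      using \<Lambda>_pos by (simp add: sum_sq_dev_def power_divide)
    then show ?thesis unfolding o B_def[symmetric] by (simp add: sum_divide_distrib)
  qed
  have "(\<Sum>i\<in>B. (g i)\<^sup>2) \<le> (\<Sum>i\<in>B. (1 + w) * (v i)\<^sup>2 + (1 + 1 / w) * (w' i)\<^sup>2)"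
    using power2_sum_le[OF w] by (intro sum_mono) (simp add: gvw)
  also have "\<dots> = (1 + w) * (\<Sum>i\<in>B. (v i)\<^sup>2) + (\<Sum>i\<in>B. (1 + 1 / w) * (w' i)\<^sup>2)"
    by (simp add: sum.distrib sum_distrib_left)
  finally have "(\<Sum>i\<in>B. (g i)\<^sup>2) \<le> (1 + w) * (\<Sum>i\<in>B. (v i)\<^sup>2) + (1 + 1 / w) * (m * (m * K)\<^sup>2)"
    using Bw by linarith
  then have "(\<Sum>i\<in>B. (g i)\<^sup>2) / \<Lambda> \<le> ((1 + w) * (\<Sum>i\<in>B. (v i)\<^sup>2) + (1 + 1 / w) * (m * (m * K)\<^sup>2)) / \<Lambda>"
    using \<Lambda>_pos by (intro divide_right_mono) auto
  then show "Q \<le> (1 + w) * sum_sq_dev {2..r} (bt_outer K n r beta a) + (1 + 1 / w) * (m * (m * K)\<^sup>2) / \<Lambda>"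
    unfolding dev Q_def by (simp only: add_divide_distrib times_divide_eq_right)
  have "(v i)\<^sup>2 \<le> (1 + w) * (g i)\<^sup>2 + (1 + 1 / w) * (w' i)\<^sup>2" if "i \<in> B" for i
    using power2_sum_le[OF w, of "g i" "- w' i"] by (simp add: gvw[OF that])
  then have "(\<Sum>i\<in>B. (v i)\<^sup>2) \<le> (\<Sum>i\<in>B. (1 + w) * (g i)\<^sup>2 + (1 + 1 / w) * (w' i)\<^sup>2)"
    by (rule sum_mono)
  also have "\<dots> = (1 + w) * (\<Sum>i\<in>B. (g i)\<^sup>2) + (\<Sum>i\<in>B. (1 + 1 / w) * (w' i)\<^sup>2)"
    by (simp add: sum.distrib sum_distrib_left)
  finally have "(\<Sum>i\<in>B. (v i)\<^sup>2) \<le> (1 + w) * (\<Sum>i\<in>B. (g i)\<^sup>2) + (1 + 1 / w) * (m * (m * K)\<^sup>2)"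
    using Bw by linarith
  then have "(\<Sum>i\<in>B. (v i)\<^sup>2) / \<Lambda> \<le> ((1 + w) * (\<Sum>i\<in>B. (g i)\<^sup>2) + (1 + 1 / w) * (m * (m * K)\<^sup>2)) / \<Lambda>"
    using \<Lambda>_pos by (intro divide_right_mono) auto
  then show "sum_sq_dev {2..r} (bt_outer K n r beta a) \<le> (1 + w) * Q + (1 + 1 / w) * (m * (m * K)\<^sup>2) / \<Lambda>"
    unfolding dev Q_def by (simp only: add_divide_distrib times_divide_eq_right)
qed

text \<open>Both bounds are affine in the other quantity, the form required by
  \<open>weak_conv_pmf_sandwich\<close>; \<open>V\<close> is the inverse of the factor in
  \<open>bt_lrt_ge\<close>.\<close>

lemma bt_lrt_sandwich:
  assumes w: "w > 0" and Km: "2 * K * m \<le> \<Lambda>"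
  defines "\<rho> \<equiv> (1 + 1 / w) * (m * (m * K)\<^sup>2) / \<Lambda>"
    and "U \<equiv> exp (4 * \<tau>) / (1 - 4 * b * \<eta>)" and "V \<equiv> (1 + 4 * b * \<eta>) / (2 - exp \<tau> - K * m / \<Lambda>)"
  shows "bt_lrt K n r a \<le> U * (1 + w) * sum_sq_dev {2..r} (bt_outer K n r beta a) + U * \<rho>"
    and "sum_sq_dev {2..r} (bt_outer K n r beta a) \<le> V * (1 + w) * bt_lrt K n r a + \<rho>"
proof -
  have U: "U \<ge> 0" using small(5) by (simp add: U_def)
  have "bt_lrt K n r a \<le> U * Q" using bt_lrt_le by (simp add: U_def)
  also have "\<dots> \<le> U * ((1 + w) * sum_sq_dev {2..r} (bt_outer K n r beta a) + \<rho>)"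
    using Q_sum_sq_dev(1)[OF w] U unfolding \<rho>_def by (rule mult_left_mono)
  finally show "bt_lrt K n r a \<le> U * (1 + w) * sum_sq_dev {2..r} (bt_outer K n r beta a) + U * \<rho>"
    by (simp only: distrib_left[of U "_ * _"] mult.assoc)
  have "exp \<tau> \<le> 1 + 2 * \<tau>" using exp_bound_lemma[of \<tau>] small(1) \<tau>(1) by simp
  moreover have "K * m / \<Lambda> \<le> 1/2" using Km \<Lambda>_pos by (simp add: pos_divide_le_eq)
  ultimately have pos: "0 < 2 - exp \<tau> - K * m / \<Lambda>" using small by simp
  have pos2: "0 < 1 + 4 * b * \<eta>" using small b by (intro add_pos_nonneg) auto
  define p q where "p = 2 - exp \<tau> - K * m / \<Lambda>" and "q = 1 + 4 * b * \<eta>"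
  have pq: "p > 0" "q > 0" using pos pos2 by (simp_all add: p_def q_def)
  have "p / q * Q \<le> bt_lrt K n r a" using bt_lrt_ge[OF Km] by (simp add: p_def q_def)
  then have "p * Q \<le> q * bt_lrt K n r a" using pq by (simp add: pos_divide_le_eq mult.commute)
  then have "Q \<le> q / p * bt_lrt K n r a" using pq by (simp add: pos_le_divide_eq mult.commute)
  then have "Q \<le> V * bt_lrt K n r a" by (simp only: V_def p_def q_def)
  then have "(1 + w) * Q + \<rho> \<le> (1 + w) * (V * bt_lrt K n r a) + \<rho>"
    using w by (intro add_right_mono mult_left_mono) auto
  then show "sum_sq_dev {2..r} (bt_outer K n r beta a) \<le> V * (1 + w) * bt_lrt K n r a + \<rho>"
    using Q_sum_sq_dev(2)[OF w] unfolding \<rho>_def[symmetric] by (simp add: mult_ac)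
qed

end

text \<open>A Slutsky-type transfer. Working with the events \<open>T \<le> x\<close> and
  \<open>S \<le> x + \<delta>\<close> or \<open>S \<le> x - \<delta>\<close> turns the factors into
  small shifts at a fixed point, so no tightness argument is required.\<close>

lemma weak_conv_pmf_sandwich:
  fixes P :: "nat \<Rightarrow> 'a pmf" and S T :: "nat \<Rightarrow> 'a \<Rightarrow> real"
  assumes wc: "weak_conv_m (\<lambda>n. distr (measure_pmf (P n)) borel (S n)) \<nu>"
    and cont: "\<And>x. isCont (cdf \<nu>) x"
    and E: "(\<lambda>n. measure_pmf.prob (P n) (- E n)) \<longlonglongrightarrow> 0"
    and lim: "\<alpha> \<longlonglongrightarrow> 1" "\<alpha>' \<longlonglongrightarrow> 1" "\<omega> \<longlonglongrightarrow> 0" "\<omega>' \<longlonglongrightarrow> 0"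
    and sand: "eventually (\<lambda>n. 0 \<le> \<alpha> n \<and> 0 \<le> \<alpha>' n \<and> (\<forall>a\<in>E n. T n a \<le> \<alpha> n * S n a + \<omega> n \<and> S n a \<le> \<alpha>' n * T n a + \<omega>' n)) sequentially"
  shows "weak_conv_m (\<lambda>n. measure_pmf (map_pmf (T n) (P n))) \<nu>"
  unfolding weak_conv_m_def weak_conv_def
proof (intro allI impI)
  fix x :: real
  define F where "F n y = measure_pmf.prob (P n) {a. S n a \<le> y}" for n y
  define G where "G n = measure_pmf.prob (P n) {a. T n a \<le> x}" for n
  have cdfS: "cdf (distr (measure_pmf (P n)) borel (S n)) y = F n y" for n y
    by (simp add: cdf_def measure_distr F_def vimage_def)
  have F: "(\<lambda>n. F n y) \<longlonglongrightarrow> cdf \<nu> y" for y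
    using wc cont unfolding weak_conv_m_def weak_conv_def cdfS by blast
  have Gle: "eventually (\<lambda>n. G n \<le> F n (x + \<delta>) + measure_pmf.prob (P n) (- E n)) sequentially" if \<delta>: "\<delta> > 0" for \<delta>
  proof -
    have "(\<lambda>n. \<alpha>' n * x + \<omega>' n) \<longlonglongrightarrow> 1 * x + 0" by (intro tendsto_intros lim)
    then have "eventually (\<lambda>n. \<alpha>' n * x + \<omega>' n < x + \<delta>) sequentially" by (rule order_tendstoD) (use \<delta> in simp)
    with sand show ?thesis
    proof eventually_elim
      case (elim n)
      have "{a. T n a \<le> x} \<subseteq> {a. S n a \<le> x + \<delta>} \<union> (- E n)"
      proof safe
        fix a assume a: "T n a \<le> x" "a \<in> E n"
        then have "S n a \<le> \<alpha>' n * T n a + \<omega>' n" using elim by blast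
        also have "\<dots> \<le> \<alpha>' n * x + \<omega>' n" using a elim by (intro add_right_mono mult_left_mono) auto
        finally show "S n a \<le> x + \<delta>" using elim by simp
      qed
      then have "G n \<le> measure_pmf.prob (P n) ({a. S n a \<le> x + \<delta>} \<union> (- E n))"
        unfolding G_def by (intro measure_pmf.finite_measure_mono) auto
      also have "\<dots> \<le> F n (x + \<delta>) + measure_pmf.prob (P n) (- E n)"
        unfolding F_def by (intro measure_Un_le) auto
      finally show ?case .
    qed
  qed
  have Fle: "eventually (\<lambda>n. F n (x - \<delta>) - measure_pmf.prob (P n) (- E n) \<le> G n) sequentially" if \<delta>: "\<delta> > 0" for \<delta>
  proof -
    have "(\<lambda>n. \<alpha> n * (x - \<delta>) + \<omega> n) \<longlonglongrightarrow> 1 * (x - \<delta>) + 0" by (intro tendsto_intros lim)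
    then have "eventually (\<lambda>n. \<alpha> n * (x - \<delta>) + \<omega> n < x) sequentially" by (rule order_tendstoD) (use \<delta> in simp)
    with sand show ?thesis
    proof eventually_elim
      case (elim n)
      have "{a. S n a \<le> x - \<delta>} \<subseteq> {a. T n a \<le> x} \<union> (- E n)"
      proof safe
        fix a assume a: "S n a \<le> x - \<delta>" "a \<in> E n"
        then have "T n a \<le> \<alpha> n * S n a + \<omega> n" using elim by blast
        also have "\<dots> \<le> \<alpha> n * (x - \<delta>) + \<omega> n" using a elim by (intro add_right_mono mult_left_mono) auto
        finally show "T n a \<le> x" using elim by simp
      qed
      then have "F n (x - \<delta>) \<le> measure_pmf.prob (P n) ({a. T n a \<le> x} \<union> (- E n))"
        unfolding F_def by (intro measure_pmf.finite_measure_mono) auto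
      also have "\<dots> \<le> G n + measure_pmf.prob (P n) (- E n)"
        unfolding G_def by (intro measure_Un_le) auto
      finally show ?case by simp
    qed
  qed
  have "G \<longlonglongrightarrow> cdf \<nu> x"
  \<comment> \<open>Continuity of the limit distribution function supplies a \<open>d\<close> for
    which the shift by \<open>d / 2\<close> is harmless.\<close>
  proof (rule order_tendstoI)
    fix u assume "u < cdf \<nu> x"
    then have "eventually (\<lambda>y. u < cdf \<nu> y) (at x)" using cont[of x] by (auto simp: isCont_def intro: order_tendstoD)
    then obtain d where d: "d > 0" "\<And>y. y \<noteq> x \<Longrightarrow> dist y x < d \<Longrightarrow> u < cdf \<nu> y" by (auto simp: eventually_at)
    have "u < cdf \<nu> (x - d / 2) - 0" using d(2)[of "x - d / 2"] d(1) by (simp add: dist_real_def)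
    moreover have "(\<lambda>n. F n (x - d / 2) - measure_pmf.prob (P n) (- E n)) \<longlonglongrightarrow> cdf \<nu> (x - d / 2) - 0"
      by (intro tendsto_diff F E)
    ultimately have "eventually (\<lambda>n. u < F n (x - d / 2) - measure_pmf.prob (P n) (- E n)) sequentially" by (rule order_tendstoD(1)[rotated])
    with Fle[of "d / 2"] d(1) show "eventually (\<lambda>n. u < G n) sequentially" by (auto elim: eventually_elim2)
  next
    fix u assume "cdf \<nu> x < u"
    then have "eventually (\<lambda>y. cdf \<nu> y < u) (at x)" using cont[of x] by (auto simp: isCont_def intro: order_tendstoD)
    then obtain d where d: "d > 0" "\<And>y. y \<noteq> x \<Longrightarrow> dist y x < d \<Longrightarrow> cdf \<nu> y < u" by (auto simp: eventually_at)
    have "cdf \<nu> (x + d / 2) + 0 < u" using d(2)[of "x + d / 2"] d(1) by (simp add: dist_real_def)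
    moreover have "(\<lambda>n. F n (x + d / 2) + measure_pmf.prob (P n) (- E n)) \<longlonglongrightarrow> cdf \<nu> (x + d / 2) + 0"
      by (intro tendsto_add F E)
    ultimately have "eventually (\<lambda>n. F n (x + d / 2) + measure_pmf.prob (P n) (- E n) < u) sequentially" by (rule order_tendstoD(2)[rotated])
    with Gle[of "d / 2"] d(1) show "eventually (\<lambda>n. G n < u) sequentially" by (auto elim: eventually_elim2)
  qed
  moreover have "cdf (measure_pmf (map_pmf (T n) (P n))) x = G n" for n
    by (simp add: cdf_def G_def vimage_def)
  ultimately show "(\<lambda>n. cdf (measure_pmf (map_pmf (T n) (P n))) x) \<longlonglongrightarrow> cdf \<nu> x" by simp
qed

lemma isCont_cdf_chi_square:
  assumes "k > 0"
  shows "isCont (cdf (chi_square k)) x"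
proof -
  interpret real_distribution "chi_square k" by (rule real_distribution_chi_square[OF assms])
  have "emeasure (chi_square k) {x} = 0"
    unfolding chi_square_def by (subst emeasure_density) (auto simp: nn_integral_0_iff_AE intro!: eventually_mono[OF AE_lborel_singleton[of x]])
  then show ?thesis by (simp add: isCont_cdf measure_def)
qed

text \<open>A central limit theorem for each block member, joined by independence and passed through
  \<open>sum_sq_dev\<close>. The sizes \<open>N k\<close> keep the block inside the set of subjects
  for every index.\<close>

lemma sum_sq_dev_bt_outer_weak_conv:
  fixes N :: "nat \<Rightarrow> nat" and beta :: "nat \<Rightarrow> nat \<Rightarrow> real"
  assumes r: "r > 2" and N: "\<And>k. N k \<ge> r" and null: "\<And>k i. i \<in> {2..r} \<Longrightarrow> beta k i = beta k 2"
    and info: "filterlim (\<lambda>k. bt_info K (N k) r (beta k)) at_top sequentially"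
  shows "weak_conv_m (\<lambda>k. distr (measure_pmf (bt_data K (N k) (beta k))) borel
      (\<lambda>a. sum_sq_dev {2..r} (bt_outer K (N k) r (beta k) a))) (chi_square (r - 2))"
proof -
  let ?B = "{2..r}" and ?P = "\<lambda>k. measure_pmf (bt_data K (N k) (beta k))"
  let ?X = "\<lambda>k i a. bt_outer K (N k) r (beta k) a i"
  define J where "J k = {1..N k} - ?B" for k
  have sub: "?B \<subseteq> {1..N k}" for k using N[of k] by auto
  have clt: "weak_conv_m (\<lambda>k. distr (?P k) borel (?X k i)) std_normal_distribution" if i: "i \<in> ?B" for i
  proof -
    \<comment> \<open>Under the null hypothesis all block members have the same variance, so one
      normalization serves the whole block.\<close>
    have v: "(\<Sum>j\<in>J k. K * logistic' (beta k i - beta k j)) = bt_info K (N k) r (beta k)" for k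
      using null[OF i, of k] by (simp add: bt_info_def J_def sum_distrib_left)
    have mem: "i \<in> {1..N k}" "j \<in> {1..N k}" "i \<noteq> j" if "j \<in> J k" for k j
      using i sub[of k] that by (auto simp: J_def)
    have "weak_conv_m (\<lambda>k. distr (?P k) borel (\<lambda>a. (\<Sum>j\<in>J k. bt_count K a i j - K * logistic (beta k i - beta k j))
       / sqrt (\<Sum>j\<in>J k. K * logistic' (beta k i - beta k j)))) std_normal_distribution"
    proof (rule central_limit_theorem_bounded_array[where C = K])
      fix k
      show "prob_space (?P k)" by (rule measure_pmf.prob_space_axioms)
      show "finite (J k)" by (simp add: J_def)
      have "prob_space.indep_vars (?P k) (\<lambda>_. borel) (\<lambda>j a. bt_count K a i j) (J k)"
        by (rule indep_vars_bt_count) (use i sub[of k] in \<open>auto simp: J_def\<close>)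
      then show "prob_space.indep_vars (?P k) (\<lambda>_. borel) (\<lambda>j a. bt_count K a i j - K * logistic (beta k i - beta k j)) (J k)"
        by (rule prob_space.indep_vars_compose2[OF measure_pmf.prob_space_axioms]) simp
      fix j assume j: "j \<in> J k"
      show "AE a in ?P k. \<bar>bt_count K a i j - K * logistic (beta k i - beta k j)\<bar> \<le> K"
        using AE_bt_count[OF mem[OF j]]
      proof eventually_elim
        case (elim a)
        have "0 \<le> K * logistic (beta k i - beta k j)" "K * logistic (beta k i - beta k j) \<le> K * 1"
          using logistic_bounds[of "beta k i - beta k j"] by (auto intro!: mult_nonneg_nonneg mult_left_le)
        then show ?case using elim by (simp add: abs_le_iff)
      qed
      show "(\<integral>a. bt_count K a i j - K * logistic (beta k i - beta k j) \<partial>?P k) = 0"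
        using integrable_bt_count[OF mem[OF j]] expectation_bt_count[OF mem[OF j]]
        by (subst Bochner_Integration.integral_diff) auto
      show "(\<integral>a. (bt_count K a i j - K * logistic (beta k i - beta k j))\<^sup>2 \<partial>?P k) = K * logistic' (beta k i - beta k j)"
        by (rule variance_bt_count[OF mem[OF j]])
    next
      show "filterlim (\<lambda>k. \<Sum>j\<in>J k. K * logistic' (beta k i - beta k j)) at_top sequentially"
        unfolding v by (rule info)
    qed
    then show ?thesis unfolding v by (simp add: bt_outer_def J_def)
  qed
  have rv: "?X k i \<in> borel_measurable (?P k)" for k i by simp
  have dist: "distr (PiM ?B (\<lambda>i. distr (?P k) borel (?X k i))) borel (sum_sq_dev ?B)
    = distr (?P k) borel (\<lambda>a. sum_sq_dev ?B (bt_outer K (N k) r (beta k) a))" for k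
  proof -
    have ind: "prob_space.indep_vars (?P k) (\<lambda>_. borel) (?X k) ?B"
      unfolding bt_outer_def by (rule indep_vars_bt_block) (use sub in auto)
    have "distr (?P k) (\<Pi>\<^sub>M i\<in>?B. borel) (\<lambda>a. \<lambda>i\<in>?B. ?X k i a) = PiM ?B (\<lambda>i. distr (?P k) borel (?X k i))"
      by (rule prob_space.indep_vars_iff_distr_eq_PiM'[OF measure_pmf.prob_space_axioms, THEN iffD1, OF _ _ ind]) (use r in auto)
    then have "distr (PiM ?B (\<lambda>i. distr (?P k) borel (?X k i))) borel (sum_sq_dev ?B)
      = distr (distr (?P k) (\<Pi>\<^sub>M i\<in>?B. borel) (\<lambda>a. \<lambda>i\<in>?B. ?X k i a)) borel (sum_sq_dev ?B)" by simp
    also have "\<dots> = distr (?P k) borel (\<lambda>a. sum_sq_dev ?B (\<lambda>i\<in>?B. ?X k i a))"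
      by (subst distr_distr) (auto simp: comp_def sum_sq_dev_def[abs_def] space_PiM intro!: measurable_restrict)
    finally show ?thesis by (simp add: sum_sq_dev_def)
  qed
  have "weak_conv_m (\<lambda>k. distr (PiM ?B (\<lambda>i. distr (?P k) borel (?X k i))) borel (sum_sq_dev ?B))
     (distr (\<Pi>\<^sub>M i\<in>?B. std_normal_distribution) borel (sum_sq_dev ?B))"
  proof (rule weak_conv_PiM_continuous_map)
    show "real_distribution (distr (?P k) borel (?X k i))" for k i
      by (rule prob_space.real_distribution_distr[OF measure_pmf.prob_space_axioms rv])
    show "sum_sq_dev ?B \<in> borel_measurable (\<Pi>\<^sub>M i\<in>?B. borel)"
      unfolding sum_sq_dev_def[abs_def] by measurable
    show "(\<lambda>n. sum_sq_dev ?B (zs n)) \<longlonglongrightarrow> sum_sq_dev ?B z" if "\<And>i. i \<in> ?B \<Longrightarrow> (\<lambda>n. zs n i) \<longlonglongrightarrow> z i" for z zs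
      unfolding sum_sq_dev_def using that by (intro tendsto_intros) (use r in auto)
  qed (auto intro: clt real_dist_normal_dist)
  also have "distr (\<Pi>\<^sub>M i\<in>?B. std_normal_distribution) borel (sum_sq_dev ?B) = chi_square (r - 2)"
    using distr_std_normal_sum_sq_dev[of ?B] r unfolding sum_sq_dev_def[abs_def] by (simp add: eval_nat_numeral)
  finally show ?thesis unfolding dist .
qed

section \<open>Bounds on the ratio constants and on the probability of large scores\<close>

lemma bt_ratio_eq: "bt_ratio beta i j = 1 / logistic' (beta i - beta j)"
  by (simp add: bt_ratio_def logistic'_def)

lemma bt_ratio_ge: "4 \<le> bt_ratio beta i j"
  using logistic'_le[of "beta i - beta j"] logistic'_pos[of "beta i - beta j"]
  by (simp add: bt_ratio_eq pos_le_divide_eq)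

lemma finite_bt_ratios: "finite {bt_ratio beta i j | i j. i \<in> {1..n} \<and> j \<in> {1..n} \<and> i \<noteq> j}"
proof (rule finite_subset)
  show "{bt_ratio beta i j | i j. i \<in> {1..n} \<and> j \<in> {1..n} \<and> i \<noteq> j} \<subseteq> (\<lambda>(i, j). bt_ratio beta i j) ` ({1..n} \<times> {1..n})"
    by auto
qed simp

lemma bt_ratio_le_bt_b:
  assumes "i \<in> {1..n}" "j \<in> {1..n}" "i \<noteq> j"
  shows "bt_ratio beta i j \<le> bt_b n beta"
  unfolding bt_b_def by (rule Max_ge[OF finite_bt_ratios]) (use assms in blast)

text \<open>Two subjects of equal strength have ratio \<open>(1 + 1)^2 = 4\<close>.\<close>

lemma bt_c_bounds:
  assumes "n \<ge> 3" "beta 3 = beta 2"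
  shows "0 < bt_c n beta" "bt_c n beta \<le> 4"
proof -
  let ?R = "{bt_ratio beta i j | i j. i \<in> {1..n} \<and> j \<in> {1..n} \<and> i \<noteq> j}"
  have mem: "bt_ratio beta 3 2 \<in> ?R"
    by (rule CollectI, intro exI[of _ 3] exI[of _ 2]) (use assms(1) in simp)
  have "bt_c n beta \<in> ?R" unfolding bt_c_def by (rule Min_in[OF finite_bt_ratios]) (use mem in blast)
  then obtain i j where "bt_c n beta = bt_ratio beta i j" by blast
  then show "0 < bt_c n beta" using bt_ratio_ge[of beta i j] by simp
  have "bt_c n beta \<le> bt_ratio beta 3 2" unfolding bt_c_def by (rule Min_le[OF finite_bt_ratios mem])
  then show "bt_c n beta \<le> 4" by (simp add: bt_ratio_def assms(2) power2_eq_square)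
qed

text \<open>The threshold makes the Hoeffding exponent \<open>- 2 * ln n\<close>, so each subject
  fails with probability at most \<open>2 / n^2\<close>, and the union bound gives
  \<open>2 / n\<close>. Membership in the support provides the count bounds of
  \<open>bt_good_data\<close>.\<close>

lemma prob_bt_score_all:
  assumes n: "n > 1" and K: "K \<ge> 1"
  shows "measure_pmf.prob (bt_data K n beta) (- {a. a \<in> set_pmf (bt_data K n beta) \<and> (\<forall>i\<in>{1..n}. \<bar>bt_score K n a beta i\<bar> \<le> K * (n * sqrt (ln n / n)))}) \<le> 2 / n"
proof -
  let ?\<epsilon> = "K * (n * sqrt (ln n / n))" and ?P = "bt_data K n beta"
  have ln: "0 \<le> ln (real n)" using n by simp
  have "measure_pmf.prob ?P (- {a. a \<in> set_pmf ?P \<and> (\<forall>i\<in>{1..n}. \<bar>bt_score K n a beta i\<bar> \<le> ?\<epsilon>)})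
    = measure_pmf.prob ?P (- {a. a \<in> set_pmf ?P \<and> (\<forall>i\<in>{1..n}. \<bar>bt_score K n a beta i\<bar> \<le> ?\<epsilon>)} \<inter> set_pmf ?P)"
    by (rule measure_Int_set_pmf[symmetric])
  also have "\<dots> \<le> measure_pmf.prob ?P (\<Union>i\<in>{1..n}. {a. ?\<epsilon> \<le> \<bar>bt_score K n a beta i\<bar>})"
    by (intro measure_pmf.finite_measure_mono) (auto simp: not_le less_imp_le)
  also have "\<dots> \<le> (\<Sum>i\<in>{1..n}. measure_pmf.prob ?P {a. ?\<epsilon> \<le> \<bar>bt_score K n a beta i\<bar>})"
    by (rule measure_pmf.finite_measure_subadditive_finite) auto
  also have "\<dots> \<le> (\<Sum>i\<in>{1..n}. 2 / (real n)\<^sup>2)"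
  proof (rule sum_mono)
    fix i assume i: "i \<in> {1..n}"
    have s: "(sqrt (ln n / n))\<^sup>2 = ln n / n" using ln by simp
    have "?\<epsilon>\<^sup>2 = (real K)\<^sup>2 * n * ln n" using n unfolding power_mult_distrib s by (simp add: power2_eq_square)
    then have "- 2 * ?\<epsilon>\<^sup>2 / (n * (real K)\<^sup>2) = - (2 * ln n)" using n K by (simp add: field_simps)
    also have "\<dots> = - ln ((real n)\<^sup>2)" using n by (simp add: ln_realpow)
    finally have "exp (- 2 * ?\<epsilon>\<^sup>2 / (n * (real K)\<^sup>2)) = 1 / (real n)\<^sup>2" using n by (simp add: exp_minus divide_inverse)
    moreover have "measure_pmf.prob ?P {a. ?\<epsilon> \<le> \<bar>bt_score K n a beta i\<bar>} \<le> 2 * exp (- 2 * ?\<epsilon>\<^sup>2 / (n * (real K)\<^sup>2))"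
      by (rule prob_bt_score_ge[OF i n K]) (use ln in simp)
    ultimately show "measure_pmf.prob ?P {a. ?\<epsilon> \<le> \<bar>bt_score K n a beta i\<bar>} \<le> 2 / (real n)\<^sup>2" by simp
  qed
  also have "\<dots> = 2 / n" using n by (simp add: power2_eq_square)
  finally show ?thesis .
qed

theorem theorem4:
  fixes K r :: nat and beta :: "nat \<Rightarrow> nat \<Rightarrow> real"
  assumes K: "K \<ge> 1"
    and r: "r > 2"
    and beta1: "\<And>n. beta n 1 = 0"
    and null: "\<And>n i. i \<in> {2..r} \<Longrightarrow> beta n i = beta n 2"
    and rate: "(\<lambda>n. bt_b n (beta n) ^ 11 / bt_c n (beta n) ^ 6)
                 \<in> o(\<lambda>n. sqrt (real n) / ln (real n) powr (5/2))"
  shows "weak_conv_m (\<lambda>n. measure_pmf (map_pmf (bt_lrt K n r) (bt_data K n (beta n))))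
           (chi_square (r - 2))"
proof -
  define b where "b n = bt_b n (beta n)" for n
  \<comment> \<open>The parameter conditions and the relative information error are constant
    multiples of \<open>\<gamma>\<close>, as recorded in \<open>\<tau>\<gamma>\<close>
    below.\<close>
  define \<gamma> where "\<gamma> n = b n ^ 3 * sqrt (ln (real n) / n)" for n
  \<comment> \<open>Solves
    \<open>K * n * \<tau> / (8 * exp 1 * b) = K * n * sqrt (ln n / n)\<close>: the score bound of
    \<open>bt_good_data\<close> becomes the threshold of \<open>prob_bt_score_all\<close>.\<close>
  define \<tau> where "\<tau> n = 8 * exp 1 * b n * sqrt (ln (real n) / n)" for n
  have b4: "4 \<le> b n" if "n \<ge> 3" for n
    using order_trans[OF bt_ratio_ge bt_ratio_le_bt_b[of 1 n 2]] that by (simp add: b_def)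
  have info: "1 / b n \<le> logistic' (beta n i - beta n j)"
    if "i \<in> {1..n}" "j \<in> {1..n}" "i \<noteq> j" "n \<ge> 3" for n i j
  proof -
    have "1 / logistic' (beta n i - beta n j) \<le> b n"
      using bt_ratio_le_bt_b[OF that(1-3)] by (simp add: b_def bt_ratio_eq)
    then show ?thesis using b4[OF that(4)] logistic'_pos[of "beta n i - beta n j"] by (simp add: field_simps)
  qed
  have L1: "1 \<le> ln (real n)" if "n \<ge> 3" for n
  proof -
    have "exp 1 \<le> real n" using exp_le that by linarith
    then show ?thesis using that by (simp add: ln_ge_iff)
  qed
  have sq: "0 < sqrt (ln (real n) / n)" "1 / sqrt n \<le> sqrt (ln (real n) / n)" if "n \<ge> 3" for n
    using L1[OF that] that by (simp_all add: real_sqrt_divide divide_right_mono)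
  have b3: "b n \<le> b n ^ 3" if "n \<ge> 3" for n
    using power_increasing[of 1 3 "b n"] b4[OF that] by simp

  let ?f = "\<lambda>n. (bt_b n (beta n) ^ 11 / bt_c n (beta n) ^ 6) / (sqrt (real n) / ln (real n) powr (5/2))"
  have \<gamma>: "\<gamma> \<longlonglongrightarrow> 0"
  proof (rule tendsto_sandwich[where f = "\<lambda>_. 0" and h = "\<lambda>n. 4096 * ?f n"])
    have "?f \<longlonglongrightarrow> 0" using smalloD_tendsto[OF rate] .
    then show "(\<lambda>n. 4096 * ?f n) \<longlonglongrightarrow> 0" by (rule tendsto_mult_right_zero)
    show "(\<lambda>_. 0) \<longlonglongrightarrow> 0" by simp
    show "eventually (\<lambda>n. 0 \<le> \<gamma> n) sequentially"
      using eventually_ge_at_top[of 3]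
    proof eventually_elim
      case (elim n)
      then show ?case using b4[OF elim] sq(1)[OF elim] by (simp add: \<gamma>_def)
    qed
    show "eventually (\<lambda>n. \<gamma> n \<le> 4096 * ?f n) sequentially"
      using eventually_ge_at_top[of 3]
    proof eventually_elim
      case (elim n)
      let ?L = "ln (real n)"
      have c: "0 < bt_c n (beta n)" "bt_c n (beta n) \<le> 4"
        using bt_c_bounds[OF elim, of "beta n"] null[of 3 n] r by auto
      then have "bt_c n (beta n) ^ 6 \<le> 4 ^ 6" by (intro power_mono) auto
      \<comment> \<open>\<open>4096 = 4 ^ 6\<close>: replacing \<open>bt_c\<close> by its bound 4
        costs a fixed factor.\<close>
      then have c6: "1 \<le> 4096 / bt_c n (beta n) ^ 6" using c by (simp add: pos_le_divide_eq)
      have bb: "b n ^ 3 \<le> b n ^ 11" using b4[OF elim] by (intro power_increasing) auto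
      have "sqrt ?L \<le> ?L powr (5/2)"
        using L1[OF elim] powr_mono[of "1/2" "5/2" ?L] by (simp add: powr_half_sqrt)
      then have "b n ^ 3 * sqrt ?L \<le> b n ^ 11 * ?L powr (5/2)"
        using bb b4[OF elim] L1[OF elim] by (intro mult_mono) auto
      then have "\<gamma> n \<le> b n ^ 11 * ?L powr (5/2) / sqrt n"
        unfolding \<gamma>_def by (simp add: real_sqrt_divide divide_right_mono)
      also have "\<dots> \<le> b n ^ 11 * ?L powr (5/2) / sqrt n * (4096 / bt_c n (beta n) ^ 6)"
        using c6 b4[OF elim] mult_left_mono[OF c6, of "b n ^ 11 * ?L powr (5/2) / sqrt n"] by simp
      also have "\<dots> = 4096 * ?f n" by (simp add: b_def mult_ac)
      finally show ?case .
    qed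
  qed

  \<comment> \<open>The shift makes the size conditions hold for every index;
    \<open>LIMSEQ_offset\<close> removes it at the end.\<close>
  define N where "N k = k + 2 * r" for k
  have N: "N k \<ge> 3" "N k \<ge> 2 * r" "N k \<ge> r" "N k > 1" "k \<le> N k" for k using r by (simp_all add: N_def)
  have \<gamma>N: "(\<lambda>k. \<gamma> (N k)) \<longlonglongrightarrow> 0" unfolding N_def by (rule LIMSEQ_ignore_initial_segment[OF \<gamma>])
  have \<tau>pos: "0 < \<tau> (N k)" for k
    using b4[OF N(1), of k] sq(1)[OF N(1), of k] by (simp add: \<tau>_def)
  have \<tau>N: "(\<lambda>k. \<tau> (N k)) \<longlonglongrightarrow> 0"
  proof (rule tendsto_sandwich[where f = "\<lambda>_. 0" and h = "\<lambda>k. 8 * exp 1 * \<gamma> (N k)"])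
    show "(\<lambda>k. 8 * exp 1 * \<gamma> (N k)) \<longlonglongrightarrow> 0" by (rule tendsto_mult_right_zero[OF \<gamma>N])
    show "eventually (\<lambda>k. \<tau> (N k) \<le> 8 * exp 1 * \<gamma> (N k)) sequentially"
      unfolding \<tau>_def \<gamma>_def mult.assoc using b3[OF N(1)] sq(1)[OF N(1)]
      by (intro always_eventually allI mult_left_mono mult_right_mono) (auto intro: less_imp_le)
  qed (use \<tau>pos in \<open>auto intro!: always_eventually less_imp_le\<close>)
  have \<tau>\<gamma>: "48 * exp 1 * (b n)\<^sup>2 * \<tau> n = 384 * (exp 1)\<^sup>2 * \<gamma> n" "4 * b n * (6 * exp 1 * b n * \<tau> n) = 192 * (exp 1)\<^sup>2 * \<gamma> n" for n
    by (simp_all add: \<tau>_def \<gamma>_def power2_eq_square power3_eq_cube)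
  have "(\<lambda>k. 384 * (exp 1)\<^sup>2 * \<gamma> (N k)) \<longlonglongrightarrow> 0" by (rule tendsto_mult_right_zero[OF \<gamma>N])
  then have "eventually (\<lambda>k. 384 * (exp 1)\<^sup>2 * \<gamma> (N k) < 1) sequentially" by (rule order_tendstoD) simp
  moreover have "eventually (\<lambda>k. \<gamma> (N k) < 1) sequentially" using \<gamma>N by (rule order_tendstoD) simp
  ultimately have par: "eventually (\<lambda>k. bt_params K (N k) r (beta (N k)) (b (N k)) (\<tau> (N k)) \<and> \<gamma> (N k) < 1) sequentially"
  proof eventually_elim
    case (elim k)
    have "bt_params K (N k) r (beta (N k)) (b (N k)) (\<tau> (N k))"
    proof
      show "beta (N k) i = beta (N k) 2" if "i \<in> {2..r}" for i using null[OF that] .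
      show "1 \<le> b (N k)" using b4[OF N(1), of k] by simp
      show "48 * exp 1 * (b (N k))\<^sup>2 * \<tau> (N k) \<le> 1" using elim unfolding \<tau>\<gamma> by simp
    qed (use K r N beta1 info \<tau>pos in auto)
    then show ?case using elim by simp
  qed
  define \<Lambda> where "\<Lambda> k = bt_info K (N k) r (beta (N k))" for k
  have \<Lambda>: "filterlim \<Lambda> at_top sequentially"
  proof (rule filterlim_at_top_mono)
    have "filterlim (\<lambda>k. sqrt (real k)) at_top sequentially"
      by (rule filterlim_compose[OF sqrt_at_top filterlim_real_sequentially])
    then show "filterlim (\<lambda>k. 1/2 * sqrt (real k)) at_top sequentially"
      by (rule filterlim_tendsto_pos_mult_at_top[OF tendsto_const, rotated]) simp
    show "eventually (\<lambda>k. 1/2 * sqrt (real k) \<le> \<Lambda> k) sequentially"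
      using par
    proof eventually_elim
      case (elim k)
      then interpret P: bt_params K "N k" r "beta (N k)" "b (N k)" "\<tau> (N k)" by simp
      let ?n = "real (N k)" and ?b = "b (N k)"
      have n0: "?n > 0" using N(4)[of k] by simp
      \<comment> \<open>\<open>\<gamma> < 1\<close> forces \<open>b \<le> sqrt n\<close>, and then
        \<open>\<Lambda> \<ge> K * n / (2 * b)\<close> is at least
        \<open>sqrt n / 2\<close>.\<close>
      have "?b / sqrt ?n \<le> ?b ^ 3 * sqrt (ln ?n / ?n)"
        using mult_mono[OF b3[OF N(1)] sq(2)[OF N(1)], of k k] b4[OF N(1), of k] by simp
      also have "\<dots> \<le> 1" using elim by (simp add: \<gamma>_def)
      finally have "?b \<le> sqrt ?n" using n0 by (simp add: pos_divide_le_eq)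
      then have "?n / (2 * sqrt ?n) \<le> ?n / (2 * ?b)"
        using n0 b4[OF N(1), of k] by (intro divide_left_mono) auto
      moreover have "?n / (2 * sqrt ?n) = 1/2 * sqrt ?n" using n0 by (simp add: real_div_sqrt)
      moreover have "?n / (2 * ?b) \<le> K * ?n / (2 * ?b)"
        using K n0 b4[OF N(1), of k] mult_right_mono[of 1 "real K" ?n] by (intro divide_right_mono) auto
      moreover have "sqrt (real k) \<le> sqrt ?n" using N(5)[of k] by simp
      ultimately have "1/2 * sqrt (real k) \<le> P.\<Lambda>" using P.\<Lambda>_ge unfolding of_nat_mult by linarith
      then show ?case by (simp add: \<Lambda>_def P.bt_info_eq)
    qed
  qed
  define m where "m = real r - 1"
  \<comment> \<open>Balances Young's inequality: \<open>w\<close> tends to 0, and so does the error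
    factor \<open>(1 + 1 / w) / \<Lambda> = (1 + sqrt \<Lambda>) / \<Lambda>\<close>.\<close>
  define w where "w k = 1 / sqrt (\<Lambda> k)" for k
  define \<rho> where "\<rho> k = (1 + 1 / w k) * (m * (m * K)\<^sup>2) / \<Lambda> k" for k
  define U where "U k = exp (4 * \<tau> (N k)) / (1 - 192 * (exp 1)\<^sup>2 * \<gamma> (N k))" for k
  define V where "V k = (1 + 192 * (exp 1)\<^sup>2 * \<gamma> (N k)) / (2 - exp (\<tau> (N k)) - K * m / \<Lambda> k)" for k
  have sqrt\<Lambda>: "filterlim (\<lambda>k. sqrt (\<Lambda> k)) at_top sequentially"
    by (rule filterlim_compose[OF sqrt_at_top \<Lambda>])
  have w0: "w \<longlonglongrightarrow> 0" unfolding w_def by (rule real_tendsto_divide_at_top[OF tendsto_const sqrt\<Lambda>])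
  have \<rho>0: "\<rho> \<longlonglongrightarrow> 0"
  proof -
    have "(\<lambda>k. m * (m * K)\<^sup>2 / \<Lambda> k + m * (m * K)\<^sup>2 / sqrt (\<Lambda> k)) \<longlonglongrightarrow> 0 + 0"
      by (intro tendsto_add real_tendsto_divide_at_top[OF tendsto_const] \<Lambda> sqrt\<Lambda>)
    moreover have "eventually (\<lambda>k. m * (m * K)\<^sup>2 / \<Lambda> k + m * (m * K)\<^sup>2 / sqrt (\<Lambda> k) = \<rho> k) sequentially"
      using filterlim_at_top_dense[THEN iffD1, OF \<Lambda>, rule_format, of 0]
    proof eventually_elim
      case (elim k)
      have e: "sqrt (\<Lambda> k) / \<Lambda> k = 1 / sqrt (\<Lambda> k)" using elim by (simp add: divide_eq_eq real_div_sqrt)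
      have "sqrt (\<Lambda> k) * C / \<Lambda> k = C * (sqrt (\<Lambda> k) / \<Lambda> k)" for C by simp
      then have "C / \<Lambda> k + C / sqrt (\<Lambda> k) = (1 + sqrt (\<Lambda> k)) * C / \<Lambda> k" for C
        unfolding e by (simp add: distrib_right add_divide_distrib)
      then show ?case by (simp add: \<rho>_def w_def)
    qed
    ultimately show ?thesis using Lim_transform_eventually by fastforce
  qed
  have U1: "U \<longlonglongrightarrow> 1"
  proof -
    have "U \<longlonglongrightarrow> exp (4 * 0) / (1 - 192 * (exp 1)\<^sup>2 * 0)"
      unfolding U_def by (intro tendsto_intros \<tau>N \<gamma>N) simp
    then show ?thesis by simp
  qed
  have V1: "V \<longlonglongrightarrow> 1"
  proof -
    have "V \<longlonglongrightarrow> (1 + 192 * (exp 1)\<^sup>2 * 0) / (2 - exp 0 - 0)"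
      unfolding V_def by (intro tendsto_intros \<tau>N \<gamma>N real_tendsto_divide_at_top[OF tendsto_const \<Lambda>]) simp
    then show ?thesis by simp
  qed
  have lims: "(\<lambda>k. U k * (1 + w k)) \<longlonglongrightarrow> 1" "(\<lambda>k. V k * (1 + w k)) \<longlonglongrightarrow> 1" "(\<lambda>k. U k * \<rho> k) \<longlonglongrightarrow> 0"
    using tendsto_mult[OF U1 tendsto_add[OF tendsto_const[of 1] w0]]
      tendsto_mult[OF V1 tendsto_add[OF tendsto_const[of 1] w0]] tendsto_mult[OF U1 \<rho>0] by simp_all
  define E where "E k = {a. a \<in> set_pmf (bt_data K (N k) (beta (N k))) \<and>
      (\<forall>i\<in>{1..N k}. \<bar>bt_score K (N k) a (beta (N k)) i\<bar> \<le> K * (N k * sqrt (ln (N k) / N k)))}" for k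
  have E0: "(\<lambda>k. measure_pmf.prob (bt_data K (N k) (beta (N k))) (- E k)) \<longlonglongrightarrow> 0"
  proof (rule tendsto_sandwich[where f = "\<lambda>_. 0" and h = "\<lambda>k. 2 / real (N k)"])
    have "filterlim (\<lambda>k. real (N k)) at_top sequentially"
      using N(5) by (intro filterlim_at_top_mono[OF filterlim_real_sequentially] always_eventually) auto
    then show "(\<lambda>k. 2 / real (N k)) \<longlonglongrightarrow> 0" by (rule real_tendsto_divide_at_top[OF tendsto_const])
    show "eventually (\<lambda>k. measure_pmf.prob (bt_data K (N k) (beta (N k))) (- E k) \<le> 2 / real (N k)) sequentially"
      unfolding E_def by (intro always_eventually allI prob_bt_score_all N K)
  qed auto
  have "weak_conv_m (\<lambda>k. measure_pmf (map_pmf (bt_lrt K (N k) r) (bt_data K (N k) (beta (N k))))) (chi_square (r - 2))"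
  proof (rule weak_conv_pmf_sandwich[OF _ _ E0 lims(1,2,3) \<rho>0])
    show "weak_conv_m (\<lambda>k. distr (measure_pmf (bt_data K (N k) (beta (N k)))) borel
        (\<lambda>a. sum_sq_dev {2..r} (bt_outer K (N k) r (beta (N k)) a))) (chi_square (r - 2))"
    proof (rule sum_sq_dev_bt_outer_weak_conv[OF r N(3)])
      show "beta (N k) i = beta (N k) 2" if "i \<in> {2..r}" for k i using null[OF that] .
      show "filterlim (\<lambda>k. bt_info K (N k) r (beta (N k))) at_top sequentially"
        using \<Lambda> unfolding \<Lambda>_def .
    qed
    show "isCont (cdf (chi_square (r - 2))) x" for x using r by (intro isCont_cdf_chi_square) simp
    have "eventually (\<lambda>k. 2 * K * m < \<Lambda> k \<and> 0 < \<Lambda> k) sequentially"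
      using \<Lambda> by (auto simp: filterlim_at_top_dense intro: eventually_conj)
    with par show "eventually (\<lambda>k. 0 \<le> U k * (1 + w k) \<and> 0 \<le> V k * (1 + w k) \<and>
      (\<forall>a\<in>E k. bt_lrt K (N k) r a \<le> U k * (1 + w k) * sum_sq_dev {2..r} (bt_outer K (N k) r (beta (N k)) a) + U k * \<rho> k \<and>
        sum_sq_dev {2..r} (bt_outer K (N k) r (beta (N k)) a) \<le> V k * (1 + w k) * bt_lrt K (N k) r a + \<rho> k)) sequentially"
    proof eventually_elim
      case (elim k)
      have wp: "w k > 0" using elim by (simp add: w_def)
      interpret P: bt_params K "N k" r "beta (N k)" "b (N k)" "\<tau> (N k)" using elim by simp
      have \<Lambda>k: "P.\<Lambda> = \<Lambda> k" by (simp add: \<Lambda>_def P.bt_info_eq)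
      have \<eta>k: "4 * b (N k) * P.\<eta> = 192 * (exp 1)\<^sup>2 * \<gamma> (N k)" unfolding P.\<eta>_def by (rule \<tau>\<gamma>)
      have mk: "P.m = m" by (simp add: P.m_def m_def)
      have "bt_lrt K (N k) r a \<le> U k * (1 + w k) * sum_sq_dev {2..r} (bt_outer K (N k) r (beta (N k)) a) + U k * \<rho> k \<and>
        sum_sq_dev {2..r} (bt_outer K (N k) r (beta (N k)) a) \<le> V k * (1 + w k) * bt_lrt K (N k) r a + \<rho> k"
        if a: "a \<in> E k" for a
      proof -
        have eq: "real (K * N k) * \<tau> (N k) / (8 * exp 1 * b (N k)) = K * (N k * sqrt (ln (N k) / N k))"
          using b4[OF N(1), of k] by (simp add: \<tau>_def)
        interpret D: bt_good_data K "N k" r "beta (N k)" "b (N k)" "\<tau> (N k)" a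
        proof
          show "a p \<le> K" if "p \<in> bt_pairs (N k)" for p
            using a that by (auto simp: E_def intro: set_pmf_bt_data)
          show "\<bar>bt_score K (N k) a (beta (N k)) i\<bar> \<le> real (K * N k) * \<tau> (N k) / (8 * exp 1 * b (N k))" if "i \<in> {1..N k}" for i
            using a that unfolding eq by (auto simp: E_def)
        qed
        show ?thesis
          using D.bt_lrt_sandwich(1,2)[OF wp, unfolded \<Lambda>k \<eta>k mk] elim by (simp add: U_def V_def \<rho>_def)
      qed
      moreover have "U k \<ge> 0"
        using P.small(5) unfolding \<eta>k by (simp add: U_def)
      moreover have "V k \<ge> 0"
      proof -
        have "exp (\<tau> (N k)) \<le> 1 + 2 * \<tau> (N k)" using exp_bound_lemma[of "\<tau> (N k)"] P.small(1) P.\<tau>(1) by simp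
        moreover have "K * m / \<Lambda> k \<le> 1/2" using elim by (simp add: pos_divide_le_eq)
        moreover have "0 \<le> 192 * (exp 1)\<^sup>2 * \<gamma> (N k)" unfolding \<eta>k[symmetric] using P.small(2) P.b by simp
        ultimately show ?thesis unfolding V_def using P.small(1) by (intro divide_nonneg_nonneg) auto
      qed
      ultimately show ?case using wp by simp
    qed
  qed
  then have "\<And>x. isCont (cdf (chi_square (r - 2))) x \<Longrightarrow>
      (\<lambda>k. cdf (measure_pmf (map_pmf (bt_lrt K (k + 2 * r) r) (bt_data K (k + 2 * r) (beta (k + 2 * r))))) x) \<longlonglongrightarrow> cdf (chi_square (r - 2)) x"
    unfolding weak_conv_m_def weak_conv_def N_def by blast
  then show ?thesis
    unfolding weak_conv_m_def weak_conv_def by (blast intro: LIMSEQ_offset)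
qed

end
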